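(* Let $s,t\ge1$ and $\nu\ge2$ be fixed integers, let $f_{i,j}\in L^1([-\pi,\pi],\mathbb{C}^{s\times t})$, $i,j=1,\dots,\nu$, and let $A_n=[T_{n_i,n_j}(f_{i,j})]_{i,j=1}^\nu$, where $n_1,\dots,n_\nu$ are positive integers (depending on $n$) with $n=\sum_{j=1}^\nu n_j$ and $\lim_{n\to\infty}\frac{n_j}{n}=c_j\in(0,1)$, $j=1,\dots,\nu$, $c_1+\cdots+c_\nu=1$. Assume that $c_1,\dots,c_\nu\in\mathbb{Q}^+$, $c_j=\frac{\alpha_j}{\beta_j}$ with $\alpha_j,\beta_j$ positive integers, $j=1,\dots,\nu$. Let $m=\mathrm{lcm}(\beta_1,\dots,\beta_\nu)$ and let $m_j$ be the positive integers with $c_j=\frac{m_j}{m}$, $j=1,\dots,\nu$. Set $F=(E_{j,k})_{j,k=1}^\nu$, where $$E_{j,k}=\begin{cases} I_{m_j}\otimes f_{j,j} & \text{if } j=k,\\[4pt] \begin{bmatrix} I_{m_j}\otimes f_{j,k} & O_{sm_j\times t(m_k-m_j)}\end{bmatrix} & \text{if } j\ne k \text{ and } m_k\ge m_j,\\[6pt] \begin{bmatrix} I_{m_k}\otimes f_{j,k}\\ O_{s(m_j-m_k)\times tm_k}\end{bmatrix} & \text{if } j\neq k\text{ and } m_j\ge m_k.\end{cases}$$ Then $$\{A_n\}_n\sim_\sigma F,$$ and $$\{A_n\}_n\sim_\lambda F$$ if in addition $A_n$ is Hermitian.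
   Context: Toeplitz matrices: for $f\in L^1([-\pi,\pi],\mathbb{C}^{s\times t})$ the Fourier coefficients are $\hat f_k=\frac1{2\pi}\int_{-\pi}^{\pi}f(\theta)e^{-\mathrm{i}k\theta}\,d\theta\in\mathbb{C}^{s\times t}$, $k\in\mathbb{Z}$; $T_{n,n'}(f)=[\hat f_{i-j}]_{i=1,\dots,n;\,j=1,\dots,n'}$ is the $sn\times tn'$ matrix. The $(i,j)$ block of $A_n$ is $T_{n_i,n_j}(f_{i,j})$, of size $sn_i\times tn_j$. $O_{a\times b}$ is the $a\times b$ zero matrix. The block $E_{j,k}$ takes values in $\mathbb{C}^{sm_j\times tm_k}$, so $F:[-\pi,\pi]\to\mathbb{C}^{sm\times tm}$. "$A_n$ is Hermitian" means for every $n$. Distributions: let $g:\Omega\to\mathbb{C}^{p\times q}$ be measurable on a measurable set $\Omega\subset\mathbb{R}^\ell$ with $0<m_\ell(\Omega)<\infty$ ($m_\ell$ Lebesgue measure), and $r=\min\{p,q\}$. For a matrix-sequence $\{B_n\}_n$ of increasing size, with $d_n$ the number of singular values $\sigma_j(B_n)$ of $B_n$ (minimum of the two dimensions), $\{B_n\}_n\sim_\sigma g$ means that for every continuous compactly supported $\Phi:[0,\infty)\to\mathbb{C}$ $$\lim_{n\to\infty}\frac1{d_n}\sum_{j=1}^{d_n}\Phi(\sigma_j(B_n))=\frac1{m_\ell(\Omega)}\int_\Omega\frac1r\sum_{i=1}^r\Phi(\sigma_i(g(\boldsymbol\theta)))\,d\boldsymbol\theta.$$ If $p=q$ and the $B_n$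 are square of size $d_n$ with eigenvalues $\lambda_j(B_n)$, $\{B_n\}_n\sim_\lambda g$ means that for every continuous compactly supported $\Phi:\mathbb{C}\to\mathbb{C}$ $$\lim_{n\to\infty}\frac1{d_n}\sum_{j=1}^{d_n}\Phi(\lambda_j(B_n))=\frac1{m_\ell(\Omega)}\int_\Omega\frac1p\sum_{i=1}^p\Phi(\lambda_i(g(\boldsymbol\theta)))\,d\boldsymbol\theta.$$ *)

theory Defs
  imports
    "HOL-Analysis.Analysis"
    "Jordan_Normal_Form.Char_Poly"
    "Jordan_Normal_Form.Schur_Decomposition"
begin

text \<open>All indices, of matrix entries and of blocks alike, start at 0: \<open>i = 1, \<dots>, \<nu>\<close> becomes
  \<open>i < \<nu>\<close>.\<close>

section \<open>Block matrices and Kronecker products\<close>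

definition kron :: "complex mat \<Rightarrow> complex mat \<Rightarrow> complex mat" where
  "kron A B = mat (dim_row A * dim_row B) (dim_col A * dim_col B)
     (\<lambda>(i, j). A $$ (i div dim_row B, j div dim_col B) * B $$ (i mod dim_row B, j mod dim_col B))"

definition append_cols :: "complex mat \<Rightarrow> complex mat \<Rightarrow> complex mat" where
  "append_cols A B = four_block_mat A B (0\<^sub>m 0 (dim_col A)) (0\<^sub>m 0 (dim_col B))"

text \<open>The block that contains the global index \<open>i\<close> when the blocks have sizes
  \<open>r 0, r 1, \<dots>\<close>; block \<open>b\<close> occupies the indices from \<open>sum r {..<b}\<close> up to, but not
  including, \<open>sum r {..b}\<close>.\<close>

definition block_index :: "(nat \<Rightarrow> nat) \<Rightarrow> nat \<Rightarrow> nat" where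
  "block_index r i = (LEAST b. i < sum r {..b})"

text \<open>The matrix of \<open>\<nu> \<times> \<nu>\<close> blocks, whose block \<open>(a, b)\<close> is \<open>B a b\<close>, of size
  \<open>r a \<times> c b\<close>.\<close>

definition block_mat ::
  "nat \<Rightarrow> (nat \<Rightarrow> nat) \<Rightarrow> (nat \<Rightarrow> nat) \<Rightarrow> (nat \<Rightarrow> nat \<Rightarrow> complex mat) \<Rightarrow> complex mat" where
  "block_mat \<nu> r c B = mat (sum r {..<\<nu>}) (sum c {..<\<nu>})
     (\<lambda>(i, j). let a = block_index r i; b = block_index c j
               in B a b $$ (i - sum r {..<a}, j - sum c {..<b}))"

definition hermitian_mat :: "complex mat \<Rightarrow> bool" where
  "hermitian_mat A \<longleftrightarrow> mat_adjoint A = A"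

section \<open>Toeplitz matrices\<close>

definition L1_mat :: "nat \<Rightarrow> nat \<Rightarrow> (real \<Rightarrow> complex mat) \<Rightarrow> bool" where
  "L1_mat s t f \<longleftrightarrow>
     (\<forall>\<theta>\<in>{-pi..pi}. f \<theta> \<in> carrier_mat s t) \<and>
     (\<forall>i<s. \<forall>j<t. (\<lambda>\<theta>. f \<theta> $$ (i, j)) absolutely_integrable_on {-pi..pi})"

definition fourier_coeff :: "nat \<Rightarrow> nat \<Rightarrow> (real \<Rightarrow> complex mat) \<Rightarrow> int \<Rightarrow> complex mat" where
  "fourier_coeff s t f k = mat s t (\<lambda>(i, j).
     1 / (2 * of_real pi) *
     (LINT \<theta>:{-pi..pi}|lebesgue. f \<theta> $$ (i, j) * exp (- \<i> * of_int k * of_real \<theta>)))"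

text \<open>The \<open>s n \<times> t n'\<close> matrix whose block \<open>(a, b)\<close> is the Fourier coefficient of index
  \<open>a - b\<close>.\<close>

definition toeplitz :: "nat \<Rightarrow> nat \<Rightarrow> nat \<Rightarrow> nat \<Rightarrow> (real \<Rightarrow> complex mat) \<Rightarrow> complex mat" where
  "toeplitz s t n n' f = mat (s * n) (t * n')
     (\<lambda>(i, j). fourier_coeff s t f (int (i div s) - int (j div t)) $$ (i mod s, j mod t))"

definition block_toeplitz ::
  "nat \<Rightarrow> nat \<Rightarrow> nat \<Rightarrow> (nat \<Rightarrow> nat) \<Rightarrow> (nat \<Rightarrow> nat \<Rightarrow> real \<Rightarrow> complex mat) \<Rightarrow> complex mat" where
  "block_toeplitz s t \<nu> ns f =
     block_mat \<nu> (\<lambda>i. s * ns i) (\<lambda>j. t * ns j) (\<lambda>i j. toeplitz s t (ns i) (ns j) (f i j))"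

section \<open>The symbol\<close>

definition E_block ::
  "nat \<Rightarrow> nat \<Rightarrow> (nat \<Rightarrow> nat) \<Rightarrow> (nat \<Rightarrow> nat \<Rightarrow> real \<Rightarrow> complex mat) \<Rightarrow>
   nat \<Rightarrow> nat \<Rightarrow> real \<Rightarrow> complex mat" where
  "E_block s t ms f j k \<theta> =
     (if j = k then kron (1\<^sub>m (ms j)) (f j j \<theta>)
      else if ms j \<le> ms k then
        append_cols (kron (1\<^sub>m (ms j)) (f j k \<theta>)) (0\<^sub>m (s * ms j) (t * (ms k - ms j)))
      else
        append_rows (kron (1\<^sub>m (ms k)) (f j k \<theta>)) (0\<^sub>m (s * (ms j - ms k)) (t * ms k)))"

definition F_symbol ::
  "nat \<Rightarrow> nat \<Rightarrow> nat \<Rightarrow> (nat \<Rightarrow> nat) \<Rightarrow> (nat \<Rightarrow> nat \<Rightarrow> real \<Rightarrow> complex mat) \<Rightarrow>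
   real \<Rightarrow> complex mat" where
  "F_symbol s t \<nu> ms f \<theta> =
     block_mat \<nu> (\<lambda>j. s * ms j) (\<lambda>k. t * ms k) (\<lambda>j k. E_block s t ms f j k \<theta>)"

section \<open>Eigenvalues, singular values and distributions\<close>

definition eigvals :: "complex mat \<Rightarrow> complex multiset" where
  "eigvals A = proots (char_poly A)"

text \<open>Of the two Gram matrices the smaller one is used, so that there are exactly
  \<open>min (dim_row A) (dim_col A)\<close> singular values, counted with multiplicity.\<close>

definition singvals :: "complex mat \<Rightarrow> real multiset" where
  "singvals A = image_mset (\<lambda>z. sqrt (Re z))
     (eigvals (if dim_col A \<le> dim_row A then mat_adjoint A * A else A * mat_adjoint A))"

definition measurable_mat ::
  "nat \<Rightarrow> nat \<Rightarrow> 'a::euclidean_space set \<Rightarrow> ('a \<Rightarrow> complex mat) \<Rightarrow> bool" where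
  "measurable_mat p q \<Omega> g \<longleftrightarrow>
     (\<forall>\<theta>\<in>\<Omega>. g \<theta> \<in> carrier_mat p q) \<and>
     (\<forall>i<p. \<forall>j<q. (\<lambda>\<theta>. g \<theta> $$ (i, j)) \<in> borel_measurable (lebesgue_on \<Omega>))"

text \<open>The conditions under which the distribution relations are meaningful (a domain of finite
  positive measure, a measurable symbol, a matrix-sequence whose size grows to infinity, square
  matrices for eigenvalues) are part of the relations. In particular all integrals below are
  integrals of bounded measurable functions.\<close>

definition singular_value_distr ::
  "nat \<Rightarrow> nat \<Rightarrow> (nat \<Rightarrow> complex mat) \<Rightarrow> 'a::euclidean_space set \<Rightarrow> ('a \<Rightarrow> complex mat) \<Rightarrow> bool" where
  "singular_value_distr p q B \<Omega> g \<longleftrightarrow>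
     0 < p \<and> 0 < q \<and> \<Omega> \<in> lmeasurable \<and> 0 < measure lebesgue \<Omega> \<and> measurable_mat p q \<Omega> g \<and>
     filterlim (\<lambda>n. min (dim_row (B n)) (dim_col (B n))) at_top sequentially \<and>
     (\<forall>\<Phi> :: real \<Rightarrow> complex.
        continuous_on {0..} \<Phi> \<and> compact (closure {x\<in>{0..}. \<Phi> x \<noteq> 0}) \<longrightarrow>
        (\<lambda>n. 1 / of_nat (min (dim_row (B n)) (dim_col (B n))) * (\<Sum>\<sigma>\<in>#singvals (B n). \<Phi> \<sigma>))
        \<longlonglongrightarrow> 1 / of_real (measure lebesgue \<Omega>) *
          (LINT \<theta>:\<Omega>|lebesgue. 1 / of_nat (min p q) * (\<Sum>\<sigma>\<in>#singvals (g \<theta>). \<Phi> \<sigma>)))"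

definition eigenvalue_distr ::
  "nat \<Rightarrow> (nat \<Rightarrow> complex mat) \<Rightarrow> 'a::euclidean_space set \<Rightarrow> ('a \<Rightarrow> complex mat) \<Rightarrow> bool" where
  "eigenvalue_distr p B \<Omega> g \<longleftrightarrow>
     0 < p \<and> \<Omega> \<in> lmeasurable \<and> 0 < measure lebesgue \<Omega> \<and> measurable_mat p p \<Omega> g \<and>
     (\<forall>n. square_mat (B n)) \<and> filterlim (\<lambda>n. dim_row (B n)) at_top sequentially \<and>
     (\<forall>\<Phi> :: complex \<Rightarrow> complex.
        continuous_on UNIV \<Phi> \<and> compact (closure {z. \<Phi> z \<noteq> 0}) \<longrightarrow>
        (\<lambda>n. 1 / of_nat (dim_row (B n)) * (\<Sum>z\<in>#eigvals (B n). \<Phi> z))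
        \<longlonglongrightarrow> 1 / of_real (measure lebesgue \<Omega>) *
          (LINT \<theta>:\<Omega>|lebesgue. 1 / of_nat p * (\<Sum>z\<in>#eigvals (g \<theta>). \<Phi> z)))"

end

theory Submission
  imports Defs
begin

text \<open>
  Both distribution relations are statements about Hermitian matrices: the eigenvalues are
  those of \<open>A n\<close>, the singular values are square roots of the eigenvalues of a Gram matrix.
  The proof follows only the resolvent traces \<open>tr (z - X)\<^sup>-\<^sup>1\<close>, the sum of
  \<open>1 / (z - x)\<close> over the eigenvalues \<open>x\<close>, for \<open>z\<close> off the real axis. This is enough, because
  the uniformly closed linear span of the constants and of the functions \<open>1 / (z - x)\<close> is an
  algebra and contains every continuous function of compact support (lemmas
  \<open>res_class_compact_support\<close> and \<open>distribution_from_resolvents\<close>).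

  Where the symbol comes from. An index of \<open>A n\<close> is a kind (a block and an index inside the
  \<open>s \<times> t\<close> coefficients) together with a position in the block. As the block sizes are
  about \<open>n * ms j / m\<close>, the positions are cut into slots of a common length \<open>k\<close>, about
  \<open>n / m\<close>; block \<open>j\<close> fills \<open>ms j\<close> slots and leaves \<open>o(n)\<close> positions over. If the symbol is a
  trigonometric polynomial, the matrix is banded in the positions. Deleting the entries
  between different slots and closing each slot up to a circulant then changes entries of
  total size \<open>o(n)\<close> (lemma \<open>toeplitz_circulant_distance\<close>), and a resolvent trace moves by at
  most that amount divided by \<open>(Im z)\<^sup>2\<close> (lemma \<open>tr_resolvent_entry_perturbation\<close>).
  The circulant matrix is block diagonal in the Fourier basis. Its block at the frequency
  \<open>\<theta>\<close> is indexed by the pairs of a kind and a slot, with entry \<open>f j k \<theta>\<close> if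
  the slots agree and \<open>0\<close> otherwise: it is \<open>F(\<theta>)\<close>, up to the order of the indices.
  The resolvent trace is therefore a Riemann sum of the resolvent trace of \<open>F(\<theta>)\<close>.

  General symbols. Trigonometric polynomials are dense in \<open>L\<^sup>1\<close>, and the resolvent
  traces are stable under \<open>L\<^sup>1\<close> perturbations of the symbol: a Toeplitz matrix is the
  mean over \<open>\<theta>\<close> of the symbol at \<open>\<theta>\<close> times matrices of rank one that are built
  from vectors with entries of modulus at most one (lemma \<open>toeplitz_trace_bound\<close>). Theorem
  \<open>resolvent_limit\<close> combines the two.

  Singular values. The dilation of \<open>A n\<close>, with blocks \<open>0\<close>, \<open>A n\<close>, its adjoint and \<open>0\<close>, is a
  Hermitian matrix of the same type whose kinds are those of the rows and of the columns
  together, and its resolvent trace at \<open>z\<close> determines that of the Gram matrix at \<open>z\<^sup>2\<close>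
  (lemma \<open>tr_resolvent_gram\<close>).

  Eigenvalues. If all \<open>A n\<close> are Hermitian, the symbol and its Hermitian symmetrisation have
  the same Fourier coefficients, so they agree almost everywhere. The uniqueness theorem
  that this needs is itself a consequence of \<open>resolvent_limit\<close>: for a real symbol with
  vanishing coefficients all the Toeplitz matrices are zero, and the limit of their
  resolvent traces at \<open>\<i>\<close> forces the symbol to vanish.
\<close>

section \<open>Traces and resolvents of Hermitian matrices\<close>

definition tr :: "complex mat \<Rightarrow> complex" where
  "tr A = (\<Sum>i<dim_row A. A $$ (i, i))"

lemma mat_adjoint_dim [simp]:
  "dim_row (mat_adjoint A) = dim_col A" "dim_col (mat_adjoint A) = dim_row A"
  by (auto simp: mat_adjoint_def)

lemma mat_adjoint_carrier [simp]: "A \<in> carrier_mat r c \<Longrightarrow> mat_adjoint A \<in> carrier_mat c r"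
  unfolding carrier_mat_def by auto

lemma mat_adjoint_index [simp]:
  fixes A :: "complex mat"
  assumes "i < dim_col A" "j < dim_row A"
  shows "mat_adjoint A $$ (i, j) = cnj (A $$ (j, i))"
  using assms by (simp add: mat_adjoint_def mat_of_rows_index conjugate_complex_def)

lemma hermitian_mat_iff:
  "hermitian_mat A \<longleftrightarrow> dim_row A = dim_col A \<and>
     (\<forall>i<dim_row A. \<forall>j<dim_row A. A $$ (i, j) = cnj (A $$ (j, i)))"
proof
  assume h: "hermitian_mat A"
  hence e: "mat_adjoint A = A" by (simp add: hermitian_mat_def)
  have d: "dim_row A = dim_col A" using arg_cong[OF e, of dim_row] by simp
  have "A $$ (i, j) = cnj (A $$ (j, i))" if "i < dim_row A" "j < dim_row A" for i j
    using mat_adjoint_index[of i A j] that d unfolding e by simp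
  thus "dim_row A = dim_col A \<and>
     (\<forall>i<dim_row A. \<forall>j<dim_row A. A $$ (i, j) = cnj (A $$ (j, i)))"
    using d by blast
next
  assume "dim_row A = dim_col A \<and>
     (\<forall>i<dim_row A. \<forall>j<dim_row A. A $$ (i, j) = cnj (A $$ (j, i)))"
  hence d: "dim_row A = dim_col A"
    and h: "\<And>i j. i < dim_row A \<Longrightarrow> j < dim_row A \<Longrightarrow> A $$ (i, j) = cnj (A $$ (j, i))" by blast+
  show "hermitian_mat A" unfolding hermitian_mat_def
  proof (rule eq_matI)
    fix i j assume "i < dim_row A" "j < dim_col A"
    thus "mat_adjoint A $$ (i, j) = A $$ (i, j)" using d h[of i j] by simp
  qed (use d in auto)
qed

lemma hermitian_matD:
  assumes "hermitian_mat A" "A \<in> carrier_mat d d" "i < d" "j < d"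
  shows "A $$ (i, j) = cnj (A $$ (j, i))"
  using assms unfolding hermitian_mat_iff by blast

lemma hermitian_matI:
  assumes "A \<in> carrier_mat d d" "\<And>i j. i < d \<Longrightarrow> j < d \<Longrightarrow> A $$ (i, j) = cnj (A $$ (j, i))"
  shows "hermitian_mat A"
  unfolding hermitian_mat_iff carrier_matD[OF assms(1)] using assms(2) by blast

lemma scalar_minus_carrier [simp]:
  fixes X :: "complex mat"
  shows "X \<in> carrier_mat d d \<Longrightarrow> z \<cdot>\<^sub>m 1\<^sub>m d - X \<in> carrier_mat d d"
  by (rule minus_carrier_mat)

abbreviation enorm :: "nat \<Rightarrow> (nat \<Rightarrow> complex) \<Rightarrow> real" where
  "enorm d u \<equiv> L2_set (\<lambda>i. cmod (u i)) {..<d}"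

lemma cauchy_schwarz: "cmod (\<Sum>i<d. u i * v i) \<le> enorm d u * enorm d v"
proof -
  have "cmod (\<Sum>i<d. u i * v i) \<le> (\<Sum>i<d. \<bar>cmod (u i)\<bar> * \<bar>cmod (v i)\<bar>)"
    by (rule order_trans[OF norm_sum]) (simp add: norm_mult)
  also have "\<dots> \<le> enorm d u * enorm d v" by (rule L2_set_mult_ineq)
  finally show ?thesis .
qed

lemma enorm_square: "complex_of_real ((enorm d u)\<^sup>2) = (\<Sum>i<d. cnj (u i) * u i)"
  by (simp add: L2_set_def real_sqrt_pow2 sum_nonneg)
     (intro sum.cong refl, metis complex_norm_square mult.commute of_real_power)

text \<open>The quadratic form of a Hermitian matrix is real, so the imaginary part of the inner
  product of \<open>u\<close> and \<open>v = (z - X) u\<close> is \<open>Im z\<close> times the squared norm of \<open>u\<close>. This one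
  estimate gives both the invertibility of \<open>z - X\<close> and the bound of its inverse.\<close>

lemma hermitian_energy:
  assumes herm: "\<And>i j. i < d \<Longrightarrow> j < d \<Longrightarrow> X i j = cnj (X j i)"
    and v: "\<And>i. i < d \<Longrightarrow> v i = z * u i - (\<Sum>j<d. X i j * u j)"
  shows "\<bar>Im z\<bar> * enorm d u \<le> enorm d v"
proof (cases "enorm d u = 0")
  case True
  then show ?thesis by (simp add: L2_set_nonneg)
next
  case False
  hence pos: "enorm d u > 0" using L2_set_nonneg[of "\<lambda>i. cmod (u i)" "{..<d}"] by linarith
  define Q where "Q = (\<Sum>i<d. \<Sum>j<d. cnj (u i) * X i j * u j)"
  have "cnj Q = (\<Sum>i<d. \<Sum>j<d. cnj (cnj (u i) * X i j * u j))"
    unfolding Q_def cnj_sum ..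
  also have "\<dots> = (\<Sum>i<d. \<Sum>j<d. cnj (u j) * X j i * u i)"
  proof (intro sum.cong refl)
    fix i j assume "i \<in> {..<d}" "j \<in> {..<d}"
    hence "X j i = cnj (X i j)" by (intro herm) auto
    thus "cnj (cnj (u i) * X i j * u j) = cnj (u j) * X j i * u i" by simp
  qed
  also have "\<dots> = Q" unfolding Q_def by (subst sum.swap) simp
  finally have Q: "Im Q = 0" by (metis Reals_cnj_iff complex_is_Real_iff)
  have "(\<Sum>i<d. cnj (u i) * v i) = (\<Sum>i<d. z * (cnj (u i) * u i) - (\<Sum>j<d. cnj (u i) * X i j * u j))"
    by (intro sum.cong refl) (simp add: v algebra_simps sum_distrib_left)
  also have "\<dots> = z * complex_of_real ((enorm d u)\<^sup>2) - Q"
    by (simp add: sum_subtractf enorm_square Q_def sum_distrib_left del: of_real_power)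
  finally have S: "(\<Sum>i<d. cnj (u i) * v i) = z * complex_of_real ((enorm d u)\<^sup>2) - Q" .
  have "\<bar>Im z\<bar> * (enorm d u)\<^sup>2 = \<bar>Im (\<Sum>i<d. cnj (u i) * v i)\<bar>"
    unfolding S by (simp add: Q abs_mult del: of_real_power)
  also have "\<dots> \<le> cmod (\<Sum>i<d. cnj (u i) * v i)" by (rule abs_Im_le_cmod)
  also have "\<dots> \<le> enorm d (\<lambda>i. cnj (u i)) * enorm d v" by (rule cauchy_schwarz)
  also have "\<dots> = enorm d u * enorm d v" by simp
  finally show ?thesis using pos by (simp add: power2_eq_square)
qed

text \<open>The spectral norm of \<open>M\<close> is at most \<open>b\<close>.\<close>

definition op_bound :: "nat \<Rightarrow> complex mat \<Rightarrow> real \<Rightarrow> bool" where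
  "op_bound d M b \<longleftrightarrow> (\<forall>v. enorm d (\<lambda>i. \<Sum>j<d. M $$ (i, j) * v j) \<le> b * enorm d v)"

lemma op_bound_bilinear:
  assumes "op_bound d M b"
  shows "cmod (\<Sum>i<d. \<Sum>j<d. u i * M $$ (i, j) * v j) \<le> b * enorm d u * enorm d v"
proof -
  have "(\<Sum>i<d. \<Sum>j<d. u i * M $$ (i, j) * v j) = (\<Sum>i<d. u i * (\<Sum>j<d. M $$ (i, j) * v j))"
    by (simp add: sum_distrib_left mult.assoc)
  also have "cmod \<dots> \<le> enorm d u * enorm d (\<lambda>i. \<Sum>j<d. M $$ (i, j) * v j)"
    by (rule cauchy_schwarz)
  also have "\<dots> \<le> enorm d u * (b * enorm d v)"
    using assms unfolding op_bound_def by (intro mult_left_mono) (auto simp: L2_set_nonneg)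
  finally show ?thesis by (simp add: mult_ac)
qed

lemma enorm_delta:
  assumes "j < d"
  shows "enorm d (\<lambda>i. if i = j then 1 else 0) = 1"
proof -
  have "(\<Sum>i<d. (cmod (if i = j then 1 else 0))\<^sup>2) = (\<Sum>i<d. if i = j then 1 else 0)"
    by (intro sum.cong) auto
  thus ?thesis using assms by (simp add: L2_set_def)
qed

lemma op_bound_entry:
  assumes "op_bound d M b" "i < d" "j < d"
  shows "cmod (M $$ (i, j)) \<le> b"
proof -
  let ?e = "\<lambda>k i. if i = k then 1 else (0::complex)"
  have "(\<Sum>k<d. \<Sum>l<d. ?e i k * M $$ (k, l) * ?e j l) = (\<Sum>k<d. if k = i then \<Sum>l<d. if l = j then M $$ (k, l) else 0 else 0)"
    by (intro sum.cong refl, simp add: if_distrib[where f = "\<lambda>x. _ * x"] if_distrib[where f = "\<lambda>x. x * _"] cong: if_cong)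
  also have "\<dots> = M $$ (i, j)" using assms by simp
  finally show ?thesis
    using op_bound_bilinear[OF assms(1), of "?e i" "?e j"] assms by (simp add: enorm_delta)
qed

lemma mat_mult_index_sum:
  assumes "M \<in> carrier_mat r d" "N \<in> carrier_mat d c" "i < r" "j < c"
  shows "(M * N) $$ (i, j) = (\<Sum>k<d. M $$ (i, k) * N $$ (k, j))"
  using assms by (auto simp: scalar_prod_def lessThan_atLeast0 intro!: sum.cong)

lemma op_bound_mult:
  assumes M: "M \<in> carrier_mat d d" "op_bound d M b" and N: "N \<in> carrier_mat d d" "op_bound d N b'"
    and b: "b \<ge> 0"
  shows "op_bound d (M * N) (b * b')"
  unfolding op_bound_def
proof
  fix v
  define w where "w = (\<lambda>i. \<Sum>j<d. N $$ (i, j) * v j)"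
  have "(\<Sum>j<d. (M * N) $$ (i, j) * v j) = (\<Sum>k<d. M $$ (i, k) * w k)" if "i < d" for i
  proof -
    have "(\<Sum>j<d. (M * N) $$ (i, j) * v j) = (\<Sum>j<d. \<Sum>k<d. M $$ (i, k) * N $$ (k, j) * v j)"
      using M N that by (intro sum.cong refl) (simp add: mat_mult_index_sum[of _ d d _ d] sum_distrib_right del: index_mult_mat(1))
    also have "\<dots> = (\<Sum>k<d. M $$ (i, k) * w k)"
      by (subst sum.swap) (simp add: w_def sum_distrib_left mult.assoc)
    finally show ?thesis .
  qed
  hence "enorm d (\<lambda>i. \<Sum>j<d. (M * N) $$ (i, j) * v j) = enorm d (\<lambda>i. \<Sum>k<d. M $$ (i, k) * w k)"
    by (intro L2_set_cong) auto
  also have "\<dots> \<le> b * enorm d w" using M by (auto simp: op_bound_def)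
  also have "\<dots> \<le> b * (b' * enorm d v)"
    unfolding w_def using N b by (intro mult_left_mono) (auto simp: op_bound_def)
  finally show "enorm d (\<lambda>i. \<Sum>j<d. (M * N) $$ (i, j) * v j) \<le> b * b' * enorm d v"
    by (simp add: mult_ac)
qed

lemma tr_mult:
  assumes "M \<in> carrier_mat r c" "N \<in> carrier_mat c r"
  shows "tr (M * N) = (\<Sum>i<r. \<Sum>j<c. M $$ (i, j) * N $$ (j, i))"
  using assms unfolding tr_def
  by (auto simp: mat_mult_index_sum[of _ r c _ r] simp del: index_mult_mat(1) intro!: sum.cong)

lemma tr_comm:
  assumes "M \<in> carrier_mat r c" "N \<in> carrier_mat c r"
  shows "tr (M * N) = tr (N * M)"
  unfolding tr_mult[OF assms] tr_mult[OF assms(2,1)]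
  by (subst sum.swap) (simp add: mult.commute)

lemma tr_minus:
  assumes "M \<in> carrier_mat d d" "N \<in> carrier_mat d d"
  shows "tr (M - N) = tr M - tr N"
  using assms by (auto simp: tr_def sum_subtractf)

lemma cmod_tr_mult_le_entries:
  assumes "M \<in> carrier_mat d d" "N \<in> carrier_mat d d" "op_bound d M b"
  shows "cmod (tr (M * N)) \<le> b * (\<Sum>i<d. \<Sum>j<d. cmod (N $$ (i, j)))"
proof -
  have "cmod (tr (M * N)) \<le> (\<Sum>i<d. \<Sum>j<d. cmod (M $$ (i, j)) * cmod (N $$ (j, i)))"
    unfolding tr_mult[OF assms(1,2)]
    by (intro order_trans[OF norm_sum] sum_mono) (simp add: norm_mult)
  also have "\<dots> \<le> (\<Sum>i<d. \<Sum>j<d. b * cmod (N $$ (j, i)))"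
    using op_bound_entry[OF assms(3)] by (intro sum_mono mult_right_mono) auto
  also have "\<dots> = b * (\<Sum>i<d. \<Sum>j<d. cmod (N $$ (i, j)))"
    by (subst sum.swap) (simp add: sum_distrib_left)
  finally show ?thesis .
qed

text \<open>The inverse of \<open>z - X\<close>, written with the adjugate so that its trace is a rational function
  of the entries of \<open>X\<close>; measurability in a parameter is then immediate.\<close>

definition resolvent :: "complex mat \<Rightarrow> complex \<Rightarrow> complex mat" where
  "resolvent X z = (let K = z \<cdot>\<^sub>m 1\<^sub>m (dim_row X) - X in (1 / Determinant.det K) \<cdot>\<^sub>m adj_mat K)"

abbreviation rtr :: "complex mat \<Rightarrow> complex \<Rightarrow> complex" where
  "rtr X z \<equiv> tr (resolvent X z)"

lemma resolvent_carrier [simp]: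
  assumes "X \<in> carrier_mat d d"
  shows "resolvent X z \<in> carrier_mat d d"
  using assms adj_mat(1)[of "z \<cdot>\<^sub>m 1\<^sub>m d - X" d]
  by (simp add: resolvent_def Let_def carrier_matD(1)[OF assms])

lemma hermitian_det_nonzero:
  assumes X: "X \<in> carrier_mat d d" "hermitian_mat X" and z: "Im z \<noteq> 0"
  shows "Determinant.det (z \<cdot>\<^sub>m 1\<^sub>m d - X) \<noteq> 0"
proof
  let ?K = "z \<cdot>\<^sub>m 1\<^sub>m d - X"
  assume "Determinant.det ?K = 0"
  then obtain v where v: "v \<in> carrier_vec d" "v \<noteq> 0\<^sub>v d" "?K *\<^sub>v v = 0\<^sub>v d"
    using det_0_iff_vec_prod_zero[OF scalar_minus_carrier[OF X(1)]] by auto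
  have "\<bar>Im z\<bar> * enorm d (\<lambda>i. vec_index v i) \<le> enorm d (\<lambda>i. 0)"
  proof (rule hermitian_energy)
    show "X $$ (i, j) = cnj (X $$ (j, i))" if "i < d" "j < d" for i j
      using X that by (intro hermitian_matD)
    show "0 = z * vec_index v i - (\<Sum>j<d. X $$ (i, j) * vec_index v j)" if i: "i < d" for i
    proof -
      have "0 = vec_index (?K *\<^sub>v v) i" unfolding v(3) using i by simp
      also have "\<dots> = (\<Sum>j<d. ?K $$ (i, j) * vec_index v j)"
        using X v(1) i by (auto simp: scalar_prod_def lessThan_atLeast0 intro!: sum.cong)
      also have "\<dots> = (\<Sum>j<d. (if j = i then z * vec_index v j else 0) - X $$ (i, j) * vec_index v j)"
        using X i by (intro sum.cong) (auto simp: algebra_simps)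
      also have "\<dots> = z * vec_index v i - (\<Sum>j<d. X $$ (i, j) * vec_index v j)"
        using i by (simp add: sum_subtractf)
      finally show ?thesis .
    qed
  qed
  hence "enorm d (\<lambda>i. vec_index v i) = 0"
    using z L2_set_nonneg[of "\<lambda>i. cmod (vec_index v i)" "{..<d}"]
    by (simp add: L2_set_def mult_le_0_iff)
  hence "\<forall>i<d. vec_index v i = 0" by (simp add: L2_set_eq_0_iff)
  hence "v = 0\<^sub>v d" using v(1) by (intro eq_vecI) auto
  with v(2) show False by simp
qed

lemma resolvent_inverse:
  assumes X: "X \<in> carrier_mat d d" and nz: "Determinant.det (z \<cdot>\<^sub>m 1\<^sub>m d - X) \<noteq> 0"
  shows "(z \<cdot>\<^sub>m 1\<^sub>m d - X) * resolvent X z = 1\<^sub>m d"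
    and "resolvent X z * (z \<cdot>\<^sub>m 1\<^sub>m d - X) = 1\<^sub>m d"
proof -
  let ?K = "z \<cdot>\<^sub>m 1\<^sub>m d - X"
  have K: "?K \<in> carrier_mat d d" using X by auto
  have r: "resolvent X z = (1 / Determinant.det ?K) \<cdot>\<^sub>m adj_mat ?K"
    using X by (auto simp: resolvent_def Let_def)
  note a = adj_mat[OF K]
  show "?K * resolvent X z = 1\<^sub>m d" "resolvent X z * ?K = 1\<^sub>m d"
    unfolding r using K a nz
    by (simp_all add: mult_smult_distrib[of _ d d _ d] mult_smult_assoc_mat[of _ d d _ d])
       (auto intro!: eq_matI)
qed

lemma resolvent_unique:
  assumes X: "X \<in> carrier_mat d d" and R: "R \<in> carrier_mat d d"
    and KR: "(z \<cdot>\<^sub>m 1\<^sub>m d - X) * R = 1\<^sub>m d"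
  shows "resolvent X z = R"
proof -
  let ?K = "z \<cdot>\<^sub>m 1\<^sub>m d - X"
  have K: "?K \<in> carrier_mat d d" using X by auto
  have "Determinant.det ?K * Determinant.det R = 1"
    using det_mult[OF K R] KR by simp
  hence nz: "Determinant.det ?K \<noteq> 0" by auto
  note i = resolvent_inverse[OF X nz]
  have "resolvent X z = resolvent X z * (?K * R)"
    using right_mult_one_mat[OF resolvent_carrier[OF X, of z]] KR by simp
  also have "\<dots> = R" using i X K R by (simp flip: assoc_mult_mat[of _ d d _ d _ d])
  finally show ?thesis .
qed

lemma resolvent_op_bound:
  assumes X: "X \<in> carrier_mat d d" "hermitian_mat X" and z: "Im z \<noteq> 0"
  shows "op_bound d (resolvent X z) (1 / \<bar>Im z\<bar>)"
  unfolding op_bound_def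
proof
  fix v
  let ?R = "resolvent X z" and ?K = "z \<cdot>\<^sub>m 1\<^sub>m d - X"
  have R: "?R \<in> carrier_mat d d" and K: "?K \<in> carrier_mat d d" using X by auto
  define u where "u = (\<lambda>i. \<Sum>j<d. ?R $$ (i, j) * v j)"
  have "\<bar>Im z\<bar> * enorm d u \<le> enorm d v"
  proof (rule hermitian_energy)
    show "X $$ (i, j) = cnj (X $$ (j, i))" if "i < d" "j < d" for i j
      using X that by (intro hermitian_matD)
    show "v i = z * u i - (\<Sum>j<d. X $$ (i, j) * u j)" if i: "i < d" for i
    proof -
      have "z * u i - (\<Sum>j<d. X $$ (i, j) * u j) = (\<Sum>j<d. (if j = i then z * u j else 0) - X $$ (i, j) * u j)"
        using i by (simp add: sum_subtractf)
      also have "\<dots> = (\<Sum>j<d. ?K $$ (i, j) * u j)"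
        using X i by (intro sum.cong) (auto simp: algebra_simps)
      also have "\<dots> = (\<Sum>j<d. \<Sum>k<d. ?K $$ (i, j) * ?R $$ (j, k) * v k)"
        by (simp add: u_def sum_distrib_left mult.assoc)
      also have "\<dots> = (\<Sum>k<d. (?K * ?R) $$ (i, k) * v k)"
        using i by (subst sum.swap, intro sum.cong refl)
          (simp add: mat_mult_index_sum[OF K R] sum_distrib_right del: index_minus_mat)
      also have "\<dots> = (\<Sum>k<d. if k = i then v k else 0)"
        using i resolvent_inverse[OF X(1) hermitian_det_nonzero[OF X z]]
        by (intro sum.cong) auto
      finally show ?thesis using i by simp
    qed
  qed
  thus "enorm d (\<lambda>i. \<Sum>j<d. ?R $$ (i, j) * v j) \<le> 1 / \<bar>Im z\<bar> * enorm d v"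
    using z unfolding u_def by (simp add: field_simps)
qed

text \<open>The second resolvent identity, with the factors rotated under the trace so that the two
  resolvents together form one bounded factor.\<close>

lemma tr_resolvent_diff:
  assumes X: "X \<in> carrier_mat d d" "hermitian_mat X" and Y: "Y \<in> carrier_mat d d" "hermitian_mat Y"
    and z: "Im z \<noteq> 0"
  shows "rtr X z - rtr Y z
       = tr (resolvent Y z * resolvent X z * (X - Y))"
    and "op_bound d (resolvent Y z * resolvent X z) (1 / (Im z)\<^sup>2)"
proof -
  let ?RX = "resolvent X z" and ?RY = "resolvent Y z"
  let ?KX = "z \<cdot>\<^sub>m 1\<^sub>m d - X" and ?KY = "z \<cdot>\<^sub>m 1\<^sub>m d - Y"
  note iX = resolvent_inverse[OF X(1) hermitian_det_nonzero[OF X z]]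
  note iY = resolvent_inverse[OF Y(1) hermitian_det_nonzero[OF Y z]]
  have c: "?RX \<in> carrier_mat d d" "?RY \<in> carrier_mat d d" "?KX \<in> carrier_mat d d" "?KY \<in> carrier_mat d d"
    using X Y by auto
  have e: "X - Y = ?KY - ?KX" using X Y by (intro eq_matI) auto
  have "?RX * (X - Y) * ?RY = (?RX * ?KY - ?RX * ?KX) * ?RY"
    unfolding e using c by (simp add: mult_minus_distrib_mat[of _ d d _ d])
  also have "\<dots> = ?RX * ?KY * ?RY - 1\<^sub>m d * ?RY"
    using c iX by (subst minus_mult_distrib_mat[of _ d d _ _ d]) auto
  also have "?RX * ?KY * ?RY = ?RX" using c iY by (subst assoc_mult_mat[of _ d d _ d _ d]) auto
  finally have "?RX * (X - Y) * ?RY = ?RX - ?RY" using c by simp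
  hence "tr ?RX - tr ?RY = tr (?RX * (X - Y) * ?RY)" using c by (simp add: tr_minus)
  also have "\<dots> = tr (?RY * (?RX * (X - Y)))"
    using c X Y by (intro tr_comm[of _ d d] mult_carrier_mat[of _ d d] minus_carrier_mat) auto
  also have "?RY * (?RX * (X - Y)) = ?RY * ?RX * (X - Y)"
    using c X Y by (subst assoc_mult_mat[of _ d d _ d _ d]) (auto intro!: minus_carrier_mat)
  finally show "tr ?RX - tr ?RY = tr (?RY * ?RX * (X - Y))" .
  show "op_bound d (?RY * ?RX) (1 / (Im z)\<^sup>2)"
    using op_bound_mult[OF c(2) resolvent_op_bound[OF Y z] c(1) resolvent_op_bound[OF X z]]
    by (simp add: power2_eq_square abs_mult_self_eq)
qed

text \<open>Resolvent traces do not see \<open>o(d)\<close> changes of bounded entries once they are divided by the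
  dimension \<open>d\<close>.\<close>

lemma tr_resolvent_entry_perturbation:
  assumes X: "X \<in> carrier_mat d d" "hermitian_mat X" and Y: "Y \<in> carrier_mat d d" "hermitian_mat Y"
    and z: "Im z \<noteq> 0"
  shows "cmod (rtr X z - rtr Y z)
       \<le> (\<Sum>i<d. \<Sum>j<d. cmod (X $$ (i, j) - Y $$ (i, j))) / (Im z)\<^sup>2"
proof -
  have c: "resolvent Y z * resolvent X z \<in> carrier_mat d d" "X - Y \<in> carrier_mat d d"
    using X Y by (auto intro!: mult_carrier_mat[of _ d d] minus_carrier_mat)
  have "(\<Sum>i<d. \<Sum>j<d. cmod ((X - Y) $$ (i, j))) = (\<Sum>i<d. \<Sum>j<d. cmod (X $$ (i, j) - Y $$ (i, j)))"
    using X Y by (intro sum.cong) auto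
  thus ?thesis
    using cmod_tr_mult_le_entries[OF c tr_resolvent_diff(2)[OF X Y z]]
    unfolding tr_resolvent_diff(1)[OF X Y z] by simp
qed

lemma tr_resolvent_bound:
  assumes X: "X \<in> carrier_mat d d" "hermitian_mat X" and z: "Im z \<noteq> 0"
  shows "cmod (rtr X z) \<le> real d / \<bar>Im z\<bar>"
proof -
  have "cmod (rtr X z) \<le> (\<Sum>i<d. cmod (resolvent X z $$ (i, i)))"
    using resolvent_carrier[OF X(1), of z] unfolding tr_def by (auto intro: norm_sum)
  also have "\<dots> \<le> (\<Sum>i<d. 1 / \<bar>Im z\<bar>)"
    by (intro sum_mono op_bound_entry[OF resolvent_op_bound[OF X z]]) auto
  finally show ?thesis by simp
qed

lemma poly_char_poly:
  fixes X :: "complex mat"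
  assumes "X \<in> carrier_mat d d"
  shows "poly (char_poly X) z = Determinant.det (z \<cdot>\<^sub>m 1\<^sub>m d - X)"
proof -
  have "poly (char_poly X) z = Determinant.det (- (char_matrix X z))" by (rule char_poly_matrix[OF assms])
  also have "- (char_matrix X z) = z \<cdot>\<^sub>m 1\<^sub>m d - X"
    using assms by (intro eq_matI) (auto simp: char_matrix_def)
  finally show ?thesis .
qed

text \<open>The logarithmic derivative of a product of linear factors.\<close>

lemma sum_mset_inverse_proots:
  fixes p :: "complex poly"
  assumes "p \<noteq> 0" "poly p z \<noteq> 0"
  shows "(\<Sum>x\<in>#proots p. 1 / (z - x)) = poly (pderiv p) z / poly p z"
proof -
  have *: "poly (pderiv (\<Prod>x\<in>#M. [:- x, 1:])) z = (\<Sum>x\<in>#M. 1 / (z - x)) * poly (\<Prod>x\<in>#M. [:- x, 1:]) z"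
    if "\<forall>x\<in>#M. z \<noteq> x" for M :: "complex multiset"
    using that
  proof (induction M)
    case (add y M)
    let ?P = "poly (\<Prod>x\<in>#M. [:- x, 1:]) z"
    have "z - y \<noteq> 0" using add by auto
    hence "(z - y) * (S * ?P) + ?P = (1 / (z - y) + S) * ((z - y) * ?P)" for S
      by (simp add: field_simps)
    from this[of "\<Sum>x\<in>#M. 1 / (z - x)"]
    have "(z - y) * ((\<Sum>x\<in>#M. 1 / (z - x)) * ?P) + ?P = (1 / (z - y) + (\<Sum>x\<in>#M. 1 / (z - x))) * ((z - y) * ?P)" .
    thus ?case using add by (simp add: pderiv_mult pderiv_pCons del: mult_pCons_left)
  qed auto
  define q where "q = (\<Prod>x\<in>#proots p. [:- x, 1:])"
  have p: "p = Polynomial.smult (lead_coeff p) q"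
    unfolding q_def by (rule complex_poly_decompose_multiset[symmetric])
  have "\<forall>x\<in>#proots p. z \<noteq> x" using assms by (auto)
  hence q: "poly (pderiv q) z = (\<Sum>x\<in>#proots p. 1 / (z - x)) * poly q z"
    unfolding q_def by (rule *)
  have nz: "lead_coeff p \<noteq> 0" "poly q z \<noteq> 0" using p assms by (auto, metis mult_zero_right poly_smult)
  have "poly (pderiv p) z / poly p z = poly (pderiv (Polynomial.smult (lead_coeff p) q)) z / poly (Polynomial.smult (lead_coeff p) q) z"
    using p by simp
  also have "\<dots> = (\<Sum>x\<in>#proots p. 1 / (z - x))"
    using nz by (simp add: pderiv_smult q)
  finally show ?thesis by simp
qed

text \<open>The derivative of the characteristic polynomial is the sum of the principal minors of
  \<open>z - X\<close> of size \<open>d - 1\<close>, which are the diagonal entries of the adjugate. Its quotient by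
  the determinant is the trace of the inverse on one side and the logarithmic derivative on
  the other.\<close>

lemma eigvals_resolvent_sum:
  assumes X: "X \<in> carrier_mat d d" "hermitian_mat X" and z: "Im z \<noteq> 0"
  shows "(\<Sum>x\<in>#eigvals X. 1 / (z - x)) = rtr X z"
proof -
  let ?K = "z \<cdot>\<^sub>m 1\<^sub>m d - X"
  note nz = hermitian_det_nonzero[OF X z]
  have pz: "poly (char_poly X) z \<noteq> 0" using nz poly_char_poly[OF X(1)] by simp
  have "poly (pderiv (char_poly X)) z = (\<Sum>i<d. poly (char_poly (mat_delete X i i)) z)"
    using pderiv_char_poly[OF X(1)] by (simp add: poly_sum)
  also have "\<dots> = (\<Sum>i<d. cofactor ?K i i)"
  proof (intro sum.cong refl)
    fix i assume "i \<in> {..<d}"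
    hence i: "i < d" by simp
    have m: "mat_delete X i i \<in> carrier_mat (d - 1) (d - 1)" using X by auto
    have "z \<cdot>\<^sub>m 1\<^sub>m (d - 1) - mat_delete X i i = mat_delete ?K i i"
      using X i by (intro eq_matI) (auto simp: mat_delete_def)
    thus "poly (char_poly (mat_delete X i i)) z = cofactor ?K i i"
      unfolding poly_char_poly[OF m] cofactor_def by (simp add: mult_2[symmetric])
  qed
  finally have "(\<Sum>x\<in>#eigvals X. 1 / (z - x)) = (\<Sum>i<d. cofactor ?K i i) / Determinant.det ?K"
    unfolding eigvals_def using pz sum_mset_inverse_proots[of "char_poly X" z] poly_char_poly[OF X(1)]
    by force
  also have "\<dots> = rtr X z"
    using X unfolding tr_def resolvent_def by (simp add: Let_def adj_mat_def sum_divide_distrib)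
  finally show ?thesis .
qed

lemma eigvals_hermitian_real:
  assumes X: "X \<in> carrier_mat d d" "hermitian_mat X" and x: "x \<in># eigvals X"
  shows "Im x = 0"
proof (rule ccontr)
  assume "Im x \<noteq> 0"
  hence "poly (char_poly X) x \<noteq> 0"
    using hermitian_det_nonzero[OF X] poly_char_poly[OF X(1)] by simp
  moreover from this have "char_poly X \<noteq> 0" by auto
  ultimately show False using x by (simp add: eigvals_def)
qed

lemma size_eigvals:
  assumes "X \<in> carrier_mat d d"
  shows "size (eigvals X) = d"
  using degree_monic_char_poly[OF assms] by (simp add: eigvals_def size_proots_complex)

section \<open>Circulant matrices\<close>

lemma sum_cis_roots:
  fixes l :: int
  assumes k: "k > 0"
  shows "(\<Sum>q<k. cis (2 * pi * real_of_int l * real q / real k)) = (if int k dvd l then of_nat k else 0)"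
proof -
  define w where "w = cis (2 * pi * real_of_int l / real k)"
  have e: "cis (2 * pi * real_of_int l * real q / real k) = w ^ q" for q
    unfolding w_def Complex.DeMoivre by (simp add: mult_ac)
  have wk: "w ^ k = 1"
  proof -
    have "w ^ k = cis (2 * pi * real_of_int l)" unfolding w_def Complex.DeMoivre using k by simp
    thus ?thesis by (simp add: cis_multiple_2pi)
  qed
  show ?thesis
  proof (cases "int k dvd l")
    case True
    then obtain m where "l = int k * m" by (elim dvdE)
    hence "2 * pi * real_of_int l / real k = 2 * pi * real_of_int m" using k by simp
    hence "w = 1" unfolding w_def by (simp add: cis_multiple_2pi)
    thus ?thesis using True by (simp add: e)
  next
    case False
    have "w \<noteq> 1"
    proof
      assume "w = 1"
      hence "cos (2 * pi * real_of_int l / real k) = 1" unfolding w_def by (metis cis.sel(1) one_complex.sel(1))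
      then obtain m :: int where "2 * pi * real_of_int l / real k = of_int m * 2 * pi"
        unfolding cos_one_2pi_int by blast
      hence "real_of_int l = real_of_int (int k * m)" using k by (simp add: field_simps)
      hence "l = int k * m" by (metis of_int_eq_iff)
      with False show False by simp
    qed
    have "(\<Sum>q<k. w ^ q) = 0" using \<open>w \<noteq> 1\<close> wk by (simp add: sum_gp_strict)
    thus ?thesis using False by (simp add: e)
  qed
qed

text \<open>The indices in \<open>S\<close> are pairs of a block index \<open>a i\<close> and a position \<open>p i\<close> modulo \<open>k\<close>. On
  \<open>S\<close> the matrix is the block circulant whose block at the frequency \<open>2 * pi * r / k\<close> is
  \<open>G r\<close>; outside \<open>S\<close> it is \<open>c\<close> times the identity.\<close>

definition circulant ::
  "nat \<Rightarrow> nat set \<Rightarrow> (nat \<Rightarrow> nat) \<Rightarrow> (nat \<Rightarrow> nat) \<Rightarrow> nat \<Rightarrow> (nat \<Rightarrow> complex mat) \<Rightarrow> complex \<Rightarrow> complex mat" where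
  "circulant d S a p k G c = mat d d (\<lambda>(i, j).
     if i \<in> S \<and> j \<in> S
     then (\<Sum>r<k. cis (2 * pi * real r * (real (p j) - real (p i)) / real k) * G r $$ (a i, a j)) / of_nat k
     else if i = j then c else 0)"

text \<open>In this setting the map from \<open>G\<close> and \<open>c\<close> to the circulant is a homomorphism of algebras
  (lemma \<open>\<Gamma>_mult\<close>). Resolvents are therefore computed frequency by frequency, and no
  discrete Fourier transform has to be written down as a matrix.\<close>

locale circulant_index =
  fixes d D k :: nat and S :: "nat set" and a p :: "nat \<Rightarrow> nat"
  assumes k_pos: "k > 0" and S: "S \<subseteq> {..<d}"
    and bij: "bij_betw (\<lambda>i. (a i, p i)) S ({..<D} \<times> {..<k})"
begin

abbreviation "\<Gamma> \<equiv> circulant d S a p k"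

lemma \<Gamma>_carrier [simp]: "\<Gamma> G c \<in> carrier_mat d d" by (simp add: circulant_def)

lemma \<Gamma>_dim [simp]: "dim_row (\<Gamma> G c) = d" "dim_col (\<Gamma> G c) = d" by (simp_all add: circulant_def)

lemma finite_S: "finite S" using S finite_subset by blast

lemma a_less: "i \<in> S \<Longrightarrow> a i < D" and p_less: "i \<in> S \<Longrightarrow> p i < k"
  using bij_betwE[OF bij] by auto

lemma inj: "i \<in> S \<Longrightarrow> j \<in> S \<Longrightarrow> a i = a j \<Longrightarrow> p i = p j \<Longrightarrow> i = j"
  using bij_betw_imp_inj_on[OF bij] by (auto simp: inj_on_def)

lemma card_S: "card S = k * D"
  using bij_betw_same_card[OF bij] by (simp add: card_cartesian_product)

lemma sum_S: "(\<Sum>i\<in>S. g (a i) (p i)) = (\<Sum>b<D. \<Sum>q<k. g b q)"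
  using sum.reindex_bij_betw[OF bij, of "\<lambda>(b, q). g b q"]
  by (simp add: sum.cartesian_product)

lemma \<Gamma>_index_S:
  assumes "i \<in> S" "j \<in> S"
  shows "\<Gamma> G c $$ (i, j) = (\<Sum>r<k. cis (2 * pi * real r * (real (p j) - real (p i)) / real k) * G r $$ (a i, a j)) / of_nat k"
proof -
  have "i < d" "j < d" using assms S by auto
  thus ?thesis using assms by (simp add: circulant_def)
qed

lemma \<Gamma>_index_off:
  assumes "i < d" "j < d" "i \<notin> S \<or> j \<notin> S"
  shows "\<Gamma> G c $$ (i, j) = (if i = j then c else 0)"
  using assms by (auto simp: circulant_def)

lemma orthogonality:
  assumes "r < k" "r' < k"
  shows "(\<Sum>q<k. cis (2 * pi * real r * (real q - x) / real k) * cis (2 * pi * real r' * (y - real q) / real k))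
       = (if r = r' then of_nat k * cis (2 * pi * real r * (y - x) / real k) else 0)"
proof -
  have "(\<Sum>q<k. cis (2 * pi * real r * (real q - x) / real k) * cis (2 * pi * real r' * (y - real q) / real k))
      = (\<Sum>q<k. cis (2 * pi * (real r' * y - real r * x) / real k) * cis (2 * pi * real_of_int (int r - int r') * real q / real k))"
    by (intro sum.cong refl) (simp add: cis_mult add_divide_distrib[symmetric] algebra_simps)
  also have "\<dots> = cis (2 * pi * (real r' * y - real r * x) / real k) * (if int k dvd int r - int r' then of_nat k else 0)"
    by (simp only: sum_distrib_left[symmetric] sum_cis_roots[OF k_pos])
  also have "int k dvd int r - int r' \<longleftrightarrow> r = r'"
    using assms zdvd_imp_le[of "int k" "int r - int r'"] zdvd_imp_le[of "int k" "int r' - int r"]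
    by (cases r r' rule: linorder_cases) (auto simp: dvd_diff_commute)
  finally show ?thesis by (auto simp: algebra_simps)
qed

text \<open>The sum over the common position is a sum over roots of unity, which by \<open>orthogonality\<close>
  leaves only equal frequencies.\<close>

lemma \<Gamma>_mult:
  assumes G: "\<And>r. r < k \<Longrightarrow> G r \<in> carrier_mat D D" and H: "\<And>r. r < k \<Longrightarrow> H r \<in> carrier_mat D D"
  shows "\<Gamma> G c * \<Gamma> H c' = \<Gamma> (\<lambda>r. G r * H r) (c * c')"
proof (rule eq_matI)
  fix i j assume "i < dim_row (\<Gamma> (\<lambda>r. G r * H r) (c * c'))" "j < dim_col (\<Gamma> (\<lambda>r. G r * H r) (c * c'))"
  hence ij: "i < d" "j < d" by simp_all
  have m: "(\<Gamma> G c * \<Gamma> H c') $$ (i, j) = (\<Sum>l<d. \<Gamma> G c $$ (i, l) * \<Gamma> H c' $$ (l, j))"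
    using ij by (intro mat_mult_index_sum) auto
  show "(\<Gamma> G c * \<Gamma> H c') $$ (i, j) = \<Gamma> (\<lambda>r. G r * H r) (c * c') $$ (i, j)"
  proof (cases "i \<in> S \<and> j \<in> S")
    case True
    let ?e = "\<lambda>r x y. cis (2 * pi * real r * (y - x) / real k)"
    have "(\<Sum>l<d. \<Gamma> G c $$ (i, l) * \<Gamma> H c' $$ (l, j)) = (\<Sum>l\<in>S. \<Gamma> G c $$ (i, l) * \<Gamma> H c' $$ (l, j))"
      using S True ij by (intro sum.mono_neutral_right) (auto simp: \<Gamma>_index_off)
    also have "\<dots> = (\<Sum>l\<in>S. (\<Sum>r<k. ?e r (real (p i)) (real (p l)) * G r $$ (a i, a l)) / of_nat k
                        * ((\<Sum>r<k. ?e r (real (p l)) (real (p j)) * H r $$ (a l, a j)) / of_nat k))"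
      using True by (intro sum.cong refl) (simp add: \<Gamma>_index_S)
    also have "\<dots> = (\<Sum>b<D. \<Sum>q<k. (\<Sum>r<k. ?e r (real (p i)) (real q) * G r $$ (a i, b)) / of_nat k
                        * ((\<Sum>r<k. ?e r (real q) (real (p j)) * H r $$ (b, a j)) / of_nat k))"
      by (rule sum_S)
    also have "\<dots> = (\<Sum>b<D. (\<Sum>r<k. \<Sum>r'<k. G r $$ (a i, b) * H r' $$ (b, a j) *
                        (\<Sum>q<k. ?e r (real (p i)) (real q) * ?e r' (real q) (real (p j)))) / of_nat k / of_nat k)"
    proof (intro sum.cong refl)
      fix b
      have "(\<Sum>q<k. (\<Sum>r<k. ?e r (real (p i)) (real q) * G r $$ (a i, b)) / of_nat k
                        * ((\<Sum>r<k. ?e r (real q) (real (p j)) * H r $$ (b, a j)) / of_nat k))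
          = (\<Sum>q<k. \<Sum>r<k. \<Sum>r'<k. G r $$ (a i, b) * H r' $$ (b, a j) *
              (?e r (real (p i)) (real q) * ?e r' (real q) (real (p j)))) / of_nat k / of_nat k"
        by (simp add: sum_product sum_divide_distrib mult_ac)
      also have "(\<Sum>q<k. \<Sum>r<k. \<Sum>r'<k. G r $$ (a i, b) * H r' $$ (b, a j) *
              (?e r (real (p i)) (real q) * ?e r' (real q) (real (p j))))
          = (\<Sum>r<k. \<Sum>r'<k. \<Sum>q<k. G r $$ (a i, b) * H r' $$ (b, a j) *
              (?e r (real (p i)) (real q) * ?e r' (real q) (real (p j))))"
        by (rule trans[OF sum.swap], rule sum.cong[OF refl], rule sum.swap)
      finally show "(\<Sum>q<k. (\<Sum>r<k. ?e r (real (p i)) (real q) * G r $$ (a i, b)) / of_nat k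
                        * ((\<Sum>r<k. ?e r (real q) (real (p j)) * H r $$ (b, a j)) / of_nat k))
          = (\<Sum>r<k. \<Sum>r'<k. G r $$ (a i, b) * H r' $$ (b, a j) *
                        (\<Sum>q<k. ?e r (real (p i)) (real q) * ?e r' (real q) (real (p j)))) / of_nat k / of_nat k"
        by (simp add: sum_distrib_left)
    qed
    also have "\<dots> = (\<Sum>b<D. (\<Sum>r<k. ?e r (real (p i)) (real (p j)) * (G r $$ (a i, b) * H r $$ (b, a j))) / of_nat k)"
    proof (intro sum.cong refl)
      fix b
      have "(\<Sum>r<k. \<Sum>r'<k. G r $$ (a i, b) * H r' $$ (b, a j) *
                        (\<Sum>q<k. ?e r (real (p i)) (real q) * ?e r' (real q) (real (p j))))
          = (\<Sum>r<k. \<Sum>r'<k. if r = r' then of_nat k * (?e r (real (p i)) (real (p j)) * (G r $$ (a i, b) * H r' $$ (b, a j))) else 0)"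
        by (intro sum.cong refl, subst orthogonality) auto
      also have "\<dots> = of_nat k * (\<Sum>r<k. ?e r (real (p i)) (real (p j)) * (G r $$ (a i, b) * H r $$ (b, a j)))"
        by (simp add: sum_distrib_left)
      finally show "(\<Sum>r<k. \<Sum>r'<k. G r $$ (a i, b) * H r' $$ (b, a j) *
                        (\<Sum>q<k. ?e r (real (p i)) (real q) * ?e r' (real q) (real (p j)))) / of_nat k / of_nat k
          = (\<Sum>r<k. ?e r (real (p i)) (real (p j)) * (G r $$ (a i, b) * H r $$ (b, a j))) / of_nat k"
        using k_pos by simp
    qed
    also have "\<dots> = (\<Sum>r<k. ?e r (real (p i)) (real (p j)) * (G r * H r) $$ (a i, a j)) / of_nat k"
    proof -
      have "(\<Sum>b<D. \<Sum>r<k. ?e r (real (p i)) (real (p j)) * (G r $$ (a i, b) * H r $$ (b, a j)))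
          = (\<Sum>r<k. ?e r (real (p i)) (real (p j)) * (\<Sum>b<D. G r $$ (a i, b) * H r $$ (b, a j)))"
        by (subst sum.swap) (simp add: sum_distrib_left)
      also have "\<dots> = (\<Sum>r<k. ?e r (real (p i)) (real (p j)) * (G r * H r) $$ (a i, a j))"
      proof (intro sum.cong refl arg_cong2[of _ _ _ _ "(*)"])
        fix r assume "r \<in> {..<k}"
        thus "(\<Sum>b<D. G r $$ (a i, b) * H r $$ (b, a j)) = (G r * H r) $$ (a i, a j)"
          using mat_mult_index_sum[OF G H, of r r "a i" "a j"] a_less True by simp
      qed
      finally show ?thesis by (simp only: sum_divide_distrib[symmetric])
    qed
    finally show ?thesis unfolding m using True by (simp add: \<Gamma>_index_S)
  next
    case False
    have "(\<Sum>l<d. \<Gamma> G c $$ (i, l) * \<Gamma> H c' $$ (l, j)) = (\<Sum>l<d. if l = i then (if i = j then c * c' else 0) else 0)"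
    proof (rule sum.cong[OF refl])
      fix l assume "l \<in> {..<d}"
      hence l: "l < d" by simp
      show "\<Gamma> G c $$ (i, l) * \<Gamma> H c' $$ (l, j) = (if l = i then (if i = j then c * c' else 0) else 0)"
      proof (cases "i \<in> S")
        case True
        hence "j \<notin> S" using False by blast
        thus ?thesis using \<Gamma>_index_off[OF l ij(2), of H c'] \<Gamma>_index_off[OF ij(1) l, of G c] True by auto
      next
        case i: False
        thus ?thesis using \<Gamma>_index_off[OF l ij(2), of H c'] \<Gamma>_index_off[OF ij(1) l, of G c] by auto
      qed
    qed
    thus ?thesis unfolding m using \<Gamma>_index_off[OF ij, of "\<lambda>r. G r * H r" "c * c'"] False ij by simp
  qed
qed auto

lemma \<Gamma>_one: "\<Gamma> (\<lambda>r. 1\<^sub>m D) 1 = 1\<^sub>m d"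
proof (rule eq_matI)
  fix i j assume "i < dim_row (1\<^sub>m d :: complex mat)" "j < dim_col (1\<^sub>m d :: complex mat)"
  hence ij: "i < d" "j < d" by simp_all
  show "\<Gamma> (\<lambda>r. 1\<^sub>m D) 1 $$ (i, j) = 1\<^sub>m d $$ (i, j)"
  proof (cases "i \<in> S \<and> j \<in> S")
    case True
    have "(\<Sum>r<k. cis (2 * pi * real r * (real (p j) - real (p i)) / real k))
        = (\<Sum>r<k. cis (2 * pi * real_of_int (int (p j) - int (p i)) * real r / real k))"
      by (intro sum.cong refl) (simp add: mult_ac)
    also have "\<dots> = (if int k dvd int (p j) - int (p i) then of_nat k else 0)"
      by (rule sum_cis_roots[OF k_pos])
    also have "int k dvd int (p j) - int (p i) \<longleftrightarrow> p i = p j"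
      using p_less[of i] p_less[of j] True zdvd_imp_le[of "int k" "int (p j) - int (p i)"] zdvd_imp_le[of "int k" "int (p i) - int (p j)"]
      by (cases "p i" "p j" rule: linorder_cases) (auto simp: dvd_diff_commute)
    finally have e: "(\<Sum>r<k. cis (2 * pi * real r * (real (p j) - real (p i)) / real k)) = (if p i = p j then of_nat k else 0)" .
    have "\<Gamma> (\<lambda>r. 1\<^sub>m D) 1 $$ (i, j) = (\<Sum>r<k. cis (2 * pi * real r * (real (p j) - real (p i)) / real k)) / of_nat k * (if a i = a j then 1 else 0)"
      using True a_less by (simp add: \<Gamma>_index_S)
    also have "\<dots> = (if i = j then 1 else 0)"
      unfolding e using k_pos inj[of i j] True by auto
    finally show ?thesis using ij by simp
  qed (use ij in \<open>auto simp: \<Gamma>_index_off\<close>)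
qed auto

lemma scalar_minus_\<Gamma>:
  assumes Y: "\<And>r. r < k \<Longrightarrow> Y r \<in> carrier_mat D D"
  shows "z \<cdot>\<^sub>m 1\<^sub>m d - \<Gamma> Y 0 = \<Gamma> (\<lambda>r. z \<cdot>\<^sub>m 1\<^sub>m D - Y r) z"
proof (rule eq_matI)
  fix i j assume "i < dim_row (\<Gamma> (\<lambda>r. z \<cdot>\<^sub>m 1\<^sub>m D - Y r) z)" "j < dim_col (\<Gamma> (\<lambda>r. z \<cdot>\<^sub>m 1\<^sub>m D - Y r) z)"
  hence ij: "i < d" "j < d" by simp_all
  show "(z \<cdot>\<^sub>m 1\<^sub>m d - \<Gamma> Y 0) $$ (i, j) = \<Gamma> (\<lambda>r. z \<cdot>\<^sub>m 1\<^sub>m D - Y r) z $$ (i, j)"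
  proof (cases "i \<in> S \<and> j \<in> S")
    case True
    let ?e = "\<lambda>r. cis (2 * pi * real r * (real (p j) - real (p i)) / real k)"
    have "\<Gamma> (\<lambda>r. z \<cdot>\<^sub>m 1\<^sub>m D - Y r) z $$ (i, j) = (\<Sum>r<k. z * (?e r * 1\<^sub>m D $$ (a i, a j)) - ?e r * Y r $$ (a i, a j)) / of_nat k"
      unfolding \<Gamma>_index_S[OF conjunct1[OF True] conjunct2[OF True]]
    proof (intro arg_cong2[of _ _ _ _ "(/)"] sum.cong refl)
      fix r assume "r \<in> {..<k}"
      hence "(z \<cdot>\<^sub>m 1\<^sub>m D - Y r) $$ (a i, a j) = z * 1\<^sub>m D $$ (a i, a j) - Y r $$ (a i, a j)"
        using True a_less[of i] a_less[of j] Y[of r] by simp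
      thus "?e r * (z \<cdot>\<^sub>m 1\<^sub>m D - Y r) $$ (a i, a j) = z * (?e r * 1\<^sub>m D $$ (a i, a j)) - ?e r * Y r $$ (a i, a j)"
        by (simp only: right_diff_distrib mult.left_commute)
    qed
    also have "\<dots> = z * \<Gamma> (\<lambda>r. 1\<^sub>m D) 1 $$ (i, j) - \<Gamma> Y 0 $$ (i, j)"
      using True by (simp add: \<Gamma>_index_S sum_subtractf sum_distrib_left diff_divide_distrib)
    finally show ?thesis using ij by (simp add: \<Gamma>_one)
  qed (use ij in \<open>auto simp: \<Gamma>_index_off\<close>)
qed auto

lemma tr_\<Gamma>:
  assumes "\<And>r. r < k \<Longrightarrow> G r \<in> carrier_mat D D"
  shows "tr (\<Gamma> G c) = (\<Sum>r<k. tr (G r)) + of_nat (d - k * D) * c"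
proof -
  have "tr (\<Gamma> G c) = (\<Sum>i\<in>S. \<Gamma> G c $$ (i, i)) + (\<Sum>i\<in>{..<d} - S. \<Gamma> G c $$ (i, i))"
    unfolding tr_def using S by (simp add: sum.subset_diff[of S] add.commute)
  also have "(\<Sum>i\<in>S. \<Gamma> G c $$ (i, i)) = (\<Sum>i\<in>S. (\<Sum>r<k. G r $$ (a i, a i)) / of_nat k)"
    by (intro sum.cong refl) (simp add: \<Gamma>_index_S)
  also have "\<dots> = (\<Sum>b<D. \<Sum>q<k. (\<Sum>r<k. G r $$ (b, b)) / of_nat k)"
    by (rule sum_S)
  also have "\<dots> = (\<Sum>r<k. \<Sum>b<D. G r $$ (b, b))"
    using k_pos by (subst sum.swap) simp
  also have "\<dots> = (\<Sum>r<k. tr (G r))"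
    unfolding tr_def by (intro sum.cong refl) (use assms in auto)
  also have "(\<Sum>i\<in>{..<d} - S. \<Gamma> G c $$ (i, i)) = (\<Sum>i\<in>{..<d} - S. c)"
    by (intro sum.cong refl) (auto simp: \<Gamma>_index_off)
  also have "\<dots> = of_nat (d - k * D) * c"
    using S finite_S by (simp add: card_Diff_subset card_S)
  finally show ?thesis .
qed

lemma \<Gamma>_hermitian:
  assumes Y: "\<And>r. r < k \<Longrightarrow> Y r \<in> carrier_mat D D \<and> hermitian_mat (Y r)"
  shows "hermitian_mat (\<Gamma> Y 0)"
proof -
  have "\<Gamma> Y 0 $$ (i, j) = cnj (\<Gamma> Y 0 $$ (j, i))" if ij: "i < d" "j < d" for i j
  proof (cases "i \<in> S \<and> j \<in> S")
    case True
    have e: "cnj (cis (2 * pi * real r * (real (p i) - real (p j)) / real k))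
        = cis (2 * pi * real r * (real (p j) - real (p i)) / real k)" for r
      unfolding cis_cnj by (rule arg_cong[of _ _ cis]) (simp add: diff_divide_distrib right_diff_distrib)
    have "cnj (\<Gamma> Y 0 $$ (j, i)) = (\<Sum>r<k. cis (2 * pi * real r * (real (p j) - real (p i)) / real k) * cnj (Y r $$ (a j, a i))) / of_nat k"
      using True by (simp add: \<Gamma>_index_S e)
    also have "\<dots> = (\<Sum>r<k. cis (2 * pi * real r * (real (p j) - real (p i)) / real k) * Y r $$ (a i, a j)) / of_nat k"
    proof (intro arg_cong2[of _ _ _ _ "(/)"] sum.cong refl arg_cong2[of _ _ _ _ "(*)"])
      fix r assume "r \<in> {..<k}"
      thus "cnj (Y r $$ (a j, a i)) = Y r $$ (a i, a j)"
        using hermitian_matD[of "Y r" D "a i" "a j"] Y[of r] a_less True by simp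
    qed
    finally have h: "cnj (\<Gamma> Y 0 $$ (j, i)) = (\<Sum>r<k. cis (2 * pi * real r * (real (p j) - real (p i)) / real k) * Y r $$ (a i, a j)) / of_nat k" .
    show ?thesis unfolding h \<Gamma>_index_S[OF conjunct1[OF True] conjunct2[OF True]] ..
  qed (use ij in \<open>auto simp: \<Gamma>_index_off\<close>)
  thus ?thesis unfolding hermitian_mat_iff \<Gamma>_dim by blast
qed

text \<open>The blocks \<open>resolvent (Y r) z\<close> with the scalar \<open>1 / z\<close> outside \<open>S\<close> form the inverse.\<close>

lemma tr_resolvent_\<Gamma>:
  assumes Y: "\<And>r. r < k \<Longrightarrow> Y r \<in> carrier_mat D D \<and> hermitian_mat (Y r)" and z: "Im z \<noteq> 0"
  shows "rtr (\<Gamma> Y 0) z = (\<Sum>r<k. rtr (Y r) z) + of_nat (d - k * D) * (1 / z)"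
proof -
  have z0: "z \<noteq> 0" using z by auto
  have Yc: "\<And>r. r < k \<Longrightarrow> Y r \<in> carrier_mat D D" using Y by blast
  have "(z \<cdot>\<^sub>m 1\<^sub>m d - \<Gamma> Y 0) * \<Gamma> (\<lambda>r. resolvent (Y r) z) (1 / z)
      = \<Gamma> (\<lambda>r. z \<cdot>\<^sub>m 1\<^sub>m D - Y r) z * \<Gamma> (\<lambda>r. resolvent (Y r) z) (1 / z)"
    using scalar_minus_\<Gamma>[of Y z] Yc by simp
  also have "\<dots> = \<Gamma> (\<lambda>r. (z \<cdot>\<^sub>m 1\<^sub>m D - Y r) * resolvent (Y r) z) (z * (1 / z))"
    by (rule \<Gamma>_mult) (use Yc in auto)
  also have "\<dots> = \<Gamma> (\<lambda>r. 1\<^sub>m D) 1"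
  proof -
    have "(z \<cdot>\<^sub>m 1\<^sub>m D - Y r) * resolvent (Y r) z = 1\<^sub>m D" if "r < k" for r
      using resolvent_inverse(1)[OF _ hermitian_det_nonzero[OF _ _ z], of "Y r" D] Y[OF that] by simp
    thus ?thesis using z0 unfolding circulant_def by (intro cong_mat refl) auto
  qed
  finally have "resolvent (\<Gamma> Y 0) z = \<Gamma> (\<lambda>r. resolvent (Y r) z) (1 / z)"
    unfolding \<Gamma>_one by (intro resolvent_unique[of _ d]) auto
  thus ?thesis using Yc by (simp add: tr_\<Gamma>)
qed

end

section \<open>Trigonometric polynomials and Riemann sums\<close>

inductive trig_poly :: "(real \<Rightarrow> complex) \<Rightarrow> bool" where
  monomial: "trig_poly (\<lambda>\<theta>. c * cis (of_int l * \<theta>))"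
| add: "trig_poly p \<Longrightarrow> trig_poly q \<Longrightarrow> trig_poly (\<lambda>\<theta>. p \<theta> + q \<theta>)"

lemma trig_poly_const: "trig_poly (\<lambda>\<theta>. c)"
  using trig_poly.monomial[of c 0] by simp

lemma trig_poly_monomial_mult:
  assumes "trig_poly q" shows "trig_poly (\<lambda>\<theta>. c * cis (of_int l * \<theta>) * q \<theta>)"
  using assms
proof induction
  case (monomial c' l')
  have "(\<lambda>\<theta>. c * cis (of_int l * \<theta>) * (c' * cis (of_int l' * \<theta>))) = (\<lambda>\<theta>. (c * c') * cis (of_int (l + l') * \<theta>))"
    by (rule ext) (simp add: cis_mult[symmetric] distrib_right)
  thus ?case by (simp only: trig_poly.monomial)
qed (simp add: distrib_left trig_poly.add)

lemma trig_poly_mult: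
  assumes "trig_poly p" "trig_poly q" shows "trig_poly (\<lambda>\<theta>. p \<theta> * q \<theta>)"
  using assms(1)
  by induction (simp_all add: trig_poly_monomial_mult[OF assms(2)] distrib_right trig_poly.add)

lemma trig_poly_cmult: "trig_poly q \<Longrightarrow> trig_poly (\<lambda>\<theta>. c * q \<theta>)"
  using trig_poly_mult[OF trig_poly_const] .

lemma trig_poly_cnj: "trig_poly p \<Longrightarrow> trig_poly (\<lambda>\<theta>. cnj (p \<theta>))"
proof (induction rule: trig_poly.induct)
  case (monomial c l)
  show ?case using trig_poly.monomial[of "cnj c" "-l"] by (simp add: cis_cnj)
qed (simp add: trig_poly.add)

lemma trig_poly_continuous: "trig_poly p \<Longrightarrow> continuous_on A p"
  by (induction rule: trig_poly.induct) (auto intro!: continuous_intros)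

lemma trig_poly_cis_cong: "trig_poly p \<Longrightarrow> cis x = cis y \<Longrightarrow> p x = p y"
proof (induction rule: trig_poly.induct)
  case (monomial c l)
  have "cis (of_int l * x) = cis x powi l" for x by (simp add: cis_power_int)
  thus ?case using monomial by simp
qed simp

lemma trig_poly_coeffs:
  assumes "trig_poly p"
  shows "\<exists>c w. (\<forall>l. \<bar>l\<bar> > int w \<longrightarrow> c l = 0) \<and> (\<forall>\<theta>. p \<theta> = (\<Sum>l\<in>{-int w..int w}. c l * cis (of_int l * \<theta>)))"
  using assms
proof induction
  case (monomial c l)
  have "(\<Sum>l'\<in>{-int (nat \<bar>l\<bar>)..int (nat \<bar>l\<bar>)}. (if l' = l then c else 0) * cis (of_int l' * \<theta>))
      = (\<Sum>l'\<in>{-int (nat \<bar>l\<bar>)..int (nat \<bar>l\<bar>)}. if l' = l then c * cis (of_int l * \<theta>) else 0)" for \<theta>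
    by (intro sum.cong) auto
  thus ?case
    by (intro exI[of _ "\<lambda>l'. if l' = l then c else 0"] exI[of _ "nat \<bar>l\<bar>"]) auto
next
  case (add p q)
  from add.IH(1) obtain c1 w1 where
    1: "\<And>l. \<bar>l\<bar> > int w1 \<Longrightarrow> c1 l = 0" "\<And>\<theta>. p \<theta> = (\<Sum>l\<in>{-int w1..int w1}. c1 l * cis (of_int l * \<theta>))"
    by blast
  from add.IH(2) obtain c2 w2 where
    2: "\<And>l. \<bar>l\<bar> > int w2 \<Longrightarrow> c2 l = 0" "\<And>\<theta>. q \<theta> = (\<Sum>l\<in>{-int w2..int w2}. c2 l * cis (of_int l * \<theta>))"
    by blast
  let ?w = "max w1 w2"
  have "p \<theta> = (\<Sum>l\<in>{-int ?w..int ?w}. c1 l * cis (of_int l * \<theta>))" for \<theta>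
    unfolding 1(2) by (intro sum.mono_neutral_left) (auto simp: 1(1))
  moreover have "q \<theta> = (\<Sum>l\<in>{-int ?w..int ?w}. c2 l * cis (of_int l * \<theta>))" for \<theta>
    unfolding 2(2) by (intro sum.mono_neutral_left) (auto simp: 2(1))
  ultimately show ?case
    by (intro exI[of _ "\<lambda>l. c1 l + c2 l"] exI[of _ ?w])
       (auto simp: 1(1) 2(1) sum.distrib distrib_right)
qed

text \<open>Linear functionals of the plane are the base case of real polynomial functions; on the
  unit circle \<open>cnj u\<close> is the inverse of \<open>u\<close>, so this form exhibits them as trigonometric
  polynomials.\<close>

lemma bounded_linear_complex_real:
  assumes "bounded_linear f"
  shows "\<exists>a b. \<forall>u. complex_of_real (f u) = a * u + b * cnj u"
proof (intro exI allI)
  interpret bounded_linear f by fact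
  fix u
  have "f u = f (Re u *\<^sub>R 1 + Im u *\<^sub>R \<i>)" by (rule arg_cong[of _ _ f]) (simp add: complex_eq_iff)
  also have "\<dots> = Re u * f 1 + Im u * f \<i>" by (simp only: add scaleR real_scaleR_def)
  finally have f: "f u = Re u * f 1 + Im u * f \<i>" .
  show "complex_of_real (f u) = (of_real (f 1) - \<i> * of_real (f \<i>)) / 2 * u + (of_real (f 1) + \<i> * of_real (f \<i>)) / 2 * cnj u"
    by (subst f) (simp add: complex_eq_iff algebra_simps diff_divide_distrib add_divide_distrib)
qed

lemma trig_poly_real_polynomial_cis:
  fixes q :: "complex \<Rightarrow> real"
  assumes "real_polynomial_function q"
  shows "trig_poly (\<lambda>\<theta>. of_real (q (cis \<theta>)))"
  using assms
proof induction
  case (linear f)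
  then obtain a b where "\<And>u. complex_of_real (f u) = a * u + b * cnj u"
    using bounded_linear_complex_real by blast
  hence "(\<lambda>\<theta>. complex_of_real (f (cis \<theta>))) = (\<lambda>\<theta>. a * cis (of_int 1 * \<theta>) + b * cis (of_int (-1) * \<theta>))"
    by (simp add: cis_cnj)
  thus ?case by (simp only: trig_poly.intros)
qed (simp_all add: trig_poly_const trig_poly.add trig_poly_mult)

text \<open>The function \<open>\<phi>\<close> lives on the circle, where the Stone-Weierstrass theorem applies.
  Its continuity there is not affected by the jump of the argument at \<open>-1\<close>: preimages of
  closed sets are images of compact sets under \<open>cis\<close>.\<close>

lemma trig_poly_dense_continuous:
  fixes \<phi> :: "real \<Rightarrow> complex"
  assumes cont: "continuous_on {-pi..pi} \<phi>" and per: "\<phi> (-pi) = \<phi> pi" and e: "e > 0"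
  shows "\<exists>p. trig_poly p \<and> (\<forall>\<theta>\<in>{-pi..pi}. cmod (\<phi> \<theta> - p \<theta>) < e)"
proof -
  define G where "G = (\<lambda>u. \<phi> (Arg u))"
  have Arg_cis': "\<phi> (Arg (cis x)) = \<phi> x" if "x \<in> {-pi..pi}" for x
  proof (cases "x = -pi")
    case True
    have "cis (-pi) = -1" by (simp add: complex_eq_iff)
    moreover have "Arg (-1) = pi" by (rule cis_Arg_unique) (auto simp: sgn_eq complex_eq_iff)
    ultimately show ?thesis using True per by simp
  next
    case False
    hence "Arg (cis x) = x" using that by (intro cis_Arg_unique) (auto simp: sgn_eq)
    thus ?thesis by simp
  qed
  have cis_Arg': "cis (Arg u) = u" if "u \<in> sphere 0 1" for u :: complex
    using that by (subst cis_Arg) (auto simp: sgn_eq)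
  have "continuous_on (sphere (0::complex) 1) G"
    unfolding continuous_on_closed_invariant
  proof (intro allI impI)
    fix B :: "complex set" assume "closed B"
    let ?A = "cis ` ({-pi..pi} \<inter> \<phi> -` B)"
    have "closed ({-pi..pi} \<inter> \<phi> -` B)"
      by (intro continuous_closed_preimage cont \<open>closed B\<close>) auto
    hence "compact ({-pi..pi} \<inter> \<phi> -` B)"
      by (meson bounded_Int bounded_closed_interval compact_eq_bounded_closed)
    hence "compact ?A" by (intro compact_continuous_image continuous_intros)
    moreover have "?A \<inter> sphere 0 1 = G -` B \<inter> sphere 0 1"
    proof (intro equalityI subsetI)
      fix u assume "u \<in> ?A \<inter> sphere 0 1"
      thus "u \<in> G -` B \<inter> sphere 0 1" using Arg_cis' by (auto simp: G_def)
    next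
      fix u assume u: "u \<in> G -` B \<inter> sphere 0 1"
      hence "Arg u \<in> {-pi..pi} \<inter> \<phi> -` B" using Arg_bounded[of u] by (auto simp: G_def)
      hence "cis (Arg u) \<in> ?A" by blast
      thus "u \<in> ?A \<inter> sphere 0 1" using u cis_Arg' by simp
    qed
    ultimately show "\<exists>A. closed A \<and> A \<inter> sphere 0 1 = G -` B \<inter> sphere 0 1"
      using compact_imp_closed by blast
  qed
  then obtain g where g: "polynomial_function g" "\<forall>u\<in>sphere 0 1. norm (G u - g u) < e"
    using Stone_Weierstrass_polynomial_function[OF compact_sphere _ e] by metis
  define p where "p = (\<lambda>\<theta>. of_real (Re (g (cis \<theta>))) + \<i> * of_real (Im (g (cis \<theta>))))"
  have "real_polynomial_function (\<lambda>u. Re (g u))" "real_polynomial_function (\<lambda>u. Im (g u))"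
    using g(1) bounded_linear_Re bounded_linear_Im unfolding polynomial_function_def o_def by blast+
  hence "trig_poly p" unfolding p_def
    by (intro trig_poly.add trig_poly_cmult trig_poly_real_polynomial_cis)
  moreover have "p \<theta> = g (cis \<theta>)" for \<theta> unfolding p_def by (simp add: complex_eq_iff)
  moreover have "cmod (\<phi> \<theta> - g (cis \<theta>)) < e" if "\<theta> \<in> {-pi..pi}" for \<theta>
  proof -
    have "norm (G (cis \<theta>) - g (cis \<theta>)) < e" using g(2) by simp
    thus ?thesis unfolding G_def Arg_cis'[OF that] .
  qed
  ultimately show ?thesis by auto
qed

lemma trig_poly_dense_periodic:
  fixes g :: "real \<Rightarrow> complex"
  assumes cont: "continuous_on UNIV g" and per: "\<And>x y. cis x = cis y \<Longrightarrow> g x = g y" and e: "e > 0"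
  shows "\<exists>p. trig_poly p \<and> (\<forall>\<theta>. cmod (g \<theta> - p \<theta>) < e)"
proof -
  have "g (-pi) = g pi" by (rule per) (simp add: complex_eq_iff)
  then obtain p where p: "trig_poly p" "\<And>\<theta>. \<theta> \<in> {-pi..pi} \<Longrightarrow> cmod (g \<theta> - p \<theta>) < e"
    using trig_poly_dense_continuous[of g e] continuous_on_subset[OF cont] e by auto
  have "cmod (g \<theta> - p \<theta>) < e" for \<theta>
  proof -
    have c: "cis (Arg (cis \<theta>)) = cis \<theta>" by (subst cis_Arg) (auto simp: sgn_eq)
    have "Arg (cis \<theta>) \<in> {-pi..pi}" using Arg_bounded[of "cis \<theta>"] by auto
    thus ?thesis using p(2) per[OF c] trig_poly_cis_cong[OF p(1) c] by metis
  qed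
  with p show ?thesis by blast
qed

definition mean :: "(real \<Rightarrow> complex) \<Rightarrow> complex" where
  "mean g = 1 / (2 * of_real pi) * (LINT \<theta>:{-pi..pi}|lebesgue. g \<theta>)"

lemma continuous_set_integrable:
  fixes g :: "real \<Rightarrow> complex"
  assumes "continuous_on {-pi..pi} g"
  shows "set_integrable lebesgue {-pi..pi} g"
  using absolutely_integrable_continuous[of "-pi" pi g] assms by (simp add: cbox_interval)

lemma mean_add:
  assumes "set_integrable lebesgue {-pi..pi} f" "set_integrable lebesgue {-pi..pi} g"
  shows "mean (\<lambda>\<theta>. f \<theta> + g \<theta>) = mean f + mean g"
  unfolding mean_def using set_integral_add(2)[OF assms] by (simp add: distrib_left)

lemma mean_diff:
  assumes "set_integrable lebesgue {-pi..pi} f" "set_integrable lebesgue {-pi..pi} g"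
  shows "mean (\<lambda>\<theta>. f \<theta> - g \<theta>) = mean f - mean g"
  unfolding mean_def using set_integral_diff(2)[OF assms] by (simp add: right_diff_distrib)

lemma mean_cmult: "mean (\<lambda>\<theta>. c * f \<theta>) = c * mean f"
  unfolding mean_def set_lebesgue_integral_def by (simp flip: mult_scaleR_right)

lemma mean_const: "mean (\<lambda>\<theta>. c) = c"
  unfolding mean_def set_lebesgue_integral_def
  by (simp add: scaleR_conv_of_real)

lemma mean_bound:
  assumes "set_integrable lebesgue {-pi..pi} g" "set_integrable lebesgue {-pi..pi} b"
    and "\<And>\<theta>. \<theta> \<in> {-pi..pi} \<Longrightarrow> cmod (g \<theta>) \<le> b \<theta>"
  shows "cmod (mean g) \<le> 1 / (2 * pi) * (LINT \<theta>:{-pi..pi}|lebesgue. b \<theta>)"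
proof -
  have "cmod (LINT \<theta>:{-pi..pi}|lebesgue. g \<theta>) \<le> (LINT \<theta>:{-pi..pi}|lebesgue. cmod (g \<theta>))"
    using assms(1) by (rule set_integral_norm_bound)
  also have "\<dots> \<le> (LINT \<theta>:{-pi..pi}|lebesgue. b \<theta>)"
    using assms by (intro set_integral_mono set_integrable_norm) auto
  finally show ?thesis unfolding mean_def by (simp add: norm_mult norm_divide divide_right_mono)
qed

lemma mean_cis: "mean (\<lambda>\<theta>. cis (of_int l * \<theta>)) = (if l = 0 then 1 else 0)"
proof (cases "l = 0")
  case True
  thus ?thesis using mean_const[of 1] by simp
next
  case False
  let ?F = "\<lambda>\<theta>. - \<i> / of_int l * cis (of_int l * \<theta>)"
  have "((\<lambda>\<theta>. cis (of_int l * \<theta>)) has_integral (?F pi - ?F (-pi))) {-pi..pi}"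
  proof (rule fundamental_theorem_of_calculus)
    fix x assume "x \<in> {-pi..pi}"
    show "(?F has_vector_derivative cis (of_int l * x)) (at x within {-pi..pi})"
    proof -
      have "((\<lambda>z. - \<i> / of_int l * exp (\<i> * (of_int l * z))) has_field_derivative
          exp (\<i> * (of_int l * of_real x))) (at (of_real x))"
        using False by (auto intro!: derivative_eq_intros simp: field_simps)
      from has_vector_derivative_real_field[OF this, of "{-pi..pi}"]
      show ?thesis by (simp add: cis_conv_exp)
    qed
  qed auto
  moreover have "?F pi - ?F (-pi) = 0"
  proof -
    have "cis (of_int l * pi) = cis (of_int l * pi - 2 * pi * of_int l)"
      by (simp only: cis_divide[symmetric] cis_multiple_2pi[OF Ints_of_int] div_by_1)
    also have "of_int l * pi - 2 * pi * of_int l = of_int l * (-pi)" by simp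
    finally show ?thesis by simp
  qed
  ultimately have "integral {-pi..pi} (\<lambda>\<theta>. cis (of_int l * \<theta>)) = 0" by (simp add: has_integral_iff)
  moreover have "set_integrable lebesgue {-pi..pi} (\<lambda>\<theta>. cis (of_int l * \<theta>))"
    by (intro continuous_set_integrable continuous_intros)
  ultimately show ?thesis using False unfolding mean_def by (simp add: set_lebesgue_integral_eq_integral)
qed

lemma riemann_sum_trig_poly:
  assumes "trig_poly p"
  shows "\<forall>\<^sub>F k in sequentially. (\<Sum>r<k. p (2 * pi * real r / real k)) / of_nat k = mean p"
  using assms
proof induction
  case (monomial c l)
  show ?case
  proof (rule eventually_sequentiallyI)
    fix k assume k: "k \<ge> Suc (nat \<bar>l\<bar>)"
    hence k0: "k > 0" by simp
    have "(\<Sum>r<k. c * cis (of_int l * (2 * pi * real r / real k)))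
        = c * (\<Sum>r<k. cis (2 * pi * real_of_int l * real r / real k))"
      by (simp add: sum_distrib_left mult_ac)
    also have "\<dots> = c * (if l = 0 then of_nat k else 0)"
      unfolding sum_cis_roots[OF k0] using k zdvd_imp_le[of "int k" "\<bar>l\<bar>"] by auto
    finally show "(\<Sum>r<k. c * cis (of_int l * (2 * pi * real r / real k))) / of_nat k
      = mean (\<lambda>\<theta>. c * cis (of_int l * \<theta>))"
      unfolding mean_cmult mean_cis using k0 by simp
  qed
next
  case (add p q)
  have "mean (\<lambda>\<theta>. p \<theta> + q \<theta>) = mean p + mean q"
    by (intro mean_add continuous_set_integrable trig_poly_continuous add)
  note m = this
  show ?case using add.IH by eventually_elim (simp add: m sum.distrib add_divide_distrib)
qed

text \<open>The Riemann sum is exact for a trigonometric polynomial as soon as \<open>k\<close> exceeds the degree;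
  uniform approximation does the rest.\<close>

lemma riemann_sum_periodic:
  assumes cont: "continuous_on UNIV g" and per: "\<And>x y. cis x = cis y \<Longrightarrow> g x = g y"
  shows "(\<lambda>k. (\<Sum>r<k. g (2 * pi * real r / real k)) / of_nat k) \<longlonglongrightarrow> mean g"
proof (rule tendstoI)
  fix e :: real assume e: "e > 0"
  obtain p where p: "trig_poly p" "\<And>\<theta>. cmod (g \<theta> - p \<theta>) < e / 3"
    using trig_poly_dense_periodic[OF cont per, of "e / 3"] e by auto
  have "cmod (mean g - mean p) \<le> 1 / (2 * pi) * (LINT \<theta>:{-pi..pi}|lebesgue. e / 3)"
    unfolding mean_diff[OF continuous_set_integrable[OF continuous_on_subset[OF cont]] continuous_set_integrable[OF trig_poly_continuous[OF p(1)]], OF subset_UNIV, symmetric]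
    using p(2) less_imp_le
    by (intro mean_bound continuous_set_integrable continuous_on_diff trig_poly_continuous p(1) continuous_on_subset[OF cont])
       (auto intro!: integrable_const simp: set_integrable_def)
  also have "\<dots> = e / 3" by (simp add: set_lebesgue_integral_def)
  finally have m: "cmod (mean g - mean p) \<le> e / 3" .
  show "\<forall>\<^sub>F k in sequentially. dist ((\<Sum>r<k. g (2 * pi * real r / real k)) / of_nat k) (mean g) < e"
    using riemann_sum_trig_poly[OF p(1)] eventually_gt_at_top[of 0]
  proof eventually_elim
    case (elim k)
    let ?s = "\<lambda>g. (\<Sum>r<k. g (2 * pi * real r / real k)) / of_nat k :: complex"
    have "cmod (?s g - ?s p) = cmod (\<Sum>r<k. g (2 * pi * real r / real k) - p (2 * pi * real r / real k)) / real k"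
      by (simp add: sum_subtractf diff_divide_distrib[symmetric] norm_divide)
    also have "\<dots> \<le> (\<Sum>r<k. e / 3) / real k"
      by (intro divide_right_mono order_trans[OF norm_sum] sum_mono less_imp_le[OF p(2)]) auto
    also have "\<dots> = e / 3" using elim by simp
    finally have "cmod (?s g - ?s p) \<le> e / 3" .
    moreover have eq: "?s g - mean g = (?s g - ?s p) - (mean g - mean p)" using elim by simp
    have "cmod (?s g - mean g) \<le> cmod (?s g - ?s p) + cmod (mean g - mean p)"
      unfolding eq by (rule norm_triangle_ineq4)
    ultimately have "cmod (?s g - mean g) \<le> e / 3 + e / 3"
      using m by linarith
    thus ?case using e by (simp add: dist_norm)
  qed
qed

section \<open>Toeplitz matrices cut into circulant slots\<close>

text \<open>An index \<open>i\<close> has a kind \<open>\<kappa> i\<close> and a position \<open>\<pi> i\<close>. In this notation a matrix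
  of Toeplitz blocks of different sizes is given by one formula, and the order of the
  indices is irrelevant.\<close>

definition toeplitz_mat :: "nat \<Rightarrow> (nat \<Rightarrow> 'k) \<Rightarrow> (nat \<Rightarrow> nat) \<Rightarrow> ('k \<Rightarrow> 'k \<Rightarrow> int \<Rightarrow> complex) \<Rightarrow> complex mat" where
  "toeplitz_mat d \<kappa> \<pi> c = mat d d (\<lambda>(i, j). c (\<kappa> i) (\<kappa> j) (int (\<pi> i) - int (\<pi> j)))"

text \<open>The matrix \<open>F(\<theta>)\<close> in the same notation, where the position is the number of the
  slot and \<open>h\<close> is the symbol at \<open>\<theta>\<close>.\<close>

definition symbol_mat :: "nat \<Rightarrow> (nat \<Rightarrow> 'k) \<Rightarrow> (nat \<Rightarrow> nat) \<Rightarrow> ('k \<Rightarrow> 'k \<Rightarrow> complex) \<Rightarrow> complex mat" where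
  "symbol_mat D \<kappa> \<pi> h = mat D D (\<lambda>(i, j). if \<pi> i = \<pi> j then h (\<kappa> i) (\<kappa> j) else 0)"

lemma toeplitz_mat_carrier [simp]: "toeplitz_mat d \<kappa> \<pi> c \<in> carrier_mat d d"
  by (simp add: toeplitz_mat_def)

lemma symbol_mat_carrier [simp]: "symbol_mat D \<kappa> \<pi> h \<in> carrier_mat D D"
  by (simp add: symbol_mat_def)

lemma toeplitz_mat_hermitian:
  assumes "\<And>i j. i < d \<Longrightarrow> j < d \<Longrightarrow> c (\<kappa> i) (\<kappa> j) (int (\<pi> i) - int (\<pi> j)) = cnj (c (\<kappa> j) (\<kappa> i) (int (\<pi> j) - int (\<pi> i)))"
  shows "hermitian_mat (toeplitz_mat d \<kappa> \<pi> c)"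
proof (rule hermitian_matI)
  fix i j assume ij: "i < d" "j < d"
  show "toeplitz_mat d \<kappa> \<pi> c $$ (i, j) = cnj (toeplitz_mat d \<kappa> \<pi> c $$ (j, i))"
    unfolding toeplitz_mat_def index_mat(1)[OF ij] index_mat(1)[OF ij(2,1)] prod.case by (rule assms[OF ij])
qed (rule toeplitz_mat_carrier)

lemma symbol_mat_hermitian:
  assumes "\<And>i j. i < D \<Longrightarrow> j < D \<Longrightarrow> h (\<kappa> i) (\<kappa> j) = cnj (h (\<kappa> j) (\<kappa> i))"
  shows "hermitian_mat (symbol_mat D \<kappa> \<pi> h)"
proof (rule hermitian_matI)
  fix i j assume ij: "i < D" "j < D"
  show "symbol_mat D \<kappa> \<pi> h $$ (i, j) = cnj (symbol_mat D \<kappa> \<pi> h $$ (j, i))"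
    unfolding symbol_mat_def index_mat(1)[OF ij] index_mat(1)[OF ij(2,1)] prod.case
    using assms[OF ij] by (cases "\<pi> i = \<pi> j") auto
qed (rule symbol_mat_carrier)

definition indexes :: "nat \<Rightarrow> (nat \<Rightarrow> 'k) \<Rightarrow> (nat \<Rightarrow> nat) \<Rightarrow> 'k set \<Rightarrow> ('k \<Rightarrow> nat) \<Rightarrow> bool" where
  "indexes d \<kappa> \<pi> K ns \<longleftrightarrow> bij_betw (\<lambda>i. (\<kappa> i, \<pi> i)) {..<d} (SIGMA L:K. {..<ns L})"

lemma indexes_kind: "indexes d \<kappa> \<pi> K ns \<Longrightarrow> i < d \<Longrightarrow> \<kappa> i \<in> K"
  and indexes_pos: "indexes d \<kappa> \<pi> K ns \<Longrightarrow> i < d \<Longrightarrow> \<pi> i < ns (\<kappa> i)"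
  using bij_betwE unfolding indexes_def by fastforce+

lemma indexes_inj:
  assumes "indexes d \<kappa> \<pi> K ns" "i < d" "j < d" "\<kappa> i = \<kappa> j" "\<pi> i = \<pi> j"
  shows "i = j"
  using bij_betw_imp_inj_on[OF assms(1)[unfolded indexes_def]] assms(2-) by (auto simp: inj_on_def)

lemma indexes_surj:
  assumes "indexes d \<kappa> \<pi> K ns" "L \<in> K" "p < ns L"
  obtains i where "i < d" "\<kappa> i = L" "\<pi> i = p"
proof -
  have "(L, p) \<in> (\<lambda>i. (\<kappa> i, \<pi> i)) ` {..<d}"
    using assms unfolding indexes_def bij_betw_def by auto
  thus ?thesis using that by auto
qed

lemma indexes_size:
  assumes "indexes d \<kappa> \<pi> K ns" "finite K"
  shows "d = (\<Sum>L\<in>K. ns L)"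
  using bij_betw_same_card[OF assms(1)[unfolded indexes_def]] assms(2) by simp

text \<open>A kind \<open>L\<close> occupies \<open>ns L\<close> positions, the first \<open>k * ms L\<close> of which form \<open>ms L\<close> slots of
  length \<open>k\<close>. The unprimed index maps belong to the Toeplitz matrix of size \<open>d\<close>, the primed
  ones to the symbol of size \<open>D\<close>.\<close>

locale slot_index =
  fixes K :: "'k set" and ns ms :: "'k \<Rightarrow> nat" and d D k :: nat
    and \<kappa> \<kappa>' :: "nat \<Rightarrow> 'k" and \<pi> \<pi>' :: "nat \<Rightarrow> nat"
  assumes finite_K: "finite K"
    and idx: "indexes d \<kappa> \<pi> K ns" and idx': "indexes D \<kappa>' \<pi>' K ms"
    and k_pos': "k > 0" and fit: "\<And>L. L \<in> K \<Longrightarrow> k * ms L \<le> ns L"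
begin

text \<open>The indices that lie in a slot, the index of the symbol for their kind and slot, and the
  position inside the slot.\<close>

definition S where "S = {i \<in> {..<d}. \<pi> i < k * ms (\<kappa> i)}"

definition a where "a i = inv_into {..<D} (\<lambda>\<alpha>. (\<kappa>' \<alpha>, \<pi>' \<alpha>)) (\<kappa> i, \<pi> i div k)"

definition p where "p i = \<pi> i mod k"

lemma
  assumes "i \<in> S"
  shows a_less': "a i < D" and \<kappa>_a: "\<kappa>' (a i) = \<kappa> i" and \<pi>_a: "\<pi>' (a i) = \<pi> i div k"
proof -
  have "\<pi> i div k < ms (\<kappa> i)" using assms k_pos' by (simp add: S_def less_mult_imp_div_less mult.commute)
  hence m: "(\<kappa> i, \<pi> i div k) \<in> (\<lambda>\<alpha>. (\<kappa>' \<alpha>, \<pi>' \<alpha>)) ` {..<D}"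
    using assms indexes_kind[OF idx, of i] idx' unfolding indexes_def bij_betw_def S_def by auto
  show "a i < D" using inv_into_into[OF m] by (simp add: a_def)
  show "\<kappa>' (a i) = \<kappa> i" "\<pi>' (a i) = \<pi> i div k" using f_inv_into_f[OF m] by (simp_all add: a_def)
qed

sublocale circulant_index d D k S a p
proof
  show "k > 0" by (rule k_pos')
  show "S \<subseteq> {..<d}" by (auto simp: S_def)
  show "bij_betw (\<lambda>i. (a i, p i)) S ({..<D} \<times> {..<k})"
  proof (rule bij_betw_imageI)
    show "inj_on (\<lambda>i. (a i, p i)) S"
    proof (rule inj_onI)
      fix i j assume ij: "i \<in> S" "j \<in> S" "(a i, p i) = (a j, p j)"
      have "\<pi> i div k = \<pi> j div k" "\<kappa> i = \<kappa> j" using ij \<kappa>_a[of i] \<kappa>_a[of j] \<pi>_a[of i] \<pi>_a[of j] by auto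
      moreover have "\<pi> i mod k = \<pi> j mod k" using ij by (simp add: p_def)
      ultimately have "\<pi> i = \<pi> j" by (metis div_mult_mod_eq)
      thus "i = j" using indexes_inj[OF idx] ij \<open>\<kappa> i = \<kappa> j\<close> by (auto simp: S_def)
    qed
    show "(\<lambda>i. (a i, p i)) ` S = {..<D} \<times> {..<k}"
    proof (intro equalityI subsetI)
      fix x assume "x \<in> (\<lambda>i. (a i, p i)) ` S"
      thus "x \<in> {..<D} \<times> {..<k}" using a_less' k_pos' by (auto simp: p_def)
    next
      fix x assume "x \<in> {..<D} \<times> {..<k}"
      then obtain b q where x: "x = (b, q)" "b < D" "q < k" by auto
      have L: "\<kappa>' b \<in> K" "\<pi>' b < ms (\<kappa>' b)" using indexes_kind[OF idx'] indexes_pos[OF idx'] x by auto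
      have "\<pi>' b * k + q < (\<pi>' b + 1) * k" using x by simp
      also have "\<dots> \<le> ms (\<kappa>' b) * k" using L by (intro mult_right_mono) auto
      finally have lt: "\<pi>' b * k + q < k * ms (\<kappa>' b)" by (simp add: mult.commute)
      then obtain i where i: "i < d" "\<kappa> i = \<kappa>' b" "\<pi> i = \<pi>' b * k + q"
        using indexes_surj[OF idx L(1), of "\<pi>' b * k + q"] fit[OF L(1)] by auto
      hence iS: "i \<in> S" using lt by (simp add: S_def)
      have "a i = b"
        using indexes_inj[OF idx', of "a i" b] a_less'[OF iS] \<kappa>_a[OF iS] \<pi>_a[OF iS] i x by auto
      moreover have "p i = q" using i x by (simp add: p_def)
      ultimately show "x \<in> (\<lambda>i. (a i, p i)) ` S" using iS x by force
    qed
  qed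
qed

lemma card_position_le:
  "real (card {j \<in> {..<d}. \<bar>int (\<pi> j) - x\<bar> \<le> int w}) \<le> real (card K) * (2 * real w + 1)"
proof -
  let ?J = "{j \<in> {..<d}. \<bar>int (\<pi> j) - x\<bar> \<le> int w}"
  have "inj_on (\<lambda>j. (\<kappa> j, int (\<pi> j))) ?J"
    by (rule inj_onI) (auto intro: indexes_inj[OF idx])
  moreover have "(\<lambda>j. (\<kappa> j, int (\<pi> j))) ` ?J \<subseteq> K \<times> {x - int w..x + int w}"
    using indexes_kind[OF idx] by auto
  ultimately have "card ?J \<le> card (K \<times> {x - int w..x + int w})"
    using finite_K by (intro card_inj_on_le) auto
  also have "\<dots> = card K * (2 * w + 1)"
  proof -
    have "nat (2 * int w + 1) = 2 * w + 1" by simp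
    thus ?thesis by (simp only: card_cartesian_product card_atLeastAtMost_int) simp
  qed
  finally have "real (card ?J) \<le> real (card K * (2 * w + 1))" by (rule of_nat_mono)
  thus ?thesis by (simp only: of_nat_mult of_nat_add of_nat_numeral of_nat_1)
qed

lemma card_residue_le: "card {j \<in> S. int k dvd int (p j) - x} \<le> D"
proof -
  let ?J = "{j \<in> S. int k dvd int (p j) - x}"
  have "inj_on a ?J"
  proof (rule inj_onI)
    fix i j assume ij: "i \<in> ?J" "j \<in> ?J" "a i = a j"
    have "int k dvd (int (p i) - x) - (int (p j) - x)" using ij dvd_diff[of "int k" "int (p i) - x" "int (p j) - x"] by blast
    hence "int (p i) mod int k = int (p j) mod int k" by (simp add: mod_eq_dvd_iff)
    hence "p i = p j" using p_less[of i] p_less[of j] ij by simp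
    thus "i = j" using inj ij by auto
  qed
  moreover have "a ` ?J \<subseteq> {..<D}" using a_less by auto
  ultimately have "card ?J \<le> card {..<D}" by (intro card_inj_on_le) auto
  thus ?thesis by simp
qed

text \<open>From here on the symbol is a trigonometric polynomial of degree at most \<open>w\<close> with
  coefficients bounded by \<open>B\<close>.\<close>

context
  fixes c :: "'k \<Rightarrow> 'k \<Rightarrow> int \<Rightarrow> complex" and w :: nat and B :: real
  assumes band: "\<And>L L' l. L \<in> K \<Longrightarrow> L' \<in> K \<Longrightarrow> \<bar>l\<bar> > int w \<Longrightarrow> c L L' l = 0"
    and bound: "\<And>L L' l. L \<in> K \<Longrightarrow> L' \<in> K \<Longrightarrow> cmod (c L L' l) \<le> B"
    and B0: "B \<ge> 0"
begin

abbreviation "trig L L' \<theta> \<equiv> (\<Sum>l\<in>{-int w..int w}. c L L' l * cis (of_int l * \<theta>))"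

abbreviation "X \<equiv> toeplitz_mat d \<kappa> \<pi> c"

abbreviation "C \<equiv> \<Gamma> (\<lambda>r. symbol_mat D \<kappa>' \<pi>' (\<lambda>L L'. trig L L' (2 * pi * real r / real k))) 0"

lemma circulant_entry:
  assumes "i \<in> S" "j \<in> S"
  shows "C $$ (i, j) = (if \<pi> i div k = \<pi> j div k
    then (\<Sum>l\<in>{-int w..int w}. if int k dvd l - (int (p i) - int (p j)) then c (\<kappa> i) (\<kappa> j) l else 0) else 0)"
proof (cases "\<pi> i div k = \<pi> j div k")
  case True
  have "(\<Sum>r<k. cis (2 * pi * real r * (real (p j) - real (p i)) / real k) * trig (\<kappa> i) (\<kappa> j) (2 * pi * real r / real k))
     = (\<Sum>r<k. \<Sum>l\<in>{-int w..int w}. c (\<kappa> i) (\<kappa> j) l * cis (2 * pi * real_of_int (l - (int (p i) - int (p j))) * real r / real k))"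
  proof (intro sum.cong refl, unfold sum_distrib_left, intro sum.cong refl)
    fix r l
    have "2 * pi * real r * (real (p j) - real (p i)) / real k + real_of_int l * (2 * pi * real r / real k)
        = 2 * pi * real_of_int (l - (int (p i) - int (p j))) * real r / real k"
      by (simp add: add_divide_distrib[symmetric] algebra_simps)
    thus "cis (2 * pi * real r * (real (p j) - real (p i)) / real k) * (c (\<kappa> i) (\<kappa> j) l * cis (real_of_int l * (2 * pi * real r / real k)))
        = c (\<kappa> i) (\<kappa> j) l * cis (2 * pi * real_of_int (l - (int (p i) - int (p j))) * real r / real k)"
      by (simp only: mult.left_commute cis_mult)
  qed
  also have "\<dots> = (\<Sum>l\<in>{-int w..int w}. c (\<kappa> i) (\<kappa> j) l * (\<Sum>r<k. cis (2 * pi * real_of_int (l - (int (p i) - int (p j))) * real r / real k)))"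
    by (subst sum.swap) (simp only: sum_distrib_left)
  also have "\<dots> = (\<Sum>l\<in>{-int w..int w}. if int k dvd l - (int (p i) - int (p j)) then c (\<kappa> i) (\<kappa> j) l else 0) * of_nat k"
    unfolding sum_cis_roots[OF k_pos] sum_distrib_right by (intro sum.cong refl) auto
  finally show ?thesis
    using True assms k_pos a_less' \<kappa>_a \<pi>_a by (simp add: \<Gamma>_index_S symbol_mat_def)
next
  case False
  thus ?thesis using assms a_less' \<kappa>_a \<pi>_a by (simp add: \<Gamma>_index_S symbol_mat_def)
qed

text \<open>In a row at distance at least \<open>w\<close> from the ends of its slot, the band stays inside the
  slot. Neither the entries to other slots nor the wrap-around of the circulant contribute.\<close>

lemma good_rows_agree:
  assumes i: "i \<in> S" "w \<le> p i" "p i + w < k" and j: "j \<in> S"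
  shows "X $$ (i, j) = C $$ (i, j)"
proof -
  have d: "i < d" "j < d" using i j by (auto simp: S_def)
  hence K: "\<kappa> i \<in> K" "\<kappa> j \<in> K" using indexes_kind[OF idx] by auto
  have pi: "int (\<pi> i) = int (\<pi> i div k) * int k + int (p i)" "int (\<pi> j) = int (\<pi> j div k) * int k + int (p j)"
    by (simp_all add: p_def flip: of_nat_mult of_nat_add)
  have pj: "p j < k" by (rule p_less[OF j])
  have X: "X $$ (i, j) = c (\<kappa> i) (\<kappa> j) (int (\<pi> i) - int (\<pi> j))" using d by (simp add: toeplitz_mat_def)
  show ?thesis
  proof (cases "\<pi> i div k = \<pi> j div k")
    case True
    let ?\<delta> = "int (p i) - int (p j)"
    have "(\<Sum>l\<in>{-int w..int w}. if int k dvd l - ?\<delta> then c (\<kappa> i) (\<kappa> j) l else 0)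
        = (\<Sum>l\<in>{-int w..int w}. if l = ?\<delta> then c (\<kappa> i) (\<kappa> j) l else 0)"
    proof (intro sum.cong refl if_cong)
      fix l assume l: "l \<in> {-int w..int w}"
      show "int k dvd l - ?\<delta> \<longleftrightarrow> l = ?\<delta>"
        using l i pj zdvd_imp_le[of "int k" "l - ?\<delta>"] zdvd_imp_le[of "int k" "?\<delta> - l"]
        by (cases l ?\<delta> rule: linorder_cases) (auto simp: dvd_diff_commute)
    qed
    also have "\<dots> = c (\<kappa> i) (\<kappa> j) ?\<delta>" using band[OF K, of ?\<delta>] by auto
    finally show ?thesis unfolding X circulant_entry[OF i(1) j] using True pi by simp
  next
    case False
    have "\<bar>int (\<pi> i) - int (\<pi> j)\<bar> > int w"
    proof (cases "\<pi> i div k" "\<pi> j div k" rule: linorder_cases)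
      case less
      hence "(int (\<pi> i div k) + 1) * int k \<le> int (\<pi> j div k) * int k" by (intro mult_right_mono) auto
      thus ?thesis using pi i pj by (simp add: distrib_right)
    next
      case greater
      hence "(int (\<pi> j div k) + 1) * int k \<le> int (\<pi> i div k) * int k" by (intro mult_right_mono) auto
      thus ?thesis using pi i pj by (simp add: distrib_right)
    qed (use False in simp)
    thus ?thesis unfolding X circulant_entry[OF i(1) j] using False band[OF K] by simp
  qed
qed

lemma toeplitz_row_sum: "i < d \<Longrightarrow> (\<Sum>j<d. cmod (X $$ (i, j))) \<le> B * (real (card K) * (2 * real w + 1))"
  and toeplitz_col_sum: "i < d \<Longrightarrow> (\<Sum>j<d. cmod (X $$ (j, i))) \<le> B * (real (card K) * (2 * real w + 1))"
proof -
  assume i: "i < d"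
  have K: "\<kappa> j \<in> K" if "j < d" for j using indexes_kind[OF idx that] .
  let ?J = "{j \<in> {..<d}. \<bar>int (\<pi> j) - int (\<pi> i)\<bar> \<le> int w}"
  have le: "(\<Sum>j<d. g j) \<le> B * (real (card K) * (2 * real w + 1))"
    if "\<And>j. j < d \<Longrightarrow> g j \<le> (if j \<in> ?J then B else 0)" for g
  proof -
    have "(\<Sum>j<d. g j) \<le> (\<Sum>j<d. if j \<in> ?J then B else 0)" using that by (intro sum_mono) auto
    also have "\<dots> = B * real (card ?J)" by (simp add: sum.If_cases Int_def)
    also have "\<dots> \<le> B * (real (card K) * (2 * real w + 1))"
      using card_position_le B0 by (intro mult_left_mono)
    finally show ?thesis .
  qed
  show "(\<Sum>j<d. cmod (X $$ (i, j))) \<le> B * (real (card K) * (2 * real w + 1))"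
    using i by (intro le) (auto simp: toeplitz_mat_def bound band K)
  show "(\<Sum>j<d. cmod (X $$ (j, i))) \<le> B * (real (card K) * (2 * real w + 1))"
    using i by (intro le) (auto simp: toeplitz_mat_def bound band K)
qed

lemma circulant_row_sum:
  assumes i: "i < d"
  shows "(\<Sum>j<d. cmod (C $$ (i, j))) \<le> B * (real D * (2 * real w + 1))"
proof (cases "i \<in> S")
  case False
  hence "(\<Sum>j<d. cmod (C $$ (i, j))) = 0" using i by (auto simp: \<Gamma>_index_off)
  thus ?thesis using B0 by simp
next
  case True
  have K: "\<kappa> j \<in> K" if "j \<in> S" for j using indexes_kind[OF idx] that by (auto simp: S_def)
  have "(\<Sum>j<d. cmod (C $$ (i, j))) = (\<Sum>j\<in>S. cmod (C $$ (i, j)))"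
    using S by (intro sum.mono_neutral_right) (auto simp: \<Gamma>_index_off i)
  also have "\<dots> \<le> (\<Sum>j\<in>S. \<Sum>l\<in>{-int w..int w}. if int k dvd int (p j) - (int (p i) - l) then B else 0)"
  proof (intro sum_mono)
    fix j assume j: "j \<in> S"
    have "cmod (C $$ (i, j)) \<le> (\<Sum>l\<in>{-int w..int w}. cmod (if int k dvd l - (int (p i) - int (p j)) then c (\<kappa> i) (\<kappa> j) l else 0))"
      unfolding circulant_entry[OF True j] by (auto intro: norm_sum sum_nonneg)
    also have "\<dots> \<le> (\<Sum>l\<in>{-int w..int w}. if int k dvd int (p j) - (int (p i) - l) then B else 0)"
      using bound[OF K[OF True] K[OF j]] B0 by (intro sum_mono) (auto simp: algebra_simps)
    finally show "cmod (C $$ (i, j)) \<le> (\<Sum>l\<in>{-int w..int w}. if int k dvd int (p j) - (int (p i) - l) then B else 0)" .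
  qed
  also have "\<dots> = (\<Sum>l\<in>{-int w..int w}. B * real (card {j \<in> S. int k dvd int (p j) - (int (p i) - l)}))"
    using finite_S by (subst sum.swap) (simp add: sum.If_cases Int_def mult.commute)
  also have "\<dots> \<le> (\<Sum>l\<in>{-int w..int w}. B * real D)"
    using card_residue_le B0 by (intro sum_mono mult_left_mono) auto
  also have "\<dots> = B * (real D * (2 * real w + 1))" by (simp add: algebra_simps)
  finally show ?thesis .
qed

text \<open>The matrices differ only in the rows within \<open>w\<close> of the end of a slot and in the rows and
  columns outside \<open>S\<close>; each of these contributes a bounded amount, by the row and column
  sums above.\<close>

lemma toeplitz_circulant_distance:
  "(\<Sum>i<d. \<Sum>j<d. cmod (X $$ (i, j) - C $$ (i, j)))
     \<le> B * (real (card K) + real D) * (2 * real w + 1) * (2 * real (d - k * D) + 2 * real w * real D)"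
proof -
  define good where "good = {i \<in> S. w \<le> p i \<and> p i + w < k}"
  define M where "M = B * (real (card K) + real D) * (2 * real w + 1)"
  have M0: "M \<ge> 0" unfolding M_def using B0 by simp
  have "cmod (X $$ (i, j) - C $$ (i, j)) \<le>
      (if i \<notin> good then cmod (X $$ (i, j)) + cmod (C $$ (i, j)) else 0) + (if j \<notin> S then cmod (X $$ (i, j)) else 0)"
    if ij: "i < d" "j < d" for i j
  proof (cases "i \<in> good")
    case True
    show ?thesis
    proof (cases "j \<in> S")
      case j: False
      thus ?thesis using True ij \<Gamma>_index_off[of i j] by (auto simp: good_def)
    qed (use True good_rows_agree[of i j] in \<open>simp add: good_def\<close>)
  next
    case False
    have "cmod (X $$ (i, j) - C $$ (i, j)) \<le> cmod (X $$ (i, j)) + cmod (C $$ (i, j))"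
      by (rule norm_triangle_ineq4)
    thus ?thesis using False norm_ge_zero[of "X $$ (i, j)"] by (auto simp del: norm_ge_zero intro: add_increasing2)
  qed
  hence "(\<Sum>i<d. \<Sum>j<d. cmod (X $$ (i, j) - C $$ (i, j))) \<le> (\<Sum>i<d. \<Sum>j<d.
      (if i \<notin> good then cmod (X $$ (i, j)) + cmod (C $$ (i, j)) else 0) + (if j \<notin> S then cmod (X $$ (i, j)) else 0))"
    by (intro sum_mono) auto
  also have "\<dots> = (\<Sum>i<d. if i \<notin> good then (\<Sum>j<d. cmod (X $$ (i, j))) + (\<Sum>j<d. cmod (C $$ (i, j))) else 0)
      + (\<Sum>j<d. if j \<notin> S then (\<Sum>i<d. cmod (X $$ (i, j))) else 0)"
  proof -
    have "(\<Sum>i<d. \<Sum>j<d. if j \<notin> S then cmod (X $$ (i, j)) else 0) = (\<Sum>j<d. if j \<notin> S then (\<Sum>i<d. cmod (X $$ (i, j))) else 0)"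
      by (subst sum.swap) (auto intro!: sum.cong)
    moreover have "(\<Sum>i<d. \<Sum>j<d. if i \<notin> good then cmod (X $$ (i, j)) + cmod (C $$ (i, j)) else 0)
       = (\<Sum>i<d. if i \<notin> good then (\<Sum>j<d. cmod (X $$ (i, j))) + (\<Sum>j<d. cmod (C $$ (i, j))) else 0)"
      by (auto intro!: sum.cong simp: sum.distrib)
    ultimately show ?thesis by (simp only: sum.distrib)
  qed
  also have "\<dots> \<le> (\<Sum>i<d. if i \<notin> good then M else 0) + (\<Sum>j<d. if j \<notin> S then M else 0)"
  proof (intro add_mono sum_mono)
    fix i assume "i \<in> {..<d}"
    hence i: "i < d" by simp
    have "(\<Sum>j<d. cmod (X $$ (i, j))) + (\<Sum>j<d. cmod (C $$ (i, j))) \<le> M"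
      using toeplitz_row_sum[OF i] circulant_row_sum[OF i] by (simp add: M_def algebra_simps)
    moreover have "(\<Sum>j<d. cmod (X $$ (j, i))) \<le> M"
    proof -
      have "B * (real D * (2 * real w + 1)) \<ge> 0" using B0 by simp
      thus ?thesis using toeplitz_col_sum[OF i] by (simp add: M_def algebra_simps)
    qed
    ultimately show "(if i \<notin> good then (\<Sum>j<d. cmod (X $$ (i, j))) + (\<Sum>j<d. cmod (C $$ (i, j))) else 0) \<le> (if i \<notin> good then M else 0)"
      "(if i \<notin> S then \<Sum>j<d. cmod (X $$ (j, i)) else 0) \<le> (if i \<notin> S then M else 0)"
      by auto
  qed
  also have "\<dots> = M * (real (card ({..<d} - good)) + real (card ({..<d} - S)))"
    by (simp add: sum.If_cases algebra_simps Diff_eq Collect_neg_eq)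
  also have "\<dots> \<le> M * ((real (d - k * D) + 2 * real w * real D) + real (d - k * D))"
  proof (intro mult_left_mono add_mono M0)
    have cS: "card ({..<d} - S) = d - k * D" using S finite_S by (simp add: card_Diff_subset card_S)
    show "real (card ({..<d} - S)) \<le> real (d - k * D)" by (simp add: cS)
    let ?E = "{i \<in> S. p i < w \<or> k - w \<le> p i}"
    have "{..<d} - good \<subseteq> ({..<d} - S) \<union> ?E" by (auto simp: good_def)
    hence "card ({..<d} - good) \<le> card (({..<d} - S) \<union> ?E)"
      using finite_S by (intro card_mono) auto
    also have "\<dots> \<le> card ({..<d} - S) + card ?E" by (rule card_Un_le)
    also have "card ?E \<le> card ({..<D} \<times> ({..<w} \<union> {k - w..<k}))"
    proof (rule card_inj_on_le)
      show "inj_on (\<lambda>i. (a i, p i)) ?E" using inj by (auto simp: inj_on_def)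
      show "(\<lambda>i. (a i, p i)) ` ?E \<subseteq> {..<D} \<times> ({..<w} \<union> {k - w..<k})"
        using a_less p_less by auto
    qed auto
    also have "\<dots> \<le> D * (w + w)"
      unfolding card_cartesian_product card_lessThan
      by (intro mult_left_mono order_trans[OF card_Un_le]) auto
    finally have "card ({..<d} - good) \<le> (d - k * D) + 2 * w * D" using cS by (simp add: algebra_simps)
    hence "real (card ({..<d} - good)) \<le> real ((d - k * D) + 2 * w * D)" by (rule of_nat_mono)
    thus "real (card ({..<d} - good)) \<le> real (d - k * D) + 2 * real w * real D"
      by (simp only: of_nat_mult of_nat_add of_nat_numeral)
  qed
  finally show ?thesis by (simp add: M_def algebra_simps)
qed

end

end

section \<open>Density of trigonometric polynomials in the integrable functions\<close>

abbreviation "circ_measure \<equiv> lebesgue_on {-pi..pi}"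

lemma set_integrable_circ:
  fixes f :: "real \<Rightarrow> 'a::{banach, second_countable_topology}"
  shows "set_integrable lebesgue {-pi..pi} f \<longleftrightarrow> integrable circ_measure f"
  unfolding set_integrable_def by (subst integrable_restrict_space) auto

lemma set_integral_circ:
  fixes f :: "real \<Rightarrow> 'a::{banach, second_countable_topology}"
  shows "(LINT \<theta>:{-pi..pi}|lebesgue. f \<theta>) = (LINT \<theta>|circ_measure. f \<theta>)"
  unfolding set_lebesgue_integral_def by (subst integral_restrict_space) auto

lemma circ_finite: "finite_measure circ_measure"
  by (rule finite_measure_lebesgue_on) simp

lemma circ_bounded_integrable:
  fixes f :: "real \<Rightarrow> 'a::{banach, second_countable_topology}"
  assumes "f \<in> borel_measurable circ_measure" "\<And>\<theta>. \<theta> \<in> {-pi..pi} \<Longrightarrow> norm (f \<theta>) \<le> B"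
  shows "integrable circ_measure f"
  using assms by (intro finite_measure.integrable_const_bound[OF circ_finite, of _ B] AE_I2) auto

text \<open>The radial retraction onto the closed disc of radius \<open>B\<close>. It is continuous, and
  \<open>clip B (f \<theta>)\<close> tends to \<open>f \<theta>\<close> as \<open>B\<close> grows.\<close>

definition clip :: "real \<Rightarrow> complex \<Rightarrow> complex" where
  "clip B z = (B / max B (cmod z)) *\<^sub>R z"

lemma clip_bound: "B > 0 \<Longrightarrow> cmod (clip B z) \<le> B"
  unfolding clip_def by (auto simp: field_simps max_def)

lemma clip_diff: "B > 0 \<Longrightarrow> cmod (z - clip B z) \<le> cmod z"
proof -
  assume B: "B > 0"
  have "z - clip B z = (1 - B / max B (cmod z)) *\<^sub>R z" unfolding clip_def by (simp add: scaleR_left_diff_distrib)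
  hence "cmod (z - clip B z) = \<bar>1 - B / max B (cmod z)\<bar> * cmod z" by simp
  moreover have "0 \<le> B / max B (cmod z)" "B / max B (cmod z) \<le> 1" using B by (auto simp: divide_le_eq max_def)
  hence "\<bar>1 - B / max B (cmod z)\<bar> \<le> 1" by linarith
  ultimately show ?thesis by (simp add: mult_left_le_one_le)
qed

lemma clip_id: "B > 0 \<Longrightarrow> cmod z \<le> B \<Longrightarrow> clip B z = z"
  unfolding clip_def by (simp add: max_def)

lemma clip_continuous: "B > 0 \<Longrightarrow> continuous_on A f \<Longrightarrow> continuous_on A (\<lambda>x. clip B (f x))"
  unfolding clip_def by (intro continuous_intros) (auto simp: max_def)

lemma trig_poly_dense_L1:
  assumes f: "integrable circ_measure f" and e: "e > 0"
  shows "\<exists>p. trig_poly p \<and> (LINT \<theta>|circ_measure. cmod (f \<theta> - p \<theta>)) < e"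
proof -
  let ?M = circ_measure
  have fm: "f \<in> borel_measurable ?M" using f by simp
  have clip_meas: "(\<lambda>x. clip B (g x)) \<in> borel_measurable ?M" if "g \<in> borel_measurable ?M" "B > 0" for g B
    using borel_measurable_continuous_on[OF clip_continuous[OF that(2) continuous_on_id] that(1)] by simp
  have nm: "(\<lambda>\<theta>. cmod (g \<theta>)) \<in> borel_measurable ?M" if "g \<in> borel_measurable ?M" for g
    using measurable_compose[OF that borel_measurable_norm] .
  \<comment> \<open>The continuous approximants taken below converge to \<open>f\<close> only almost everywhere.
     Truncation at a level \<open>B\<close> gives the constant that dominates them.\<close>
  have "(\<lambda>j. LINT \<theta>|?M. cmod (f \<theta> - clip (real (Suc j)) (f \<theta>))) \<longlonglongrightarrow> (LINT \<theta>|?M. (0::real))"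
  proof (rule integral_dominated_convergence[where w = "\<lambda>\<theta>. cmod (f \<theta>)"])
    show "AE x in ?M. (\<lambda>j. cmod (f x - clip (real (Suc j)) (f x))) \<longlonglongrightarrow> 0"
    proof (rule AE_I2)
      fix x
      obtain N :: nat where N: "cmod (f x) \<le> real N" using real_arch_simple by blast
      have "\<forall>\<^sub>F j in sequentially. cmod (f x - clip (real (Suc j)) (f x)) = 0"
        by (rule eventually_sequentiallyI[of N]) (use N in \<open>auto simp: clip_id\<close>)
      thus "(\<lambda>j. cmod (f x - clip (real (Suc j)) (f x))) \<longlonglongrightarrow> 0" by (rule tendsto_eventually)
    qed
    show "\<And>j. AE x in ?M. norm (cmod (f x - clip (real (Suc j)) (f x))) \<le> cmod (f x)"
      by (intro AE_I2) (simp add: clip_diff)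
    show "\<And>j. (\<lambda>\<theta>. cmod (f \<theta> - clip (real (Suc j)) (f \<theta>))) \<in> borel_measurable ?M"
      by (rule measurable_compose[OF borel_measurable_diff[OF fm clip_meas[OF fm]] borel_measurable_norm]) simp
  qed (use f in auto)
  hence "\<forall>\<^sub>F j in sequentially. (LINT \<theta>|?M. cmod (f \<theta> - clip (real (Suc j)) (f \<theta>))) < e / 3"
    using e by (intro order_tendstoD(2)) auto
  then obtain j where j: "(LINT \<theta>|?M. cmod (f \<theta> - clip (real (Suc j)) (f \<theta>))) < e / 3"
    by (auto simp: eventually_sequentially)
  define B where "B = real (Suc j)"
  have B: "B > 0" by (simp add: B_def)
  have "f measurable_on {-pi..pi}" using fm by (subst measurable_on_iff_borel_measurable) auto
  then obtain N g where N: "negligible N" and g: "\<And>n. continuous_on UNIV (g n)"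
    and lim: "\<And>x. x \<notin> N \<Longrightarrow> (\<lambda>n. g n x) \<longlonglongrightarrow> (if x \<in> {-pi..pi} then f x else 0)"
    unfolding measurable_on_def by blast
  \<comment> \<open>The factor \<open>cut n\<close> vanishes at the end points, so that \<open>u n\<close> is periodic, and is
    eventually \<open>1\<close> at each interior point.\<close>
  define cut where "cut = (\<lambda>n x. max 0 (min 1 (real n * (pi - \<bar>x\<bar>))))"
  define u where "u = (\<lambda>n x. cut n x *\<^sub>R clip B (g n x))"
  have ucont: "continuous_on A (u n)" for A n
    unfolding u_def cut_def by (intro continuous_intros clip_continuous B continuous_on_subset[OF g]) auto
  have ubound: "cmod (u n x) \<le> B" for n x
  proof -
    have "\<bar>cut n x\<bar> \<le> 1" by (auto simp: cut_def)
    hence "\<bar>cut n x\<bar> * cmod (clip B (g n x)) \<le> 1 * B" using clip_bound[OF B] by (intro mult_mono) auto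
    thus ?thesis by (simp add: u_def)
  qed
  have umeas: "u n \<in> borel_measurable ?M" for n
    by (intro continuous_imp_measurable_on_sets_lebesgue ucont) auto
  have cfm: "(\<lambda>\<theta>. clip B (f \<theta>)) \<in> borel_measurable ?M" by (rule clip_meas[OF fm B])
  have "(\<lambda>n. LINT \<theta>|?M. cmod (clip B (f \<theta>) - u n \<theta>)) \<longlonglongrightarrow> (LINT \<theta>|?M. (0::real))"
  proof (rule integral_dominated_convergence[where w = "\<lambda>\<theta>. 2 * B"])
    have "AE x in lebesgue. x \<notin> N \<union> {-pi, pi}"
      using N by (intro AE_not_in) (auto simp: negligible_iff_null_sets[symmetric] negligible_Un)
    hence "AE x in ?M. x \<notin> N \<union> {-pi, pi}" by (subst AE_restrict_space_iff) auto
    moreover have "AE x in ?M. x \<in> {-pi..pi}" by (intro AE_I2) simp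
    ultimately show "AE x in ?M. (\<lambda>n. cmod (clip B (f x) - u n x)) \<longlonglongrightarrow> 0"
    proof eventually_elim
      case (elim x)
      hence x: "\<bar>x\<bar> < pi" "x \<notin> N" "x \<in> {-pi..pi}" by auto
      have "isCont (clip B) (f x)"
        using clip_continuous[OF B continuous_on_id[of UNIV]] by (simp add: continuous_on_eq_continuous_at)
      moreover have "(\<lambda>n. g n x) \<longlonglongrightarrow> f x" using lim[OF x(2)] x(3) by simp
      ultimately have "(\<lambda>n. clip B (g n x)) \<longlonglongrightarrow> clip B (f x)" by (rule isCont_tendsto_compose)
      moreover have "(\<lambda>n. cut n x) \<longlonglongrightarrow> 1"
      proof -
        obtain n0 :: nat where n0: "1 / (pi - \<bar>x\<bar>) \<le> real n0" using real_arch_simple by blast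
        have "\<forall>\<^sub>F n in sequentially. cut n x = 1"
        proof (rule eventually_sequentiallyI)
          fix n assume "n \<ge> n0"
          hence "1 / (pi - \<bar>x\<bar>) \<le> real n" using n0 by linarith
          hence "1 \<le> real n * (pi - \<bar>x\<bar>)" using x by (simp add: field_simps)
          thus "cut n x = 1" by (simp add: cut_def)
        qed
        thus ?thesis by (rule tendsto_eventually)
      qed
      ultimately have "(\<lambda>n. clip B (f x) - u n x) \<longlonglongrightarrow> clip B (f x) - 1 *\<^sub>R clip B (f x)"
        unfolding u_def by (intro tendsto_intros)
      thus ?case by (simp add: tendsto_norm_zero)
    qed
    show "\<And>n. AE x in ?M. norm (cmod (clip B (f x) - u n x)) \<le> 2 * B"
    proof (intro AE_I2)
      fix n x
      have "cmod (clip B (f x) - u n x) \<le> cmod (clip B (f x)) + cmod (u n x)" by (rule norm_triangle_ineq4)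
      also have "\<dots> \<le> 2 * B" using clip_bound[OF B, of "f x"] ubound[of n x] by linarith
      finally show "norm (cmod (clip B (f x) - u n x)) \<le> 2 * B" by simp
    qed
    show "integrable ?M (\<lambda>\<theta>. 2 * B)" by (rule circ_bounded_integrable) auto
    show "\<And>n. (\<lambda>\<theta>. cmod (clip B (f \<theta>) - u n \<theta>)) \<in> borel_measurable ?M"
      by (intro nm borel_measurable_diff cfm umeas)
  qed auto
  hence "\<forall>\<^sub>F n in sequentially. (LINT \<theta>|?M. cmod (clip B (f \<theta>) - u n \<theta>)) < e / 3"
    using e by (intro order_tendstoD(2)) auto
  then obtain n where n: "(LINT \<theta>|?M. cmod (clip B (f \<theta>) - u n \<theta>)) < e / 3"
    by (auto simp: eventually_sequentially)
  have "u n (-pi) = u n pi" by (simp add: u_def cut_def)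
  \<comment> \<open>On an interval of length \<open>2 * pi\<close> this accuracy costs \<open>e / 4\<close>, which together with the
    two errors below \<open>e / 3\<close> stays below \<open>e\<close>.\<close>
  moreover have "e / (8 * pi) > 0" using e by simp
  ultimately obtain p where p: "trig_poly p" "\<And>\<theta>. \<theta> \<in> {-pi..pi} \<Longrightarrow> cmod (u n \<theta> - p \<theta>) < e / (8 * pi)"
    using trig_poly_dense_continuous[OF ucont, of n "e / (8 * pi)"] by auto
  have pm: "p \<in> borel_measurable ?M"
    by (intro continuous_imp_measurable_on_sets_lebesgue trig_poly_continuous p) auto
  have i1: "integrable ?M (\<lambda>\<theta>. cmod (f \<theta> - clip B (f \<theta>)))"
    by (rule Bochner_Integration.integrable_bound[OF integrable_norm[OF f]])
       (auto intro!: nm borel_measurable_diff fm cfm AE_I2 simp: clip_diff B)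
  have i2: "integrable ?M (\<lambda>\<theta>. cmod (clip B (f \<theta>) - u n \<theta>))"
  proof (rule circ_bounded_integrable[of _ "B + B"])
    show "(\<lambda>\<theta>. cmod (clip B (f \<theta>) - u n \<theta>)) \<in> borel_measurable ?M"
      by (intro nm borel_measurable_diff cfm umeas)
    fix \<theta> show "norm (cmod (clip B (f \<theta>) - u n \<theta>)) \<le> B + B"
      using norm_triangle_ineq4[of "clip B (f \<theta>)" "u n \<theta>"] clip_bound[OF B, of "f \<theta>"] ubound[of n \<theta>] by simp
  qed
  have i3: "integrable ?M (\<lambda>\<theta>. e / (8 * pi))" by (rule circ_bounded_integrable) auto
  have "(LINT \<theta>|?M. cmod (f \<theta> - p \<theta>))
      \<le> (LINT \<theta>|?M. cmod (f \<theta> - clip B (f \<theta>)) + cmod (clip B (f \<theta>) - u n \<theta>) + e / (8 * pi))"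
  proof (rule Bochner_Integration.integral_mono)
    show r: "integrable ?M (\<lambda>\<theta>. cmod (f \<theta> - clip B (f \<theta>)) + cmod (clip B (f \<theta>) - u n \<theta>) + e / (8 * pi))"
      by (intro Bochner_Integration.integrable_add i1 i2 i3)
    show b: "cmod (f \<theta> - p \<theta>) \<le> cmod (f \<theta> - clip B (f \<theta>)) + cmod (clip B (f \<theta>) - u n \<theta>) + e / (8 * pi)"
      if "\<theta> \<in> space ?M" for \<theta>
      using that p(2)[of \<theta>] norm_triangle_ineq[of "f \<theta> - clip B (f \<theta>)" "clip B (f \<theta>) - u n \<theta>"]
        norm_triangle_ineq[of "f \<theta> - u n \<theta>" "u n \<theta> - p \<theta>"] by simp
    show "integrable ?M (\<lambda>\<theta>. cmod (f \<theta> - p \<theta>))"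
      by (rule Bochner_Integration.integrable_bound[OF r])
         (use b in \<open>auto intro!: nm borel_measurable_diff fm pm AE_I2 intro: order_trans[OF _ abs_ge_self]\<close>)
  qed
  also have "\<dots> = (LINT \<theta>|?M. cmod (f \<theta> - clip B (f \<theta>))) + (LINT \<theta>|?M. cmod (clip B (f \<theta>) - u n \<theta>)) + (LINT \<theta>|?M. e / (8 * pi))"
    using i1 i2 i3 by simp
  also have "(LINT \<theta>|?M. e / (8 * pi)) = e / 4"
    by (simp add: measure_restrict_space)
  finally have "(LINT \<theta>|?M. cmod (f \<theta> - p \<theta>)) < e" using j n e unfolding B_def by linarith
  with p(1) show ?thesis by blast
qed

section \<open>Fourier coefficients and the trace bound for Toeplitz matrices\<close>

definition fcoef :: "(real \<Rightarrow> complex) \<Rightarrow> int \<Rightarrow> complex" where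
  "fcoef f l = mean (\<lambda>\<theta>. f \<theta> * cis (- of_int l * \<theta>))"

lemma cis_measurable: "(\<lambda>\<theta>. cis (x * \<theta>)) \<in> borel_measurable circ_measure"
  by (intro continuous_imp_measurable_on_sets_lebesgue continuous_intros) auto

lemma integrable_mult_cis:
  assumes "integrable circ_measure f"
  shows "integrable circ_measure (\<lambda>\<theta>. f \<theta> * cis (x * \<theta>))"
  by (rule Bochner_Integration.integrable_bound[OF assms])
     (auto intro!: borel_measurable_times cis_measurable AE_I2 borel_measurable_integrable[OF assms] simp: norm_mult)

lemma mean_sum:
  assumes "\<And>i. i \<in> I \<Longrightarrow> integrable circ_measure (g i)"
  shows "mean (\<lambda>\<theta>. \<Sum>i\<in>I. g i \<theta>) = (\<Sum>i\<in>I. mean (g i))"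
  unfolding mean_def set_integral_circ using assms by (simp add: sum_distrib_left)

lemma fcoef_zero: "fcoef (\<lambda>_. 0) l = 0"
  unfolding fcoef_def by (simp add: mean_const)

lemma fcoef_diff:
  assumes "integrable circ_measure f" "integrable circ_measure g"
  shows "fcoef f l - fcoef g l = fcoef (\<lambda>\<theta>. f \<theta> - g \<theta>) l"
  unfolding fcoef_def left_diff_distrib
  by (rule mean_diff[symmetric]) (unfold set_integrable_circ, (rule integrable_mult_cis assms)+)

lemma fcoef_cnj:
  assumes "integrable circ_measure f"
  shows "fcoef (\<lambda>\<theta>. cnj (f \<theta>)) l = cnj (fcoef f (-l))"
proof -
  have e: "cnj (f \<theta>) * cis (- of_int l * \<theta>) = cnj (f \<theta> * cis (- of_int (-l) * \<theta>))" for \<theta>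
    by (simp add: cis_cnj)
  show ?thesis
    unfolding fcoef_def mean_def set_integral_circ e Bochner_Integration.integral_cnj by simp
qed

lemma trig_poly_integrable: "trig_poly p \<Longrightarrow> integrable circ_measure p"
  using continuous_set_integrable[OF trig_poly_continuous] set_integrable_circ by blast

lemma trig_poly_fcoef:
  assumes "trig_poly p"
  shows "\<exists>w. \<forall>w'\<ge>w. (\<forall>l. \<bar>l\<bar> > int w' \<longrightarrow> fcoef p l = 0) \<and>
           (\<forall>\<theta>. p \<theta> = (\<Sum>l\<in>{-int w'..int w'}. fcoef p l * cis (of_int l * \<theta>)))"
proof -
  obtain c w where c: "\<And>l. \<bar>l\<bar> > int w \<Longrightarrow> c l = 0"
    and p: "\<And>\<theta>. p \<theta> = (\<Sum>l\<in>{-int w..int w}. c l * cis (of_int l * \<theta>))"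
    using trig_poly_coeffs[OF assms] by blast
  have f: "fcoef p = c"
  proof
    fix l
    have "fcoef p l = mean (\<lambda>\<theta>. \<Sum>l'\<in>{-int w..int w}. c l' * cis (of_int (l' - l) * \<theta>))"
      unfolding fcoef_def p sum_distrib_right
      by (rule arg_cong[of _ _ mean], rule ext, intro sum.cong refl)
         (simp add: mult.assoc cis_mult algebra_simps del: mult_minus_left)
    also have "\<dots> = (\<Sum>l'\<in>{-int w..int w}. mean (\<lambda>\<theta>. c l' * cis (of_int (l' - l) * \<theta>)))"
      by (intro mean_sum trig_poly_integrable trig_poly.intros)
    also have "\<dots> = (\<Sum>l'\<in>{-int w..int w}. if l' = l then c l' else 0)"
      unfolding mean_cmult mean_cis by (intro sum.cong) auto
    also have "\<dots> = c l" using c[of l] by auto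
    finally show "fcoef p l = c l" .
  qed
  have "(\<forall>l. \<bar>l\<bar> > int w' \<longrightarrow> c l = 0) \<and> (\<forall>\<theta>. p \<theta> = (\<Sum>l\<in>{-int w'..int w'}. c l * cis (of_int l * \<theta>)))"
    if "w' \<ge> w" for w'
  proof (intro conjI allI impI)
    fix \<theta> show "p \<theta> = (\<Sum>l\<in>{-int w'..int w'}. c l * cis (of_int l * \<theta>))"
      unfolding p using that by (intro sum.mono_neutral_left) (auto simp: c)
  qed (use that c in auto)
  thus ?thesis unfolding f by blast
qed

abbreviation "fcoefs h \<equiv> (\<lambda>L L'. fcoef (h L L'))"

text \<open>For a fixed \<open>\<theta>\<close> the contribution of a pair of kinds is the symbol at \<open>\<theta>\<close>
  times the value of the bilinear form \<open>M\<close> at two vectors whose entries are exponentials or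
  \<open>0\<close>, of norm at most the square root of \<open>d\<close>. The bound is thus linear in the \<open>L\<^sup>1\<close>
  norm of the symbol and in \<open>d\<close>.\<close>

lemma toeplitz_trace_bound:
  fixes g :: "'k \<Rightarrow> 'k \<Rightarrow> real \<Rightarrow> complex"
  assumes g: "\<And>L L'. L \<in> K \<Longrightarrow> L' \<in> K \<Longrightarrow> integrable circ_measure (g L L')"
    and K: "finite K" "\<And>i. i < d \<Longrightarrow> \<kappa> i \<in> K"
    and M: "M \<in> carrier_mat d d" "op_bound d M b" and b: "b \<ge> 0"
  shows "cmod (tr (M * toeplitz_mat d \<kappa> \<pi> (fcoefs g)))
    \<le> b * real d * (1 / (2 * pi) * (LINT \<theta>|circ_measure. (\<Sum>L\<in>K. \<Sum>L'\<in>K. cmod (g L L' \<theta>))))"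
proof -
  define G where "G = (\<lambda>\<theta>. \<Sum>i<d. \<Sum>j<d. M $$ (i, j) * (g (\<kappa> j) (\<kappa> i) \<theta> * cis (- of_int (int (\<pi> j) - int (\<pi> i)) * \<theta>)))"
  let ?T = "\<lambda>\<theta>. \<Sum>L\<in>K. \<Sum>L'\<in>K. cmod (g L L' \<theta>)"
  have int: "integrable circ_measure (\<lambda>\<theta>. M $$ (i, j) * (g (\<kappa> j) (\<kappa> i) \<theta> * cis (- of_int (int (\<pi> j) - int (\<pi> i)) * \<theta>)))"
    if "i < d" "j < d" for i j
    by (intro integrable_mult_right integrable_mult_cis g K that)
  have T: "integrable circ_measure ?T"
    by (intro Bochner_Integration.integrable_sum integrable_norm g)
  have "tr (M * toeplitz_mat d \<kappa> \<pi> (fcoefs g)) = (\<Sum>i<d. \<Sum>j<d. M $$ (i, j) * fcoef (g (\<kappa> j) (\<kappa> i)) (int (\<pi> j) - int (\<pi> i)))"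
    unfolding tr_mult[OF M(1) toeplitz_mat_carrier] by (intro sum.cong refl) (simp add: toeplitz_mat_def)
  also have "\<dots> = (\<Sum>i<d. mean (\<lambda>\<theta>. \<Sum>j<d. M $$ (i, j) * (g (\<kappa> j) (\<kappa> i) \<theta> * cis (- of_int (int (\<pi> j) - int (\<pi> i)) * \<theta>))))"
    unfolding fcoef_def mean_cmult[symmetric]
    by (rule sum.cong[OF refl], rule mean_sum[symmetric], rule int) auto
  also have "\<dots> = mean G"
    unfolding G_def by (rule mean_sum[symmetric], rule Bochner_Integration.integrable_sum, rule int) auto
  finally have e: "tr (M * toeplitz_mat d \<kappa> \<pi> (fcoefs g)) = mean G" .
  have "cmod (mean G) \<le> 1 / (2 * pi) * (LINT \<theta>:{-pi..pi}|lebesgue. b * real d * ?T \<theta>)"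
  proof (rule mean_bound)
    show "set_integrable lebesgue {-pi..pi} G"
      unfolding set_integrable_circ G_def by (intro Bochner_Integration.integrable_sum int) auto
    show "set_integrable lebesgue {-pi..pi} (\<lambda>\<theta>. b * real d * ?T \<theta>)"
      unfolding set_integrable_circ by (intro integrable_mult_right T)
    fix \<theta>
    let ?u = "\<lambda>L' i. if \<kappa> i = L' then cis (real (\<pi> i) * \<theta>) else 0"
    let ?v = "\<lambda>L j. if \<kappa> j = L then cis (- real (\<pi> j) * \<theta>) else 0"
    have "G \<theta> = (\<Sum>i<d. \<Sum>j<d. \<Sum>L\<in>K. \<Sum>L'\<in>K. g L L' \<theta> * (?u L' i * M $$ (i, j) * ?v L j))"
      unfolding G_def
    proof (intro sum.cong refl)
      fix i j assume "i \<in> {..<d}" "j \<in> {..<d}"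
      hence ij: "\<kappa> i \<in> K" "\<kappa> j \<in> K" using K by auto
      have "(\<Sum>L\<in>K. \<Sum>L'\<in>K. g L L' \<theta> * (?u L' i * M $$ (i, j) * ?v L j))
          = (\<Sum>L\<in>K. if \<kappa> j = L then (\<Sum>L'\<in>K. if \<kappa> i = L' then g L L' \<theta> * (cis (real (\<pi> i) * \<theta>) * M $$ (i, j) * cis (- real (\<pi> j) * \<theta>)) else 0) else 0)"
        by (auto intro!: sum.cong)
      also have "\<dots> = g (\<kappa> j) (\<kappa> i) \<theta> * (cis (real (\<pi> i) * \<theta>) * M $$ (i, j) * cis (- real (\<pi> j) * \<theta>))"
        using ij K(1) by simp
      also have "\<dots> = M $$ (i, j) * (g (\<kappa> j) (\<kappa> i) \<theta> * (cis (real (\<pi> i) * \<theta>) * cis (- real (\<pi> j) * \<theta>)))"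
        by (simp only: mult_ac)
      also have "cis (real (\<pi> i) * \<theta>) * cis (- real (\<pi> j) * \<theta>) = cis (- of_int (int (\<pi> j) - int (\<pi> i)) * \<theta>)"
        unfolding cis_mult by (rule arg_cong[of _ _ cis]) (simp add: algebra_simps)
      finally show "M $$ (i, j) * (g (\<kappa> j) (\<kappa> i) \<theta> * cis (- of_int (int (\<pi> j) - int (\<pi> i)) * \<theta>))
          = (\<Sum>L\<in>K. \<Sum>L'\<in>K. g L L' \<theta> * (?u L' i * M $$ (i, j) * ?v L j))" ..
    qed
    also have "\<dots> = (\<Sum>L\<in>K. \<Sum>L'\<in>K. \<Sum>i<d. \<Sum>j<d. g L L' \<theta> * (?u L' i * M $$ (i, j) * ?v L j))"
    proof -
      have "(\<Sum>i<d. \<Sum>j<d. \<Sum>L\<in>K. \<Sum>L'\<in>K. F i j L L') = (\<Sum>L\<in>K. \<Sum>L'\<in>K. \<Sum>i<d. \<Sum>j<d. F i j L L')" for F :: "_ \<Rightarrow> _ \<Rightarrow> _ \<Rightarrow> _ \<Rightarrow> complex"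
      proof -
        have "(\<Sum>i<d. \<Sum>j<d. \<Sum>L\<in>K. \<Sum>L'\<in>K. F i j L L') = (\<Sum>i<d. \<Sum>L\<in>K. \<Sum>L'\<in>K. \<Sum>j<d. F i j L L')"
          by (rule sum.cong[OF refl], rule trans[OF sum.swap], rule sum.cong[OF refl], rule sum.swap)
        also have "\<dots> = (\<Sum>L\<in>K. \<Sum>L'\<in>K. \<Sum>i<d. \<Sum>j<d. F i j L L')"
          by (rule trans[OF sum.swap], rule sum.cong[OF refl], rule sum.swap)
        finally show ?thesis .
      qed
      thus ?thesis .
    qed
    also have "\<dots> = (\<Sum>L\<in>K. \<Sum>L'\<in>K. g L L' \<theta> * (\<Sum>i<d. \<Sum>j<d. ?u L' i * M $$ (i, j) * ?v L j))"
      by (simp only: sum_distrib_left)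
    finally have "cmod (G \<theta>) \<le> (\<Sum>L\<in>K. \<Sum>L'\<in>K. cmod (g L L' \<theta>) * cmod (\<Sum>i<d. \<Sum>j<d. ?u L' i * M $$ (i, j) * ?v L j))"
      by (simp only:) (intro order_trans[OF norm_sum] sum_mono, simp add: norm_mult)
    also have "\<dots> \<le> (\<Sum>L\<in>K. \<Sum>L'\<in>K. cmod (g L L' \<theta>) * (b * real d))"
    proof (intro sum_mono mult_left_mono)
      fix L L'
      have *: "enorm d w \<le> sqrt (real d)" if "\<And>i. cmod (w i) \<le> 1" for w
      proof -
        have "(\<Sum>i<d. (cmod (w i))\<^sup>2) \<le> (\<Sum>i<d. 1)" using that by (intro sum_mono) (simp add: power_le_one)
        thus ?thesis by (simp add: L2_set_def)
      qed
      have "cmod (\<Sum>i<d. \<Sum>j<d. ?u L' i * M $$ (i, j) * ?v L j) \<le> b * enorm d (?u L') * enorm d (?v L)"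
        by (rule op_bound_bilinear[OF M(2)])
      also have "\<dots> \<le> b * sqrt (real d) * sqrt (real d)"
        using b by (intro mult_mono * mult_nonneg_nonneg L2_set_nonneg order_refl) auto
      finally show "cmod (\<Sum>i<d. \<Sum>j<d. ?u L' i * M $$ (i, j) * ?v L j) \<le> b * real d" by (simp only: mult.assoc real_sqrt_mult_self abs_of_nat)
    qed auto
    also have "\<dots> = b * real d * ?T \<theta>" by (simp add: sum_distrib_left mult_ac)
    finally show "cmod (G \<theta>) \<le> b * real d * ?T \<theta>" .
  qed
  thus ?thesis unfolding e set_integral_circ by simp
qed

section \<open>The limit of resolvent traces\<close>

lemma det_measurable:
  fixes A :: "'a \<Rightarrow> complex mat"
  assumes "\<And>x. A x \<in> carrier_mat n n"
    and "\<And>i j. i < n \<Longrightarrow> j < n \<Longrightarrow> (\<lambda>x. A x $$ (i, j)) \<in> borel_measurable M"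
  shows "(\<lambda>x. Determinant.det (A x)) \<in> borel_measurable M"
proof -
  have "(\<lambda>x. Determinant.det (A x)) = (\<lambda>x. \<Sum>p | p permutes {0..<n}. signof p * (\<Prod>i = 0..<n. A x $$ (i, p i)))"
    by (rule ext, rule det_def'[OF assms(1)])
  also have "\<dots> \<in> borel_measurable M"
    by (intro borel_measurable_sum borel_measurable_times borel_measurable_prod borel_measurable_const assms(2))
       (auto dest: permutes_in_image)
  finally show ?thesis .
qed

lemma tr_resolvent_eq_det:
  assumes "X \<in> carrier_mat d d"
  shows "rtr X z = (\<Sum>i<d. (-1)^(i+i) * Determinant.det (mat_delete (z \<cdot>\<^sub>m 1\<^sub>m d - X) i i)) / Determinant.det (z \<cdot>\<^sub>m 1\<^sub>m d - X)"
  using assms unfolding tr_def resolvent_def cofactor_def adj_mat_def by (simp add: Let_def sum_divide_distrib)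

lemma tr_resolvent_measurable:
  fixes A :: "'a \<Rightarrow> complex mat"
  assumes A: "\<And>x. A x \<in> carrier_mat n n"
    and m: "\<And>i j. i < n \<Longrightarrow> j < n \<Longrightarrow> (\<lambda>x. A x $$ (i, j)) \<in> borel_measurable M"
  shows "(\<lambda>x. rtr (A x) z) \<in> borel_measurable M"
proof -
  let ?K = "\<lambda>x. z \<cdot>\<^sub>m 1\<^sub>m n - A x"
  have K: "?K x \<in> carrier_mat n n" for x using A by simp
  have mK: "(\<lambda>x. ?K x $$ (i, j)) \<in> borel_measurable M" if "i < n" "j < n" for i j
  proof -
    have "(\<lambda>x. ?K x $$ (i, j)) = (\<lambda>x. z * 1\<^sub>m n $$ (i, j) - A x $$ (i, j))"
      using that carrier_matD[OF A] by (intro ext) simp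
    thus ?thesis using m[OF that] by simp
  qed
  have "(\<lambda>x. Determinant.det (mat_delete (?K x) i i)) \<in> borel_measurable M" if i: "i < n" for i
  proof (rule det_measurable[of _ "n - 1"])
    show "mat_delete (?K x) i i \<in> carrier_mat (n - 1) (n - 1)" for x using K[of x] by (rule mat_delete_carrier)
    fix k l assume kl: "k < n - 1" "l < n - 1"
    have n: "Suc (n - 1) = n" using i by simp
    have "mat_delete (?K x) i i $$ (k, l) = ?K x $$ (insert_index i k, insert_index i l)" for x
      using mat_delete_index[of "?K x" "n - 1" i i k l, unfolded n, OF K i i kl] by simp
    hence "(\<lambda>x. mat_delete (?K x) i i $$ (k, l)) = (\<lambda>x. ?K x $$ (insert_index i k, insert_index i l))"
      by (intro ext)
    also have "\<dots> \<in> borel_measurable M" using i kl by (intro mK) (auto simp: insert_index_def)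
    finally show "(\<lambda>x. mat_delete (?K x) i i $$ (k, l)) \<in> borel_measurable M" .
  qed
  thus ?thesis unfolding tr_resolvent_eq_det[OF A]
    by (intro borel_measurable_divide borel_measurable_sum borel_measurable_times borel_measurable_const det_measurable[OF K mK]) auto
qed

text \<open>The index set of the symbols: finitely many kinds, the kind \<open>L\<close> with \<open>ms L\<close> slots.\<close>

locale kind_symbol =
  fixes K :: "'k set" and ms :: "'k \<Rightarrow> nat" and D :: nat and \<kappa>' :: "nat \<Rightarrow> 'k" and \<pi>' :: "nat \<Rightarrow> nat"
  assumes finite_K: "finite K" and K_ne: "K \<noteq> {}" and idx': "indexes D \<kappa>' \<pi>' K ms" and ms_pos: "\<And>L. L \<in> K \<Longrightarrow> ms L > 0"
begin

definition symb :: "('k \<Rightarrow> 'k \<Rightarrow> real \<Rightarrow> complex) \<Rightarrow> real \<Rightarrow> complex mat" where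
  "symb h \<theta> = symbol_mat D \<kappa>' \<pi>' (\<lambda>L L'. h L L' \<theta>)"

lemma symb_carrier [simp]: "symb h \<theta> \<in> carrier_mat D D" by (simp add: symb_def)

lemma symb_hermitian:
  assumes "\<And>L L'. L \<in> K \<Longrightarrow> L' \<in> K \<Longrightarrow> h L L' \<theta> = cnj (h L' L \<theta>)"
  shows "hermitian_mat (symb h \<theta>)"
  unfolding symb_def by (rule symbol_mat_hermitian, rule assms) (auto intro: indexes_kind[OF idx'])

lemma symb_diff_le:
  "(\<Sum>i<D. \<Sum>j<D. cmod (symb h \<theta> $$ (i, j) - symb h' \<theta>' $$ (i, j)))
    \<le> (real D)\<^sup>2 * (\<Sum>L\<in>K. \<Sum>L'\<in>K. cmod (h L L' \<theta> - h' L L' \<theta>'))"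
proof -
  let ?T = "\<Sum>L\<in>K. \<Sum>L'\<in>K. cmod (h L L' \<theta> - h' L L' \<theta>')"
  have "cmod (symb h \<theta> $$ (i, j) - symb h' \<theta>' $$ (i, j)) \<le> ?T" if ij: "i < D" "j < D" for i j
  proof -
    have K: "\<kappa>' i \<in> K" "\<kappa>' j \<in> K" using ij indexes_kind[OF idx'] by auto
    have "cmod (symb h \<theta> $$ (i, j) - symb h' \<theta>' $$ (i, j)) \<le> cmod (h (\<kappa>' i) (\<kappa>' j) \<theta> - h' (\<kappa>' i) (\<kappa>' j) \<theta>')"
      using ij by (simp add: symb_def symbol_mat_def)
    also have "\<dots> \<le> (\<Sum>L'\<in>K. cmod (h (\<kappa>' i) L' \<theta> - h' (\<kappa>' i) L' \<theta>'))"
      using K finite_K by (intro member_le_sum) auto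
    also have "\<dots> \<le> ?T"
      using K finite_K by (intro member_le_sum[of _ _ "\<lambda>L. \<Sum>L'\<in>K. cmod (h L L' \<theta> - h' L L' \<theta>')"]) (auto intro: sum_nonneg)
    finally show ?thesis .
  qed
  hence "(\<Sum>i<D. \<Sum>j<D. cmod (symb h \<theta> $$ (i, j) - symb h' \<theta>' $$ (i, j))) \<le> (\<Sum>i<D. \<Sum>j<D. ?T)"
    by (intro sum_mono) auto
  thus ?thesis by (simp add: power2_eq_square mult.assoc)
qed

abbreviation "herm h \<equiv> (\<forall>L\<in>K. \<forall>L'\<in>K. \<forall>\<theta>. h L L' \<theta> = cnj (h L' L \<theta>))"

lemma symb_herm: "herm h \<Longrightarrow> hermitian_mat (symb h \<theta>)"
  by (rule symb_hermitian) blast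

lemma tr_symb_diff:
  assumes "herm h" "herm h'" "Im z \<noteq> 0"
  shows "cmod (rtr (symb h \<theta>) z - rtr (symb h' \<theta>') z)
    \<le> (real D)\<^sup>2 / (Im z)\<^sup>2 * (\<Sum>L\<in>K. \<Sum>L'\<in>K. cmod (h L L' \<theta> - h' L L' \<theta>'))"
proof -
  have "cmod (rtr (symb h \<theta>) z - rtr (symb h' \<theta>') z)
    \<le> (\<Sum>i<D. \<Sum>j<D. cmod (symb h \<theta> $$ (i, j) - symb h' \<theta>' $$ (i, j))) / (Im z)\<^sup>2"
    by (intro tr_resolvent_entry_perturbation symb_carrier symb_herm assms)
  also have "\<dots> \<le> ((real D)\<^sup>2 * (\<Sum>L\<in>K. \<Sum>L'\<in>K. cmod (h L L' \<theta> - h' L L' \<theta>'))) / (Im z)\<^sup>2"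
    by (intro divide_right_mono symb_diff_le) auto
  finally show ?thesis by simp
qed

lemma tr_symb_measurable:
  assumes "\<And>L L'. L \<in> K \<Longrightarrow> L' \<in> K \<Longrightarrow> h L L' \<in> borel_measurable M"
  shows "(\<lambda>\<theta>. rtr (symb h \<theta>) z) \<in> borel_measurable M"
proof (rule tr_resolvent_measurable[of _ D])
  fix i j assume ij: "i < D" "j < D"
  have "\<kappa>' i \<in> K" "\<kappa>' j \<in> K" using ij indexes_kind[OF idx'] by auto
  thus "(\<lambda>\<theta>. symb h \<theta> $$ (i, j)) \<in> borel_measurable M"
    using assms ij by (simp add: symb_def symbol_mat_def)
qed simp

lemma tr_symb_integrable:
  assumes "herm h" "\<And>L L'. L \<in> K \<Longrightarrow> L' \<in> K \<Longrightarrow> integrable circ_measure (h L L')" "Im z \<noteq> 0"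
  shows "integrable circ_measure (\<lambda>\<theta>. rtr (symb h \<theta>) z)"
proof (rule circ_bounded_integrable[of _ "real D / \<bar>Im z\<bar>"])
  show "(\<lambda>\<theta>. rtr (symb h \<theta>) z) \<in> borel_measurable circ_measure"
    by (intro tr_symb_measurable borel_measurable_integrable assms)
  show "norm (rtr (symb h \<theta>) z) \<le> real D / \<bar>Im z\<bar>" for \<theta>
    by (intro tr_resolvent_bound symb_herm assms) auto
qed

lemma tr_symb_continuous:
  assumes "herm h" "\<And>L L'. L \<in> K \<Longrightarrow> L' \<in> K \<Longrightarrow> continuous_on UNIV (h L L')" "Im z \<noteq> 0"
  shows "continuous_on UNIV (\<lambda>\<theta>. rtr (symb h \<theta>) z)"
  unfolding continuous_on_eq_continuous_at[OF open_UNIV] continuous_at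
proof
  fix x
  have "((\<lambda>\<theta>. (real D)\<^sup>2 / (Im z)\<^sup>2 * (\<Sum>L\<in>K. \<Sum>L'\<in>K. cmod (h L L' \<theta> - h L L' x))) \<longlongrightarrow>
      (real D)\<^sup>2 / (Im z)\<^sup>2 * (\<Sum>L\<in>K. \<Sum>L'\<in>K. cmod (h L L' x - h L L' x))) (at x)"
    using assms(2) unfolding continuous_on_eq_continuous_at[OF open_UNIV] continuous_at
    by (intro tendsto_intros) auto
  hence "((\<lambda>\<theta>. (real D)\<^sup>2 / (Im z)\<^sup>2 * (\<Sum>L\<in>K. \<Sum>L'\<in>K. cmod (h L L' \<theta> - h L L' x))) \<longlongrightarrow> 0) (at x)"
    by simp
  hence "((\<lambda>\<theta>. rtr (symb h \<theta>) z - rtr (symb h x) z) \<longlongrightarrow> 0) (at x)"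
    by (rule Lim_null_comparison[OF always_eventually[OF allI[OF tr_symb_diff[OF assms(1,1,3)]]]])
  thus "((\<lambda>\<theta>. rtr (symb h \<theta>) z) \<longlongrightarrow> rtr (symb h x) z) (at x)"
    by (simp add: LIM_zero_iff)
qed

end

lemma cmod_diff_triangle: "cmod (a - b) \<le> cmod (a - a') + cmod (b - b') + cmod (a' - b')"
  using norm_triangle_ineq4[of "(a - a') + (a' - b')" "b - b'"] norm_triangle_ineq[of "a - a'" "a' - b'"] by simp

text \<open>Used for the slot length and for the block sizes, which grow like a positive multiple of
  \<open>n\<close>.\<close>

lemma at_top_of_positive_ratio:
  assumes "(\<lambda>n. real (k n) / real n) \<longlonglongrightarrow> c" "c > 0"
  shows "filterlim k at_top sequentially"
proof -
  have "filterlim (\<lambda>n. real (k n) / real n * real n) at_top sequentially"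
    by (intro filterlim_tendsto_pos_mult_at_top[OF assms] filterlim_real_sequentially)
  moreover have "\<forall>\<^sub>F n in sequentially. real (k n) / real n * real n = real (k n)"
    using eventually_gt_at_top[of 0] by eventually_elim simp
  ultimately have "filterlim (\<lambda>n. real (k n)) at_top sequentially"
    by (simp cong: filterlim_cong)
  thus ?thesis by (simp add: filterlim_sequentially_iff_filterlim_real)
qed

text \<open>Matrix sizes in which the kind \<open>L\<close> takes asymptotically the fraction \<open>ms L / m\<close> of \<open>n\<close>
  positions.\<close>

locale kind_sequence = kind_symbol K ms D \<kappa>' \<pi>'
  for K :: "'k set" and ms D \<kappa>' \<pi>' +
  fixes m :: nat and ns :: "nat \<Rightarrow> 'k \<Rightarrow> nat" and d :: "nat \<Rightarrow> nat"
    and \<kappa> :: "nat \<Rightarrow> nat \<Rightarrow> 'k" and \<pi> :: "nat \<Rightarrow> nat \<Rightarrow> nat"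
  assumes m_pos: "m > 0"
    and idx: "\<forall>\<^sub>F n in sequentially. indexes (d n) (\<kappa> n) (\<pi> n) K (ns n)"
    and ratio: "\<And>L. L \<in> K \<Longrightarrow> (\<lambda>n. real (ns n L) / real n) \<longlonglongrightarrow> real (ms L) / real m"
begin

text \<open>The largest slot length that fits all kinds.\<close>

definition k where "k n = Min ((\<lambda>L. ns n L div ms L) ` K)"

lemma k_fit: "L \<in> K \<Longrightarrow> k n * ms L \<le> ns n L"
proof -
  assume L: "L \<in> K"
  hence "k n \<le> ns n L div ms L" unfolding k_def using finite_K by (intro Min_le) auto
  hence "k n * ms L \<le> (ns n L div ms L) * ms L" by (rule mult_right_mono) simp
  also have "\<dots> \<le> ns n L" by simp
  finally show ?thesis .
qed

lemma k_limit: "(\<lambda>n. real (k n) / real n) \<longlonglongrightarrow> 1 / real m"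
proof (rule tendstoI)
  fix e :: real assume e: "e > 0"
  have "(\<lambda>n. real (ns n L div ms L) / real n) \<longlonglongrightarrow> 1 / real m" if L: "L \<in> K" for L
  proof (rule tendsto_sandwich)
    let ?l = "\<lambda>n. real (ns n L) / real n / real (ms L) - 1 / real n" and ?u = "\<lambda>n. real (ns n L) / real n / real (ms L)"
    have b: "real (ns n L) / real (ms L) - 1 \<le> real (ns n L div ms L)" "real (ns n L div ms L) \<le> real (ns n L) / real (ms L)" for n
      using floor_divide_of_nat_eq[of "ns n L" "ms L", where ?'a = real] by linarith+
    have e1: "?l n = (real (ns n L) / real (ms L) - 1) / real n" "?u n = (real (ns n L) / real (ms L)) / real n" for n
      by (simp_all add: diff_divide_distrib)
    have "?l n \<le> real (ns n L div ms L) / real n" for n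
      by (subst e1(1)) (rule divide_right_mono[OF b(1)], simp)
    thus "\<forall>\<^sub>F n in sequentially. ?l n \<le> real (ns n L div ms L) / real n"
      by (rule eventuallyI)
    have "real (ns n L div ms L) / real n \<le> ?u n" for n
      by (subst e1(2)) (rule divide_right_mono[OF b(2)], simp)
    thus "\<forall>\<^sub>F n in sequentially. real (ns n L div ms L) / real n \<le> ?u n"
      by (rule eventuallyI)
    have "?l \<longlonglongrightarrow> real (ms L) / real m / real (ms L) - 0"
      using ms_pos[OF L] by (intro tendsto_intros ratio L lim_1_over_n) auto
    thus "?l \<longlonglongrightarrow> 1 / real m" using ms_pos[OF L] by simp
    have "?u \<longlonglongrightarrow> real (ms L) / real m / real (ms L)"
      using ms_pos[OF L] by (intro tendsto_intros ratio L) auto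
    thus "?u \<longlonglongrightarrow> 1 / real m" using ms_pos[OF L] by simp
  qed
  hence "\<forall>\<^sub>F n in sequentially. \<forall>L\<in>K. dist (real (ns n L div ms L) / real n) (1 / real m) < e"
    using e by (intro eventually_ball_finite finite_K ballI tendstoD)
  thus "\<forall>\<^sub>F n in sequentially. dist (real (k n) / real n) (1 / real m) < e"
  proof eventually_elim
    case (elim n)
    have "k n \<in> (\<lambda>L. ns n L div ms L) ` K" unfolding k_def using finite_K K_ne by (intro Min_in) auto
    thus ?case using elim by auto
  qed
qed

lemma k_at_top: "filterlim k at_top sequentially"
  using m_pos by (intro at_top_of_positive_ratio[OF k_limit]) simp

lemma d_limit: "(\<lambda>n. real (d n) / real n) \<longlonglongrightarrow> real D / real m"
proof -
  have "(\<lambda>n. \<Sum>L\<in>K. real (ns n L) / real n) \<longlonglongrightarrow> (\<Sum>L\<in>K. real (ms L) / real m)"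
    by (intro tendsto_sum ratio)
  moreover have "\<forall>\<^sub>F n in sequentially. (\<Sum>L\<in>K. real (ns n L) / real n) = real (d n) / real n"
    using idx
  proof eventually_elim
    case (elim n)
    show ?case unfolding indexes_size[OF elim finite_K] by (simp add: sum_divide_distrib)
  qed
  ultimately show ?thesis
    unfolding indexes_size[OF idx' finite_K] of_nat_sum sum_divide_distrib
    by (rule Lim_transform_eventually)
qed

lemma leftover_limit: "(\<lambda>n. real (d n - k n * D) / real n) \<longlonglongrightarrow> 0"
proof -
  have "(\<lambda>n. real (d n) / real n - real (k n) / real n * real D) \<longlonglongrightarrow> real D / real m - 1 / real m * real D"
    by (intro tendsto_intros d_limit k_limit)
  moreover have "\<forall>\<^sub>F n in sequentially. real (d n) / real n - real (k n) / real n * real D = real (d n - k n * D) / real n"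
    using idx
  proof eventually_elim
    case (elim n)
    have "k n * D = (\<Sum>L\<in>K. k n * ms L)" using indexes_size[OF idx' finite_K] by (simp add: sum_distrib_left)
    also have "\<dots> \<le> (\<Sum>L\<in>K. ns n L)" by (intro sum_mono k_fit)
    also have "\<dots> = d n" using indexes_size[OF elim finite_K] ..
    finally show ?case by (simp add: of_nat_diff diff_divide_distrib)
  qed
  ultimately show ?thesis by (simp cong: filterlim_cong)
qed

definition T :: "('k \<Rightarrow> 'k \<Rightarrow> real \<Rightarrow> complex) \<Rightarrow> nat \<Rightarrow> complex mat" where
  "T h n = toeplitz_mat (d n) (\<kappa> n) (\<pi> n) (fcoefs h)"

lemma T_carrier [simp]: "T h n \<in> carrier_mat (d n) (d n)" by (simp add: T_def)

lemma T_hermitian: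
  assumes h: "herm h" "\<And>L L'. L \<in> K \<Longrightarrow> L' \<in> K \<Longrightarrow> integrable circ_measure (h L L')"
    and idx: "indexes (d n) (\<kappa> n) (\<pi> n) K (ns n)"
  shows "hermitian_mat (T h n)"
  unfolding T_def
proof (rule toeplitz_mat_hermitian)
  fix i j assume "i < d n" "j < d n"
  hence K: "\<kappa> n i \<in> K" "\<kappa> n j \<in> K" using indexes_kind[OF idx] by auto
  have "h (\<kappa> n i) (\<kappa> n j) = (\<lambda>\<theta>. cnj (h (\<kappa> n j) (\<kappa> n i) \<theta>))" using h(1) K by blast
  thus "fcoef (h (\<kappa> n i) (\<kappa> n j)) (int (\<pi> n i) - int (\<pi> n j)) = cnj (fcoef (h (\<kappa> n j) (\<kappa> n i)) (int (\<pi> n j) - int (\<pi> n i)))"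
    using fcoef_cnj[OF h(2)[OF K(2,1)], of "int (\<pi> n i) - int (\<pi> n j)"] by simp
qed

text \<open>The resolvent trace of the circulant comparison matrix is \<open>k n\<close> times a Riemann sum plus
  the contribution \<open>1 / z\<close> of each of the \<open>o(n)\<close> indices outside the slots.\<close>

lemma trig_limit:
  assumes h: "herm h" and trig: "\<And>L L'. L \<in> K \<Longrightarrow> L' \<in> K \<Longrightarrow> trig_poly (h L L')" and z: "Im z \<noteq> 0"
  shows "(\<lambda>n. rtr (T h n) z / of_nat n) \<longlonglongrightarrow> mean (\<lambda>\<theta>. rtr (symb h \<theta>) z) / of_nat m"
proof -
  define c where "c = (\<lambda>L L'. fcoef (h L L'))"
  have int: "integrable circ_measure (h L L')" if "L \<in> K" "L' \<in> K" for L L'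
    using trig_poly_integrable trig that by blast
  have "\<exists>W. \<forall>L\<in>K. \<forall>L'\<in>K. \<forall>w'\<ge>W L L'. (\<forall>l. \<bar>l\<bar> > int w' \<longrightarrow> c L L' l = 0) \<and>
           (\<forall>\<theta>. h L L' \<theta> = (\<Sum>l\<in>{-int w'..int w'}. c L L' l * cis (of_int l * \<theta>)))"
    using trig_poly_fcoef[OF trig] unfolding c_def by metis
  then obtain W where W: "\<And>L L' w'. L \<in> K \<Longrightarrow> L' \<in> K \<Longrightarrow> w' \<ge> W L L' \<Longrightarrow> (\<forall>l. \<bar>l\<bar> > int w' \<longrightarrow> c L L' l = 0) \<and>
           (\<forall>\<theta>. h L L' \<theta> = (\<Sum>l\<in>{-int w'..int w'}. c L L' l * cis (of_int l * \<theta>)))" by metis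
  \<comment> \<open>Sums serve as common bounds for the finitely many degrees and, below, coefficients.\<close>
  define w where "w = (\<Sum>L\<in>K. \<Sum>L'\<in>K. W L L')"
  have "W L L' \<le> w" if "L \<in> K" "L' \<in> K" for L L'
  proof -
    have "W L L' \<le> (\<Sum>L'\<in>K. W L L')" using that finite_K by (intro member_le_sum) auto
    also have "\<dots> \<le> w" unfolding w_def using that finite_K by (intro member_le_sum) auto
    finally show ?thesis .
  qed
  hence band: "\<And>L L' l. L \<in> K \<Longrightarrow> L' \<in> K \<Longrightarrow> \<bar>l\<bar> > int w \<Longrightarrow> c L L' l = 0"
    and rep: "\<And>L L' \<theta>. L \<in> K \<Longrightarrow> L' \<in> K \<Longrightarrow> h L L' \<theta> = (\<Sum>l\<in>{-int w..int w}. c L L' l * cis (of_int l * \<theta>))"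
    using W by blast+
  define B where "B = (\<Sum>L\<in>K. \<Sum>L'\<in>K. \<Sum>l\<in>{-int w..int w}. cmod (c L L' l))"
  have B0: "B \<ge> 0" unfolding B_def by (intro sum_nonneg) auto
  have bound: "cmod (c L L' l) \<le> B" if "L \<in> K" "L' \<in> K" for L L' l
  proof (cases "\<bar>l\<bar> > int w")
    case True
    thus ?thesis using band[OF that] B0 by simp
  next
    case False
    hence "cmod (c L L' l) \<le> (\<Sum>l\<in>{-int w..int w}. cmod (c L L' l))" by (intro member_le_sum) auto
    also have "\<dots> \<le> (\<Sum>L'\<in>K. \<Sum>l\<in>{-int w..int w}. cmod (c L L' l))"
      using that finite_K by (intro member_le_sum[of L' K "\<lambda>L'. \<Sum>l\<in>{-int w..int w}. cmod (c L L' l)"]) (auto intro: sum_nonneg)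
    also have "\<dots> \<le> B" unfolding B_def
      using that finite_K by (intro member_le_sum[of L K "\<lambda>L. \<Sum>L'\<in>K. \<Sum>l\<in>{-int w..int w}. cmod (c L L' l)"]) (auto intro!: sum_nonneg)
    finally show ?thesis .
  qed
  define g where "g = (\<lambda>\<theta>. rtr (symb h \<theta>) z)"
  have gcont: "continuous_on UNIV g"
    unfolding g_def using trig by (intro tr_symb_continuous h z trig_poly_continuous) auto
  have gper: "g x = g y" if "cis x = cis y" for x y
  proof -
    have "symb h x = symb h y"
      unfolding symb_def symbol_mat_def
      by (intro cong_mat refl) (auto intro!: trig_poly_cis_cong[OF trig] that indexes_kind[OF idx'])
    thus ?thesis by (simp add: g_def)
  qed
  have riem: "(\<lambda>n. (\<Sum>r<k n. g (2 * pi * real r / real (k n))) / of_nat (k n)) \<longlonglongrightarrow> mean g"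
    by (rule filterlim_compose[OF riemann_sum_periodic[OF gcont gper] k_at_top])
  define M where "M = B * (real (card K) + real D) * (2 * real w + 1)"
  have main: "\<forall>\<^sub>F n in sequentially. cmod (rtr (T h n) z / of_nat n -
      (of_real (real (k n) / real n) * ((\<Sum>r<k n. g (2 * pi * real r / real (k n))) / of_nat (k n)) + of_real (real (d n - k n * D) / real n) * (1 / z)))
      \<le> M / (Im z)\<^sup>2 * (2 * (real (d n - k n * D) / real n) + 2 * real w * real D * (1 / real n))"
    using idx eventually_gt_at_top[of 0] eventually_compose_filterlim[OF eventually_gt_at_top[of 0] k_at_top]
  proof eventually_elim
    case (elim n)
    interpret slot_index K "ns n" ms "d n" D "k n" "\<kappa> n" \<kappa>' "\<pi> n" \<pi>'
      by unfold_locales (use finite_K elim idx' k_fit in auto)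
    let ?Y = "\<lambda>r. symbol_mat D \<kappa>' \<pi>' (\<lambda>L L'. \<Sum>l\<in>{-int w..int w}. c L L' l * cis (of_int l * (2 * pi * real r / real (k n))))"
    have Y: "?Y r = symb h (2 * pi * real r / real (k n))" for r
      unfolding symb_def symbol_mat_def
      by (intro cong_mat refl) (auto simp: rep indexes_kind[OF idx'])
    have Yh: "?Y r \<in> carrier_mat D D \<and> hermitian_mat (?Y r)" for r
      unfolding Y using symb_herm[OF h] by simp
    have C: "rtr (\<Gamma> ?Y 0) z = (\<Sum>r<k n. g (2 * pi * real r / real (k n))) + of_nat (d n - k n * D) * (1 / z)"
      using tr_resolvent_\<Gamma>[OF Yh z] unfolding Y g_def .
    have "cmod (rtr (T h n) z - rtr (\<Gamma> ?Y 0) z)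
       \<le> (\<Sum>i<d n. \<Sum>j<d n. cmod (T h n $$ (i, j) - \<Gamma> ?Y 0 $$ (i, j))) / (Im z)\<^sup>2"
      by (intro tr_resolvent_entry_perturbation T_hermitian \<Gamma>_hermitian h int elim(1) Yh z) auto
    also have "\<dots> \<le> (M * (2 * real (d n - k n * D) + 2 * real w * real D)) / (Im z)\<^sup>2"
      unfolding T_def M_def c_def[symmetric] by (intro divide_right_mono toeplitz_circulant_distance band bound B0) auto
    finally have le: "cmod (rtr (T h n) z - rtr (\<Gamma> ?Y 0) z) \<le> (M * (2 * real (d n - k n * D) + 2 * real w * real D)) / (Im z)\<^sup>2" .
    have eq: "rtr (T h n) z / of_nat n -
      (of_real (real (k n) / real n) * ((\<Sum>r<k n. g (2 * pi * real r / real (k n))) / of_nat (k n)) + of_real (real (d n - k n * D) / real n) * (1 / z))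
      = (rtr (T h n) z - rtr (\<Gamma> ?Y 0) z) / of_nat n"
      unfolding C using elim by (simp add: diff_divide_distrib add_divide_distrib)
    have "cmod ((rtr (T h n) z - rtr (\<Gamma> ?Y 0) z) / of_nat n) = cmod (rtr (T h n) z - rtr (\<Gamma> ?Y 0) z) / real n"
      by (simp add: norm_divide)
    also have "\<dots> \<le> (M * (2 * real (d n - k n * D) + 2 * real w * real D)) / (Im z)\<^sup>2 / real n"
      by (intro divide_right_mono le) auto
    also have "\<dots> = M / (Im z)\<^sup>2 * (2 * (real (d n - k n * D) / real n) + 2 * real w * real D * (1 / real n))"
      by (simp add: add_divide_distrib algebra_simps)
    finally show ?case unfolding eq .
  qed
  have "(\<lambda>n. M / (Im z)\<^sup>2 * (2 * (real (d n - k n * D) / real n) + 2 * real w * real D * (1 / real n))) \<longlonglongrightarrow>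
     M / (Im z)\<^sup>2 * (2 * 0 + 2 * real w * real D * 0)"
    by (intro tendsto_intros leftover_limit lim_1_over_n)
  hence diff: "(\<lambda>n. rtr (T h n) z / of_nat n -
      (of_real (real (k n) / real n) * ((\<Sum>r<k n. g (2 * pi * real r / real (k n))) / of_nat (k n)) + of_real (real (d n - k n * D) / real n) * (1 / z))) \<longlonglongrightarrow> 0"
    by (intro Lim_null_comparison[OF main]) simp
  have "(\<lambda>n. of_real (real (k n) / real n) * ((\<Sum>r<k n. g (2 * pi * real r / real (k n))) / of_nat (k n)) + of_real (real (d n - k n * D) / real n) * (1 / z))
     \<longlonglongrightarrow> of_real (1 / real m) * mean g + of_real 0 * (1 / z)"
    by (intro tendsto_intros tendsto_of_real k_limit leftover_limit riem)
  from tendsto_add[OF diff this] show ?thesis unfolding g_def by simp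
qed

text \<open>The approximating trigonometric polynomials have to be Hermitian, too. Symmetrising them
  keeps the distance, because \<open>h\<close> is Hermitian. The constant \<open>A\<close> collects the two stability
  constants, of the matrices and of the symbol.\<close>

theorem resolvent_limit:
  assumes h: "herm h" and int: "\<And>L L'. L \<in> K \<Longrightarrow> L' \<in> K \<Longrightarrow> integrable circ_measure (h L L')" and z: "Im z \<noteq> 0"
  shows "(\<lambda>n. rtr (T h n) z / of_nat n) \<longlonglongrightarrow> mean (\<lambda>\<theta>. rtr (symb h \<theta>) z) / of_nat m"
proof (rule tendstoI)
  fix e :: real assume e: "e > 0"
  define A where "A = (1 / (Im z)\<^sup>2) * (real D / real m + 1) + (real D)\<^sup>2 / (Im z)\<^sup>2 / real m"
  have "real D / real m + 1 > 0" by (intro add_nonneg_pos) auto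
  hence A: "A > 0" unfolding A_def using z by (intro add_pos_nonneg[OF mult_pos_pos]) auto
  \<comment> \<open>After summation over all pairs of kinds and multiplication by \<open>A\<close> this accuracy gives an
    error of at most \<open>e / 2\<close>.\<close>
  define \<epsilon> where "\<epsilon> = e / (2 * A) * (2 * pi) / (real (card K))\<^sup>2"
  have cK: "card K > 0" using finite_K K_ne by (simp add: card_gt_0_iff)
  have \<epsilon>: "\<epsilon> > 0" unfolding \<epsilon>_def using e A cK by simp
  have "\<exists>q. \<forall>L\<in>K. \<forall>L'\<in>K. trig_poly (q L L') \<and> (LINT \<theta>|circ_measure. cmod (h L L' \<theta> - q L L' \<theta>)) < \<epsilon>"
    using trig_poly_dense_L1[OF int \<epsilon>] by metis
  then obtain q where q: "\<And>L L'. L \<in> K \<Longrightarrow> L' \<in> K \<Longrightarrow> trig_poly (q L L')"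
    "\<And>L L'. L \<in> K \<Longrightarrow> L' \<in> K \<Longrightarrow> (LINT \<theta>|circ_measure. cmod (h L L' \<theta> - q L L' \<theta>)) < \<epsilon>" by metis
  define p where "p = (\<lambda>L L' \<theta>. 1 / 2 * (q L L' \<theta> + cnj (q L' L \<theta>)))"
  have p: "herm p" unfolding p_def by (simp add: add.commute)
  have pt: "trig_poly (p L L')" if "L \<in> K" "L' \<in> K" for L L'
    unfolding p_def using that by (intro trig_poly_cmult trig_poly.add trig_poly_cnj q)
  have pint: "integrable circ_measure (p L L')" if "L \<in> K" "L' \<in> K" for L L'
    by (rule trig_poly_integrable[OF pt[OF that]])
  have dint: "integrable circ_measure (\<lambda>\<theta>. cmod (h L L' \<theta> - q L L' \<theta>))" if "L \<in> K" "L' \<in> K" for L L'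
    using int[OF that] trig_poly_integrable[OF q(1)[OF that]] by (intro integrable_norm Bochner_Integration.integrable_diff)
  have hp: "(LINT \<theta>|circ_measure. cmod (h L L' \<theta> - p L L' \<theta>)) \<le> \<epsilon>" if L: "L \<in> K" "L' \<in> K" for L L'
  proof -
    have "(LINT \<theta>|circ_measure. cmod (h L L' \<theta> - p L L' \<theta>))
       \<le> (LINT \<theta>|circ_measure. 1 / 2 * cmod (h L L' \<theta> - q L L' \<theta>) + 1 / 2 * cmod (h L' L \<theta> - q L' L \<theta>))"
    proof (rule Bochner_Integration.integral_mono)
      fix \<theta>
      have hh: "h L L' \<theta> = cnj (h L' L \<theta>)" using h L by blast
      have eq: "h L L' \<theta> - p L L' \<theta> = 1 / 2 * (h L L' \<theta> - q L L' \<theta>) + 1 / 2 * cnj (h L' L \<theta> - q L' L \<theta>)"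
        unfolding p_def complex_cnj_diff hh[symmetric] by (simp add: algebra_simps)
      have "cmod (h L L' \<theta> - p L L' \<theta>) \<le> cmod (1 / 2 * (h L L' \<theta> - q L L' \<theta>)) + cmod (1 / 2 * cnj (h L' L \<theta> - q L' L \<theta>))"
        unfolding eq by (rule norm_triangle_ineq)
      also have "\<dots> = 1 / 2 * cmod (h L L' \<theta> - q L L' \<theta>) + 1 / 2 * cmod (h L' L \<theta> - q L' L \<theta>)"
        unfolding norm_mult complex_mod_cnj by simp
      finally show "cmod (h L L' \<theta> - p L L' \<theta>) \<le> 1 / 2 * cmod (h L L' \<theta> - q L L' \<theta>) + 1 / 2 * cmod (h L' L \<theta> - q L' L \<theta>)" .
    qed (intro integrable_norm Bochner_Integration.integrable_diff Bochner_Integration.integrable_add integrable_mult_right int pint dint L)+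
    also have "\<dots> = 1 / 2 * (LINT \<theta>|circ_measure. cmod (h L L' \<theta> - q L L' \<theta>)) + 1 / 2 * (LINT \<theta>|circ_measure. cmod (h L' L \<theta> - q L' L \<theta>))"
      using dint L by simp
    also have "\<dots> \<le> \<epsilon>" using q(2)[OF L] q(2)[OF L(2,1)] by simp
    finally show ?thesis .
  qed
  let ?g = "\<lambda>L L' \<theta>. h L L' \<theta> - p L L' \<theta>"
  have gint: "integrable circ_measure (?g L L')" if "L \<in> K" "L' \<in> K" for L L'
    using int pint that by simp
  define \<delta> where "\<delta> = 1 / (2 * pi) * (LINT \<theta>|circ_measure. (\<Sum>L\<in>K. \<Sum>L'\<in>K. cmod (?g L L' \<theta>)))"
  have "(LINT \<theta>|circ_measure. (\<Sum>L\<in>K. \<Sum>L'\<in>K. cmod (?g L L' \<theta>))) = (\<Sum>L\<in>K. \<Sum>L'\<in>K. LINT \<theta>|circ_measure. cmod (?g L L' \<theta>))"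
  proof -
    have "(LINT \<theta>|circ_measure. (\<Sum>L\<in>K. \<Sum>L'\<in>K. cmod (?g L L' \<theta>))) = (\<Sum>L\<in>K. LINT \<theta>|circ_measure. (\<Sum>L'\<in>K. cmod (?g L L' \<theta>)))"
      by (rule Bochner_Integration.integral_sum) (intro Bochner_Integration.integrable_sum integrable_norm gint)
    also have "\<dots> = (\<Sum>L\<in>K. \<Sum>L'\<in>K. LINT \<theta>|circ_measure. cmod (?g L L' \<theta>))"
      by (intro sum.cong refl Bochner_Integration.integral_sum integrable_norm gint)
    finally show ?thesis .
  qed
  also have "\<dots> \<le> (\<Sum>L\<in>K. \<Sum>L'\<in>K. \<epsilon>)" by (intro sum_mono hp)
  finally have "\<delta> \<le> 1 / (2 * pi) * ((real (card K))\<^sup>2 * \<epsilon>)"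
    unfolding \<delta>_def by (intro mult_left_mono) (auto simp: power2_eq_square mult.assoc)
  also have "\<dots> = e / (2 * A)" unfolding \<epsilon>_def using cK by simp
  finally have \<delta>: "\<delta> \<le> e / (2 * A)" .
  have \<delta>0: "\<delta> \<ge> 0" unfolding \<delta>_def by (intro mult_nonneg_nonneg Bochner_Integration.integral_nonneg sum_nonneg) auto
  have symbol_part: "cmod (mean (\<lambda>\<theta>. rtr (symb h \<theta>) z) - mean (\<lambda>\<theta>. rtr (symb p \<theta>) z)) \<le> (real D)\<^sup>2 / (Im z)\<^sup>2 * \<delta>"
  proof -
    have i: "set_integrable lebesgue {-pi..pi} (\<lambda>\<theta>. rtr (symb h \<theta>) z)"
      "set_integrable lebesgue {-pi..pi} (\<lambda>\<theta>. rtr (symb p \<theta>) z)"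
      unfolding set_integrable_circ by (intro tr_symb_integrable h p int pint z; assumption)+
    have "cmod (mean (\<lambda>\<theta>. rtr (symb h \<theta>) z - rtr (symb p \<theta>) z))
      \<le> 1 / (2 * pi) * (LINT \<theta>:{-pi..pi}|lebesgue. (real D)\<^sup>2 / (Im z)\<^sup>2 * (\<Sum>L\<in>K. \<Sum>L'\<in>K. cmod (?g L L' \<theta>)))"
    proof (rule mean_bound)
      show "set_integrable lebesgue {-pi..pi} (\<lambda>\<theta>. (real D)\<^sup>2 / (Im z)\<^sup>2 * (\<Sum>L\<in>K. \<Sum>L'\<in>K. cmod (?g L L' \<theta>)))"
        unfolding set_integrable_circ
        by (intro integrable_mult_right Bochner_Integration.integrable_sum integrable_norm gint)
      show "set_integrable lebesgue {-pi..pi} (\<lambda>\<theta>. rtr (symb h \<theta>) z - rtr (symb p \<theta>) z)"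
        by (rule set_integral_diff(1)[OF i])
      show "cmod (rtr (symb h \<theta>) z - rtr (symb p \<theta>) z) \<le> (real D)\<^sup>2 / (Im z)\<^sup>2 * (\<Sum>L\<in>K. \<Sum>L'\<in>K. cmod (?g L L' \<theta>))" for \<theta>
        by (rule tr_symb_diff[OF h p z])
    qed
    also have "\<dots> = (real D)\<^sup>2 / (Im z)\<^sup>2 * \<delta>" unfolding \<delta>_def set_integral_circ by simp
    finally show ?thesis unfolding mean_diff[OF i] .
  qed
  have "(\<lambda>n. rtr (T p n) z / of_nat n) \<longlonglongrightarrow> mean (\<lambda>\<theta>. rtr (symb p \<theta>) z) / of_nat m"
    by (rule trig_limit[OF p pt z])
  hence ev1: "\<forall>\<^sub>F n in sequentially. dist (rtr (T p n) z / of_nat n) (mean (\<lambda>\<theta>. rtr (symb p \<theta>) z) / of_nat m) < e / 2"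
    using e by (intro tendstoD) auto
  have ev2: "\<forall>\<^sub>F n in sequentially. real (d n) / real n < real D / real m + 1"
    by (rule order_tendstoD(2)[OF d_limit]) simp
  show "\<forall>\<^sub>F n in sequentially. dist (rtr (T h n) z / of_nat n) (mean (\<lambda>\<theta>. rtr (symb h \<theta>) z) / of_nat m) < e"
    using ev1 ev2 idx
  proof eventually_elim
    case (elim n)
    have Th: "hermitian_mat (T h n)" "hermitian_mat (T p n)"
      by (intro T_hermitian h p int pint elim(3); assumption)+
    let ?M = "resolvent (T p n) z * resolvent (T h n) z"
    have eq: "T h n - T p n = toeplitz_mat (d n) (\<kappa> n) (\<pi> n) (fcoefs ?g)"
    proof (rule eq_matI)
      fix i j assume "i < dim_row (toeplitz_mat (d n) (\<kappa> n) (\<pi> n) (fcoefs ?g))" "j < dim_col (toeplitz_mat (d n) (\<kappa> n) (\<pi> n) (fcoefs ?g))"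
      hence ij: "i < d n" "j < d n" by (simp_all add: toeplitz_mat_def)
      hence K: "\<kappa> n i \<in> K" "\<kappa> n j \<in> K" using indexes_kind[OF elim(3)] by auto
      show "(T h n - T p n) $$ (i, j) = toeplitz_mat (d n) (\<kappa> n) (\<pi> n) (fcoefs ?g) $$ (i, j)"
        using ij fcoef_diff[OF int[OF K] pint[OF K]] by (simp add: T_def toeplitz_mat_def)
    qed (auto simp: T_def toeplitz_mat_def)
    have "cmod (rtr (T h n) z - rtr (T p n) z) \<le> 1 / (Im z)\<^sup>2 * real (d n) * \<delta>"
      unfolding tr_resolvent_diff(1)[OF T_carrier Th(1) T_carrier Th(2) z] eq \<delta>_def
      by (intro toeplitz_trace_bound gint finite_K indexes_kind[OF elim(3)] tr_resolvent_diff(2)[OF T_carrier Th(1) T_carrier Th(2) z]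
          mult_carrier_mat[of _ _ "d n"]) auto
    hence "cmod (rtr (T h n) z - rtr (T p n) z) / real n \<le> 1 / (Im z)\<^sup>2 * real (d n) * \<delta> / real n"
      by (rule divide_right_mono) simp
    also have "\<dots> = 1 / (Im z)\<^sup>2 * (real (d n) / real n) * \<delta>" by simp
    also have "\<dots> \<le> 1 / (Im z)\<^sup>2 * (real D / real m + 1) * \<delta>"
      using elim(2) \<delta>0 by (intro mult_right_mono mult_left_mono) auto
    finally have t1: "cmod (rtr (T h n) z / of_nat n - rtr (T p n) z / of_nat n) \<le> 1 / (Im z)\<^sup>2 * (real D / real m + 1) * \<delta>"
      by (simp add: diff_divide_distrib[symmetric] norm_divide)
    have "cmod (mean (\<lambda>\<theta>. rtr (symb h \<theta>) z) - mean (\<lambda>\<theta>. rtr (symb p \<theta>) z)) / real m \<le> (real D)\<^sup>2 / (Im z)\<^sup>2 * \<delta> / real m"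
      by (intro divide_right_mono symbol_part) simp
    hence t2: "cmod (mean (\<lambda>\<theta>. rtr (symb h \<theta>) z) / of_nat m - mean (\<lambda>\<theta>. rtr (symb p \<theta>) z) / of_nat m) \<le> (real D)\<^sup>2 / (Im z)\<^sup>2 / real m * \<delta>"
      by (simp add: diff_divide_distrib[symmetric] norm_divide)
    have t12: "1 / (Im z)\<^sup>2 * (real D / real m + 1) * \<delta> + (real D)\<^sup>2 / (Im z)\<^sup>2 / real m * \<delta> = A * \<delta>"
      by (simp only: A_def distrib_right)
    have "A * \<delta> \<le> e / 2" using \<delta> A by (simp add: field_simps)
    moreover note cmod_diff_triangle[of "rtr (T h n) z / of_nat n" "mean (\<lambda>\<theta>. rtr (symb h \<theta>) z) / of_nat m"
        "rtr (T p n) z / of_nat n" "mean (\<lambda>\<theta>. rtr (symb p \<theta>) z) / of_nat m"]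
    ultimately show ?case using t1 t2 t12 elim(1) unfolding dist_norm by linarith
  qed
qed

end

section \<open>Test functions generated by resolvents\<close>

inductive res_class :: "(real \<Rightarrow> complex) \<Rightarrow> bool" where
  const: "res_class (\<lambda>x. c)"
| res: "Im z \<noteq> 0 \<Longrightarrow> res_class (\<lambda>x. 1 / (z - of_real x))"
| add: "res_class f \<Longrightarrow> res_class g \<Longrightarrow> res_class (\<lambda>x. f x + g x)"
| scale: "res_class f \<Longrightarrow> res_class (\<lambda>x. c * f x)"
| lim: "(\<forall>e>0. \<exists>g. res_class g \<and> (\<forall>x. cmod (f x - g x) < e)) \<Longrightarrow> res_class f"

lemma cmod_res_le:
  assumes "Im z \<noteq> 0" shows "cmod (1 / (z - of_real x)) \<le> 1 / \<bar>Im z\<bar>"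
proof -
  have "\<bar>Im z\<bar> \<le> cmod (z - of_real x)" using abs_Im_le_cmod[of "z - of_real x"] by simp
  thus ?thesis using assms by (simp add: norm_divide frac_le)
qed

lemma res_class_bounded: "res_class f \<Longrightarrow> \<exists>B>0. \<forall>x. cmod (f x) \<le> B"
proof (induction rule: res_class.induct)
  case (const c)
  show ?case by (intro exI[of _ "cmod c + 1"]) (auto intro: add_nonneg_pos)
next
  case (res z)
  thus ?case using cmod_res_le[of z] by (intro exI[of _ "1 / \<bar>Im z\<bar>"]) auto
next
  case (add f g)
  then obtain B C where B: "B > 0" "\<And>x. cmod (f x) \<le> B" and C: "C > 0" "\<And>x. cmod (g x) \<le> C" by blast
  have "cmod (f x + g x) \<le> B + C" for x
    using norm_triangle_ineq[of "f x" "g x"] B(2)[of x] C(2)[of x] by linarith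
  thus ?case using B C by (intro exI[of _ "B + C"]) auto
next
  case (scale f c)
  then obtain B where B: "B > 0" "\<And>x. cmod (f x) \<le> B" by blast
  have "cmod (c * f x) \<le> (cmod c + 1) * B" for x
    unfolding norm_mult using B by (intro mult_mono) auto
  thus ?case using B by (intro exI[of _ "(cmod c + 1) * B"]) (auto intro!: mult_pos_pos add_nonneg_pos)
next
  case (lim f)
  have "\<exists>g. (res_class g \<and> (\<exists>B>0. \<forall>x. cmod (g x) \<le> B)) \<and> (\<forall>x. cmod (f x - g x) < 1)"
    using lim by simp
  then obtain g where g: "\<And>x. cmod (f x - g x) < 1"
    and "\<exists>B>0. \<forall>x. cmod (g x) \<le> B" by blast
  then obtain B where B: "B > 0" "\<And>x. cmod (g x) \<le> B" by blast
  have "cmod (f x) \<le> B + 1" for x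
    using norm_triangle_ineq[of "f x - g x" "g x"] g[of x] B(2)[of x] by simp
  thus ?case using B by (intro exI[of _ "B + 1"]) auto
qed

lemma res_class_diff: "res_class f \<Longrightarrow> res_class g \<Longrightarrow> res_class (\<lambda>x. f x - g x)"
  using res_class.add[of f "\<lambda>x. (-1) * g x"] res_class.scale[of g "-1"] by simp

text \<open>Products of two resolvents with different poles are linear combinations of them by partial
  fractions; equal poles are a uniform limit of different ones. The second pole is moved
  parallel to the real axis, which keeps its distance from it.\<close>

lemma res_class_mult_res:
  assumes z: "Im z \<noteq> 0" and g: "res_class g"
  shows "res_class (\<lambda>x. 1 / (z - of_real x) * g x)"
  using g
proof (induction rule: res_class.induct)
  case (const c)
  show ?case using res_class.scale[OF res_class.res[OF z], of c] by (simp add: mult.commute)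
next
  case (res w)
  have nz: "z' - of_real x \<noteq> 0" if "Im z' \<noteq> 0" for z' and x :: real using that by (auto simp: complex_eq_iff)
  have distinct: "res_class (\<lambda>x. 1 / (z - of_real x) * (1 / (w - of_real x)))" if w: "Im w \<noteq> 0" "w \<noteq> z" for w
  proof -
    have eq: "(\<lambda>x. 1 / (z - of_real x) * (1 / (w - of_real x))) = (\<lambda>x. 1 / (w - z) * (1 / (z - of_real x) - 1 / (w - of_real x)))"
      using w nz[OF z] nz[OF w(1)] by (intro ext) (simp add: field_simps)
    show ?thesis unfolding eq by (intro res_class.scale res_class_diff res_class.res z w)
  qed
  show ?case
  proof (cases "w = z")
    case True
    show ?thesis unfolding True
    proof (rule res_class.lim, intro allI impI)
      fix e :: real assume e: "e > 0"
      define \<delta> where "\<delta> = e * \<bar>Im z\<bar> ^ 3 / 2"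
      have \<delta>: "\<delta> > 0" unfolding \<delta>_def using e z by simp
      let ?w = "z + of_real \<delta>"
      have w: "Im ?w \<noteq> 0" "?w \<noteq> z" using z \<delta> by auto
      have "cmod (1 / (z - of_real x) * (1 / (z - of_real x)) - 1 / (z - of_real x) * (1 / (?w - of_real x))) < e" for x
      proof -
        have "1 / a * (1 / a) - 1 / a * (1 / b) = (b - a) * (1 / a * (1 / a) * (1 / b))"
          if "a \<noteq> 0" "b \<noteq> 0" for a b :: complex
          using that by (simp add: field_simps)
        from this[OF nz[OF z, of x] nz[OF w(1), of x]]
        have "1 / (z - of_real x) * (1 / (z - of_real x)) - 1 / (z - of_real x) * (1 / (?w - of_real x))
            = of_real \<delta> * (1 / (z - of_real x) * (1 / (z - of_real x)) * (1 / (?w - of_real x)))"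
          by simp
        hence "cmod (1 / (z - of_real x) * (1 / (z - of_real x)) - 1 / (z - of_real x) * (1 / (?w - of_real x)))
            = \<delta> * (cmod (1 / (z - of_real x)) * cmod (1 / (z - of_real x)) * cmod (1 / (?w - of_real x)))"
          using \<delta> by (simp only: norm_mult norm_of_real abs_of_pos)
        also have "\<dots> \<le> \<delta> * (1 / \<bar>Im z\<bar> * (1 / \<bar>Im z\<bar>) * (1 / \<bar>Im ?w\<bar>))"
          using \<delta> by (intro mult_left_mono mult_mono cmod_res_le z w) auto
        also have "\<dots> = e / 2" unfolding \<delta>_def using z by (simp add: field_simps power3_eq_cube)
        finally show ?thesis using e by simp
      qed
      thus "\<exists>g. res_class g \<and> (\<forall>x. cmod (1 / (z - of_real x) * (1 / (z - of_real x)) - g x) < e)"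
        using distinct[OF w] by blast
    qed
  qed (use distinct res in blast)
next
  case (add f g)
  thus ?case using res_class.add[OF add.IH] by (simp only: distrib_left)
next
  case (scale f c)
  thus ?case using res_class.scale[OF scale.IH, of c] by (simp only: mult.left_commute)
next
  case (lim f)
  show ?case
  proof (rule res_class.lim, intro allI impI)
    fix e :: real assume e: "e > 0"
    hence "e * \<bar>Im z\<bar> > 0" using z by simp
    then obtain g where g: "res_class (\<lambda>x. 1 / (z - of_real x) * g x)" "\<And>x. cmod (f x - g x) < e * \<bar>Im z\<bar>"
      using lim by blast
    have "cmod (1 / (z - of_real x) * f x - 1 / (z - of_real x) * g x) < e" for x
    proof -
      have "cmod (1 / (z - of_real x) * f x - 1 / (z - of_real x) * g x) = cmod (1 / (z - of_real x)) * cmod (f x - g x)"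
        by (simp only: right_diff_distrib[symmetric] norm_mult)
      also have "\<dots> \<le> 1 / \<bar>Im z\<bar> * cmod (f x - g x)" by (intro mult_right_mono cmod_res_le z) auto
      also have "\<dots> < 1 / \<bar>Im z\<bar> * (e * \<bar>Im z\<bar>)" using g(2)[of x] z by (intro mult_strict_left_mono) auto
      finally show ?thesis using z by simp
    qed
    with g(1) show "\<exists>g. res_class g \<and> (\<forall>x. cmod (1 / (z - of_real x) * f x - g x) < e)" by blast
  qed
qed

lemma res_class_mult:
  assumes f: "res_class f" and g: "res_class g"
  shows "res_class (\<lambda>x. f x * g x)"
  using f
proof (induction rule: res_class.induct)
  case (const c) show ?case by (rule res_class.scale[OF g])
next
  case (res z) show ?case by (rule res_class_mult_res[OF res g])
next
  case (add f h) thus ?case using res_class.add[OF add.IH] by (simp only: distrib_right)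
next
  case (scale f c) thus ?case using res_class.scale[OF scale.IH, of c] by (simp only: mult.assoc)
next
  case (lim f)
  obtain B where B: "B > 0" "\<And>x. cmod (g x) \<le> B" using res_class_bounded[OF g] by blast
  show ?case
  proof (rule res_class.lim, intro allI impI)
    fix e :: real assume e: "e > 0"
    hence "e / B > 0" using B by simp
    then obtain h where h: "res_class (\<lambda>x. h x * g x)" "\<And>x. cmod (f x - h x) < e / B"
      using lim by blast
    have "cmod (f x * g x - h x * g x) < e" for x
    proof -
      have "cmod (f x * g x - h x * g x) = cmod (f x - h x) * cmod (g x)"
        by (simp only: left_diff_distrib[symmetric] norm_mult)
      also have "\<dots> \<le> cmod (f x - h x) * B" using B by (intro mult_left_mono) auto
      also have "\<dots> < e / B * B" using h(2)[of x] B by (intro mult_strict_right_mono) auto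
      finally show ?thesis using B by simp
    qed
    with h(1) show "\<exists>h. res_class h \<and> (\<forall>x. cmod (f x * g x - h x) < e)" by blast
  qed
qed

text \<open>The Cayley transform maps the real line to the unit circle without the point \<open>1\<close>. It and
  its conjugate are affine functions of the resolvents at \<open>\<i>\<close> and \<open>-\<i>\<close>.\<close>

definition cayley :: "real \<Rightarrow> complex" where
  "cayley x = (of_real x + \<i>) / (of_real x - \<i>)"

lemma cayley_eq: "cayley x = 1 - 2 * \<i> * (1 / (\<i> - of_real x))"
  and cnj_cayley_eq: "cnj (cayley x) = 1 + 2 * \<i> * (1 / (- \<i> - of_real x))"
  and cayley_circle: "cmod (cayley x) = 1" and cayley_ne: "cayley x \<noteq> 1"
  and cayley_inverse: "\<i> * (cayley x + 1) / (cayley x - 1) = of_real x"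
proof -
  have nz: "of_real x - \<i> \<noteq> 0" "\<i> - of_real x \<noteq> 0" "- \<i> - of_real x \<noteq> 0" "of_real x + \<i> \<noteq> 0"
    by (auto simp: complex_eq_iff)
  show e: "cayley x = 1 - 2 * \<i> * (1 / (\<i> - of_real x))"
    unfolding cayley_def using nz by (simp add: field_simps)
  show "cnj (cayley x) = 1 + 2 * \<i> * (1 / (- \<i> - of_real x))"
    unfolding e by simp
  have "cmod (of_real x + \<i>) = cmod (of_real x - \<i>)" by (simp add: cmod_def)
  thus "cmod (cayley x) = 1" unfolding cayley_def using nz by (simp add: norm_divide)
  show "cayley x \<noteq> 1" unfolding e using nz by simp
  have "cayley x + 1 = 2 * of_real x / (of_real x - \<i>)" "cayley x - 1 = 2 * \<i> / (of_real x - \<i>)"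
    unfolding cayley_def using nz by (simp_all add: field_simps)
  thus "\<i> * (cayley x + 1) / (cayley x - 1) = of_real x" using nz by simp
qed

lemma res_class_real_polynomial:
  fixes q :: "complex \<Rightarrow> real"
  assumes "real_polynomial_function q"
  shows "res_class (\<lambda>x. of_real (q (cayley x)))"
  using assms
proof induction
  case (linear f)
  have c1: "res_class cayley" unfolding cayley_eq[abs_def]
    by (intro res_class_diff res_class.intros) simp
  have c2: "res_class (\<lambda>x. cnj (cayley x))" unfolding cnj_cayley_eq
    by (intro res_class.intros) simp
  from linear obtain a b where "\<And>u. complex_of_real (f u) = a * u + b * cnj u"
    using bounded_linear_complex_real by blast
  thus ?case by (simp only: res_class.add res_class.scale c1 c2)
qed (simp_all add: res_class.const res_class.add res_class_mult)

text \<open>Transported to the unit circle by the Cayley transform, a function of compact support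
  extends continuously by \<open>0\<close> to the point \<open>1\<close>, which corresponds to infinity. Polynomials
  in the real and imaginary part then approximate it by the Stone-Weierstrass theorem.\<close>

theorem res_class_compact_support:
  fixes \<phi> :: "real \<Rightarrow> complex"
  assumes cont: "continuous_on UNIV \<phi>" and supp: "\<And>x. \<bar>x\<bar> > R \<Longrightarrow> \<phi> x = 0"
  shows "res_class \<phi>"
proof (rule res_class.lim, intro allI impI)
  fix e :: real assume e: "e > 0"
  define X where "X = (\<lambda>w :: complex. \<i> * (w + 1) / (w - 1))"
  define F where "F = (\<lambda>w. if w = 1 then 0 else \<phi> (Re (X w)))"
  have real: "Im (X w) = 0" if "w \<in> sphere 0 1" "w \<noteq> 1" for w
  proof -
    have w: "w * cnj w = 1" "w \<noteq> 0" using that complex_norm_square[of w] by auto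
    hence cw: "cnj w = 1 / w" by (simp add: field_simps)
    have "cnj (X w) = - \<i> * (1 / w + 1) / (1 / w - 1)" unfolding X_def by (simp add: cw)
    also have "\<dots> = X w" unfolding X_def using that w by (simp add: divide_simps) (simp add: algebra_simps)
    finally show ?thesis by (metis Reals_cnj_iff complex_is_Real_iff)
  qed
  have "continuous_on (sphere 0 1) F"
    unfolding continuous_on_def
  proof
    fix w :: complex assume w: "w \<in> sphere 0 1"
    show "(F \<longlongrightarrow> F w) (at w within sphere 0 1)"
    proof (cases "w = 1")
      case False
      have "isCont \<phi> (Re (X w))" using cont by (simp add: continuous_on_eq_continuous_at)
      moreover have "isCont (\<lambda>v. Re (X v)) w" unfolding X_def by (intro isCont_Re continuous_intros) (use False in auto)
      ultimately have "isCont (\<lambda>v. \<phi> (Re (X v))) w" by (rule isCont_o2[rotated])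
      hence "((\<lambda>v. \<phi> (Re (X v))) \<longlongrightarrow> F w) (at w within sphere 0 1)"
        unfolding isCont_def F_def using False by (auto intro: tendsto_within_subset)
      moreover have "\<forall>\<^sub>F v in at w within sphere 0 1. \<phi> (Re (X v)) = F v"
        using eventually_neq_at_within[of 1 w] by eventually_elim (simp add: F_def)
      ultimately show ?thesis by (rule Lim_transform_eventually)
    next
      case True
      \<comment> \<open>Points of the circle within this distance of \<open>1\<close> correspond to real numbers beyond
        \<open>R\<close>.\<close>
      define \<delta> where "\<delta> = 1 / (\<bar>R\<bar> + 1)"
      have \<delta>: "\<delta> > 0" "\<delta> \<le> 1" unfolding \<delta>_def by (auto simp: add_nonneg_pos)
      have "\<forall>\<^sub>F v in at 1 within sphere 0 1. v \<in> sphere 0 1 \<and> v \<noteq> 1 \<and> dist v 1 < \<delta>"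
        unfolding eventually_at using \<delta> by (intro exI[of _ \<delta>]) auto
      hence "\<forall>\<^sub>F v in at 1 within sphere 0 1. F v = 0"
      proof eventually_elim
        case (elim v)
        have "\<bar>Re (X v)\<bar> = cmod (X v)" using real[of v] elim by (simp add: cmod_eq_Re)
        also have "\<dots> = cmod (v + 1) / cmod (v - 1)" unfolding X_def by (simp add: norm_mult norm_divide)
        also have "\<dots> > \<bar>R\<bar>"
        proof -
          have d: "cmod (v - 1) < \<delta>" "cmod (v - 1) > 0" using elim by (auto simp: dist_norm)
          have "2 \<le> cmod (v + 1) + cmod (v - 1)"
            using norm_triangle_ineq4[of "v + 1" "v - 1"] by simp
          hence "cmod (v + 1) \<ge> 1" using d \<delta> by linarith
          moreover have "\<bar>R\<bar> * cmod (v - 1) \<le> \<bar>R\<bar> * \<delta>" using d by (intro mult_left_mono) auto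
          moreover have "\<bar>R\<bar> * \<delta> < 1" unfolding \<delta>_def by (simp add: divide_less_eq)
          ultimately have "\<bar>R\<bar> * cmod (v - 1) < cmod (v + 1)" by linarith
          thus ?thesis using d by (simp add: less_divide_eq)
        qed
        finally have "\<phi> (Re (X v)) = 0" by (intro supp) linarith
        thus ?case by (simp add: F_def)
      qed
      thus ?thesis unfolding True by (simp add: F_def tendsto_eventually)
    qed
  qed
  then obtain g where g: "polynomial_function g" "\<forall>u\<in>sphere 0 1. norm (F u - g u) < e"
    using Stone_Weierstrass_polynomial_function[OF compact_sphere _ e] by metis
  have rp: "real_polynomial_function (\<lambda>u. Re (g u))" "real_polynomial_function (\<lambda>u. Im (g u))"
    using g(1) bounded_linear_Re bounded_linear_Im unfolding polynomial_function_def o_def by blast+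
  have "res_class (\<lambda>x. of_real (Re (g (cayley x))) + \<i> * of_real (Im (g (cayley x))))"
    by (intro res_class.add res_class.scale res_class_real_polynomial[OF rp(1)] res_class_real_polynomial[OF rp(2)])
  hence "res_class (\<lambda>x. g (cayley x))" by (simp add: complex_eq[symmetric])
  moreover have "cmod (\<phi> x - g (cayley x)) < e" for x
  proof -
    have "F (cayley x) = \<phi> x" unfolding F_def X_def cayley_inverse by (simp add: cayley_ne)
    thus ?thesis using g(2) cayley_circle[of x] by (metis mem_sphere_0)
  qed
  ultimately show "\<exists>g. res_class g \<and> (\<forall>x. cmod (\<phi> x - g x) < e)" by blast
qed

lemma sum_mset_diff_le:
  fixes f g :: "'a \<Rightarrow> complex"
  assumes "\<And>x. cmod (f x - g x) \<le> e"
  shows "cmod ((\<Sum>x\<in>#M. f x) - (\<Sum>x\<in>#M. g x)) \<le> real (size M) * e"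
proof (induction M)
  case (add x M)
  have "(\<Sum>x\<in>#add_mset x M. f x) - (\<Sum>x\<in>#add_mset x M. g x) = (f x - g x) + ((\<Sum>x\<in>#M. f x) - (\<Sum>x\<in>#M. g x))" by simp
  hence "cmod ((\<Sum>x\<in>#add_mset x M. f x) - (\<Sum>x\<in>#add_mset x M. g x)) \<le> cmod (f x - g x) + cmod ((\<Sum>x\<in>#M. f x) - (\<Sum>x\<in>#M. g x))"
    using norm_triangle_ineq by metis
  thus ?case using add assms[of x] by (simp add: distrib_right)
qed simp

lemma sum_mset_le:
  fixes f :: "'a \<Rightarrow> complex"
  assumes "\<And>x. cmod (f x) \<le> B"
  shows "cmod (\<Sum>x\<in>#M. f x) \<le> real (size M) * B"
  using sum_mset_diff_le[of f "\<lambda>_. 0" B M] assms by simp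

lemma sum_mset_cmult: "(\<Sum>x\<in>#M. c * f x) = c * (\<Sum>x\<in>#M. f x :: complex)"
  by (induction M) (auto simp: distrib_left)

text \<open>Convergence is preserved by linear combinations and, because the averages are normalised
  by the number of eigenvalues, by uniform limits. Integrability is part of the induction,
  as the integrals of sums would be meaningless without it.\<close>

lemma distribution_from_resolvents:
  fixes E :: "nat \<Rightarrow> real multiset" and S :: "real \<Rightarrow> real multiset"
  assumes sizeE: "\<forall>\<^sub>F n in sequentially. size (E n) = N n \<and> N n > 0"
    and sizeS: "\<And>\<theta>. \<theta> \<in> {-pi..pi} \<Longrightarrow> size (S \<theta>) = D" and D: "D > 0"
    and int: "\<And>z. Im z \<noteq> 0 \<Longrightarrow> integrable circ_measure (\<lambda>\<theta>. \<Sum>x\<in>#S \<theta>. 1 / (z - of_real x))"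
    and lim: "\<And>z. Im z \<noteq> 0 \<Longrightarrow> (\<lambda>n. 1 / of_nat (N n) * (\<Sum>x\<in>#E n. 1 / (z - of_real x)))
       \<longlonglongrightarrow> mean (\<lambda>\<theta>. 1 / of_nat D * (\<Sum>x\<in>#S \<theta>. 1 / (z - of_real x)))"
    and \<phi>: "res_class \<phi>"
  shows "integrable circ_measure (\<lambda>\<theta>. \<Sum>x\<in>#S \<theta>. \<phi> x) \<and>
     (\<lambda>n. 1 / of_nat (N n) * (\<Sum>x\<in>#E n. \<phi> x)) \<longlonglongrightarrow> mean (\<lambda>\<theta>. 1 / of_nat D * (\<Sum>x\<in>#S \<theta>. \<phi> x))"
  using \<phi>
proof (induction rule: res_class.induct)
  case (const c)
  have "integrable circ_measure (\<lambda>\<theta>. \<Sum>x\<in>#S \<theta>. c) \<longleftrightarrow> integrable circ_measure (\<lambda>\<theta>. of_nat D * c)"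
    by (intro Bochner_Integration.integrable_cong) (auto simp: sizeS)
  moreover have "integrable circ_measure (\<lambda>\<theta>. of_nat D * c)" by (rule circ_bounded_integrable[of _ "cmod (of_nat D * c)"]) auto
  moreover have "mean (\<lambda>\<theta>. 1 / of_nat D * (\<Sum>x\<in>#S \<theta>. c)) = mean (\<lambda>\<theta>. c)"
    unfolding mean_def set_integral_circ using D
    by (intro arg_cong2[of _ _ _ _ "(*)"] refl Bochner_Integration.integral_cong) (auto simp: sizeS)
  moreover have "(\<lambda>n. 1 / of_nat (N n) * (\<Sum>x\<in>#E n. c)) \<longlonglongrightarrow> c"
    by (rule tendsto_eventually, rule eventually_mono[OF sizeE]) auto
  ultimately show ?case by (simp add: mean_const)
next
  case (res z)
  thus ?case using int lim by blast
next
  case (add f g)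
  hence i: "integrable circ_measure (\<lambda>\<theta>. \<Sum>x\<in>#S \<theta>. f x)" "integrable circ_measure (\<lambda>\<theta>. \<Sum>x\<in>#S \<theta>. g x)" by blast+
  have m: "mean (\<lambda>\<theta>. 1 / of_nat D * (\<Sum>x\<in>#S \<theta>. f x + g x)) = mean (\<lambda>\<theta>. 1 / of_nat D * (\<Sum>x\<in>#S \<theta>. f x)) + mean (\<lambda>\<theta>. 1 / of_nat D * (\<Sum>x\<in>#S \<theta>. g x))"
    unfolding sum_mset.distrib distrib_left
    by (rule mean_add; unfold set_integrable_circ; intro integrable_mult_right i)
  show ?case unfolding m unfolding sum_mset.distrib distrib_left
    using i add by (intro conjI Bochner_Integration.integrable_add tendsto_add) auto
next
  case (scale f c)
  have m: "mean (\<lambda>\<theta>. 1 / of_nat D * (c * (\<Sum>x\<in>#S \<theta>. f x))) = c * mean (\<lambda>\<theta>. 1 / of_nat D * (\<Sum>x\<in>#S \<theta>. f x))"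
    unfolding mean_cmult[symmetric] by (simp only: mult.left_commute)
  show ?case unfolding sum_mset_cmult m mult.left_commute[of "1 / of_nat (N _)" c]
    using scale.IH by (intro conjI integrable_mult_right tendsto_mult_left) auto
next
  case (lim f)
  let ?conv = "\<lambda>g. integrable circ_measure (\<lambda>\<theta>. \<Sum>x\<in>#S \<theta>. g x) \<and>
     (\<lambda>n. 1 / of_nat (N n) * (\<Sum>x\<in>#E n. g x)) \<longlonglongrightarrow> mean (\<lambda>\<theta>. 1 / of_nat D * (\<Sum>x\<in>#S \<theta>. g x))"
  have "\<exists>g. ?conv g \<and> res_class g \<and> (\<forall>x. cmod (f x - g x) < 1 / real (Suc j))" for j
  proof -
    have "1 / real (Suc j) > 0" by simp
    with lim show ?thesis by blast
  qed
  hence "\<exists>G. \<forall>j. ?conv (G j) \<and> res_class (G j) \<and> (\<forall>x. cmod (f x - G j x) < 1 / real (Suc j))"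
    by (intro choice allI)
  then obtain G where G: "\<And>j. integrable circ_measure (\<lambda>\<theta>. \<Sum>x\<in>#S \<theta>. G j x)"
     "\<And>j. (\<lambda>n. 1 / of_nat (N n) * (\<Sum>x\<in>#E n. G j x)) \<longlonglongrightarrow> mean (\<lambda>\<theta>. 1 / of_nat D * (\<Sum>x\<in>#S \<theta>. G j x))"
     "\<And>j x. cmod (f x - G j x) < 1 / real (Suc j)" "res_class (G 0)" by blast
  obtain B where B: "B > 0" "\<And>x. cmod (G 0 x) \<le> B" using res_class_bounded[OF G(4)] by blast
  have fB: "cmod (f x) \<le> B + 1" for x
    using norm_triangle_ineq[of "f x - G 0 x" "G 0 x"] G(3)[of x 0] B(2)[of x] by simp
  have diffS: "cmod ((\<Sum>x\<in>#S \<theta>. f x) - (\<Sum>x\<in>#S \<theta>. G j x)) \<le> real D * (1 / real (Suc j))" if "\<theta> \<in> {-pi..pi}" for \<theta> j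
    using sum_mset_diff_le[of f "G j" "1 / real (Suc j)" "S \<theta>"] less_imp_le[OF G(3)] sizeS[OF that] by simp
  have meas: "(\<lambda>\<theta>. \<Sum>x\<in>#S \<theta>. f x) \<in> borel_measurable circ_measure"
  proof (rule borel_measurable_LIMSEQ_metric[of "\<lambda>j \<theta>. \<Sum>x\<in>#S \<theta>. G j x"])
    show "\<And>j. (\<lambda>\<theta>. \<Sum>x\<in>#S \<theta>. G j x) \<in> borel_measurable circ_measure" using G(1) by simp
    fix \<theta> assume "\<theta> \<in> space circ_measure"
    hence t: "\<theta> \<in> {-pi..pi}" by simp
    have "(\<lambda>j. real D * (1 / real (Suc j))) \<longlonglongrightarrow> real D * 0"
      by (intro tendsto_intros LIMSEQ_Suc[OF lim_1_over_n])
    hence z: "(\<lambda>j. real D * (1 / real (Suc j))) \<longlonglongrightarrow> 0" by simp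
    have "(\<lambda>j. (\<Sum>x\<in>#S \<theta>. G j x) - (\<Sum>x\<in>#S \<theta>. f x)) \<longlonglongrightarrow> 0"
      by (rule Lim_null_comparison[OF _ z]) (use diffS[OF t] in \<open>auto simp: norm_minus_commute\<close>)
    thus "(\<lambda>j. \<Sum>x\<in>#S \<theta>. G j x) \<longlonglongrightarrow> (\<Sum>x\<in>#S \<theta>. f x)" by (rule LIM_zero_cancel)
  qed
  have int: "integrable circ_measure (\<lambda>\<theta>. \<Sum>x\<in>#S \<theta>. f x)"
  proof (rule circ_bounded_integrable[OF meas])
    fix \<theta> assume "\<theta> \<in> {-pi..pi}"
    thus "cmod (\<Sum>x\<in>#S \<theta>. f x) \<le> real D * (B + 1)"
      using sum_mset_le[of f "B + 1" "S \<theta>", OF fB] by (simp only: sizeS)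
  qed
  have "(\<lambda>n. 1 / of_nat (N n) * (\<Sum>x\<in>#E n. f x)) \<longlonglongrightarrow> mean (\<lambda>\<theta>. 1 / of_nat D * (\<Sum>x\<in>#S \<theta>. f x))"
  proof (rule tendstoI)
    fix e :: real assume e: "e > 0"
    obtain j where j: "1 / real (Suc j) < e / 3" using e nat_approx_posE[of "e / 3"] by auto
    let ?m = "\<lambda>f. mean (\<lambda>\<theta>. 1 / of_nat D * (\<Sum>x\<in>#S \<theta>. f x))"
    have "cmod (?m f - ?m (G j)) \<le> 1 / (2 * pi) * (LINT \<theta>:{-pi..pi}|lebesgue. 1 / real (Suc j))"
    proof -
      have i: "set_integrable lebesgue {-pi..pi} (\<lambda>\<theta>. 1 / of_nat D * (\<Sum>x\<in>#S \<theta>. f x))"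
        "set_integrable lebesgue {-pi..pi} (\<lambda>\<theta>. 1 / of_nat D * (\<Sum>x\<in>#S \<theta>. G j x))"
        unfolding set_integrable_circ by (intro integrable_mult_right int G(1))+
      show ?thesis unfolding mean_diff[OF i, symmetric]
      proof (rule mean_bound)
        show "set_integrable lebesgue {-pi..pi} (\<lambda>\<theta>. 1 / of_nat D * (\<Sum>x\<in>#S \<theta>. f x) - 1 / of_nat D * (\<Sum>x\<in>#S \<theta>. G j x))"
          by (rule set_integral_diff(1)[OF i])
        show "set_integrable lebesgue {-pi..pi} (\<lambda>\<theta>. 1 / real (Suc j))"
          unfolding set_integrable_circ by (rule circ_bounded_integrable[of _ 1]) auto
        fix \<theta> assume t: "\<theta> \<in> {-pi..pi}"
        have "cmod (1 / of_nat D * (\<Sum>x\<in>#S \<theta>. f x) - 1 / of_nat D * (\<Sum>x\<in>#S \<theta>. G j x)) = 1 / real D * cmod ((\<Sum>x\<in>#S \<theta>. f x) - (\<Sum>x\<in>#S \<theta>. G j x))"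
          by (simp only: right_diff_distrib[symmetric] norm_mult norm_divide norm_one norm_of_nat)
        also have "\<dots> \<le> 1 / real D * (real D * (1 / real (Suc j)))" by (intro mult_left_mono diffS t) auto
        finally show "cmod (1 / of_nat D * (\<Sum>x\<in>#S \<theta>. f x) - 1 / of_nat D * (\<Sum>x\<in>#S \<theta>. G j x)) \<le> 1 / real (Suc j)"
          using D by simp
      qed
    qed
    also have "\<dots> = 1 / real (Suc j)" by (simp add: set_lebesgue_integral_def)
    finally have 1: "cmod (?m f - ?m (G j)) < e / 3" using j by simp
    have 2: "\<forall>\<^sub>F n in sequentially. dist (1 / of_nat (N n) * (\<Sum>x\<in>#E n. G j x)) (?m (G j)) < e / 3"
      using e by (intro tendstoD[OF G(2)]) auto
    show "\<forall>\<^sub>F n in sequentially. dist (1 / of_nat (N n) * (\<Sum>x\<in>#E n. f x)) (?m f) < e"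
      using 2 sizeE
    proof eventually_elim
      case (elim n)
      have "cmod (1 / of_nat (N n) * (\<Sum>x\<in>#E n. f x) - 1 / of_nat (N n) * (\<Sum>x\<in>#E n. G j x)) = 1 / real (N n) * cmod ((\<Sum>x\<in>#E n. f x) - (\<Sum>x\<in>#E n. G j x))"
        by (simp only: right_diff_distrib[symmetric] norm_mult norm_divide norm_one norm_of_nat)
      also have "\<dots> \<le> 1 / real (N n) * (real (N n) * (1 / real (Suc j)))"
        using sum_mset_diff_le[of f "G j" "1 / real (Suc j)" "E n"] less_imp_le[OF G(3)] elim
        by (intro mult_left_mono) auto
      also have "\<dots> < e / 3" using elim j by simp
      finally have 3: "cmod (1 / of_nat (N n) * (\<Sum>x\<in>#E n. f x) - 1 / of_nat (N n) * (\<Sum>x\<in>#E n. G j x)) < e / 3" .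
      note cmod_diff_triangle[of "1 / of_nat (N n) * (\<Sum>x\<in>#E n. f x)" "?m f" "1 / of_nat (N n) * (\<Sum>x\<in>#E n. G j x)" "?m (G j)"]
      with 1 3 elim(1) show ?case unfolding dist_norm by linarith
    qed
  qed
  with int show ?case by blast
qed

section \<open>The Hermitian dilation\<close>

definition dilation :: "complex mat \<Rightarrow> complex mat" where
  "dilation A = four_block_mat (0\<^sub>m (dim_row A) (dim_row A)) A (mat_adjoint A) (0\<^sub>m (dim_col A) (dim_col A))"

text \<open>The smaller of the two Gram matrices, whose eigenvalues are the squares of the singular
  values.\<close>

definition gram :: "complex mat \<Rightarrow> complex mat" where
  "gram A = (if dim_col A \<le> dim_row A then mat_adjoint A * A else A * mat_adjoint A)"

lemma dilation_carrier [simp]: "A \<in> carrier_mat r c \<Longrightarrow> dilation A \<in> carrier_mat (r + c) (r + c)"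
  unfolding dilation_def by auto

lemma mat_adjoint_adjoint: "mat_adjoint (mat_adjoint A) = (A :: complex mat)"
  by (rule eq_matI) auto

lemma adjoint_mult_hermitian:
  assumes A: "A \<in> carrier_mat r c"
  shows "hermitian_mat (mat_adjoint A * A)"
proof (rule hermitian_matI[of _ c])
  show c: "mat_adjoint A * A \<in> carrier_mat c c" using A by (intro mult_carrier_mat[of _ c r]) auto
  fix i j assume ij: "i < c" "j < c"
  have e: "(mat_adjoint A * A) $$ (i, j) = (\<Sum>k<r. cnj (A $$ (k, i)) * A $$ (k, j))" if "i < c" "j < c" for i j
    using that A by (subst mat_mult_index_sum[of _ c r _ c]) auto
  show "(mat_adjoint A * A) $$ (i, j) = cnj ((mat_adjoint A * A) $$ (j, i))"
    unfolding e[OF ij] e[OF ij(2,1)] by (simp add: mult.commute)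
qed

lemma gram_hermitian: "hermitian_mat (gram A)"
  unfolding gram_def using adjoint_mult_hermitian[of A "dim_row A" "dim_col A"]
    adjoint_mult_hermitian[of "mat_adjoint A" "dim_col A" "dim_row A"]
  by (auto simp: mat_adjoint_adjoint)

lemma gram_carrier: "A \<in> carrier_mat r c \<Longrightarrow> gram A \<in> carrier_mat (min r c) (min r c)"
  unfolding gram_def by auto

lemma tr_add: "A \<in> carrier_mat d d \<Longrightarrow> B \<in> carrier_mat d d \<Longrightarrow> tr (A + B) = tr A + tr B"
  by (auto simp: tr_def sum.distrib)

lemma mat_add_minus_cancel:
  assumes "X \<in> carrier_mat r c" "Y \<in> carrier_mat r c"
  shows "X + (Y - X) = (Y :: complex mat)"
  using assms by (intro eq_matI) auto

lemma uminus_mult_mat: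
  assumes "X \<in> carrier_mat r c" "Y \<in> carrier_mat c d"
  shows "(- X) * Y = - (X * Y :: complex mat)"
  using assms by (intro uminus_mult_left_mat) simp

lemma scalar_mult_mat:
  assumes "X \<in> carrier_mat r c"
  shows "(z \<cdot>\<^sub>m 1\<^sub>m r) * X = (z \<cdot>\<^sub>m X :: complex mat)"
  using assms by (simp add: mult_smult_assoc_mat[of _ r r _ c])

lemma tr_smult: "tr (c \<cdot>\<^sub>m A) = c * tr A" if "A \<in> carrier_mat d d"
  using that by (auto simp: tr_def sum_distrib_left)

lemma tr_one: "tr (1\<^sub>m d) = of_nat d"
  by (simp add: tr_def)

lemma sum_lessThan_split: "(\<Sum>i<r + c. g i) = (\<Sum>i<r. g i) + (\<Sum>i<c. g (r + i))" for g :: "nat \<Rightarrow> complex"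
  by (induction c) (auto simp: add.assoc)

lemma tr_four_block:
  assumes "A \<in> carrier_mat r r" "B \<in> carrier_mat r c" "C \<in> carrier_mat c r" "D \<in> carrier_mat c c"
  shows "tr (four_block_mat A B C D) = tr A + tr D"
proof -
  have "tr (four_block_mat A B C D) = (\<Sum>i<r + c. four_block_mat A B C D $$ (i, i))"
    using assms by (simp add: tr_def)
  also have "\<dots> = (\<Sum>i<r. four_block_mat A B C D $$ (i, i)) + (\<Sum>i<c. four_block_mat A B C D $$ (r + i, r + i))"
    by (rule sum_lessThan_split)
  also have "\<dots> = tr A + tr D" using assms by (auto simp: tr_def)
  finally show ?thesis .
qed

text \<open>With \<open>A'\<close> the adjoint, \<open>w = z\<^sup>2\<close> and \<open>S\<close> the resolvent of \<open>A' * A\<close> at \<open>w\<close>, the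
  inverse of \<open>z\<close> minus the dilation has the blocks \<open>(1 + A * S * A') / z\<close>, \<open>A * S\<close>, \<open>S * A'\<close>
  and \<open>z * S\<close>, and the resolvent of \<open>A * A'\<close> at \<open>w\<close> is \<open>(1 + A * S * A') / w\<close>. The traces
  follow from \<open>A' * A * S = w * S - 1\<close>.\<close>

lemma
  assumes A: "A \<in> carrier_mat r c" and z: "Im (z\<^sup>2) \<noteq> 0"
  shows tr_resolvent_dilation:
      "rtr (dilation A) z = 2 * z * rtr (mat_adjoint A * A) (z\<^sup>2) + (of_nat r - of_nat c) / z"
    and tr_resolvent_mult_adjoint:
      "rtr (A * mat_adjoint A) (z\<^sup>2) = rtr (mat_adjoint A * A) (z\<^sup>2) + (of_nat r - of_nat c) / z\<^sup>2"
proof -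
  define w where "w = z\<^sup>2"
  have z0: "z \<noteq> 0" using z by auto
  have w0: "w \<noteq> 0" using z0 by (simp add: w_def)
  let ?A' = "mat_adjoint A"
  have A': "?A' \<in> carrier_mat c r" using A by simp
  define G where "G = ?A' * A"
  have G: "G \<in> carrier_mat c c" unfolding G_def using A' A by (rule mult_carrier_mat)
  define S where "S = resolvent G w"
  have S: "S \<in> carrier_mat c c" unfolding S_def using G by simp
  have "hermitian_mat G" unfolding G_def by (rule adjoint_mult_hermitian[OF A])
  hence KS: "(w \<cdot>\<^sub>m 1\<^sub>m c - G) * S = 1\<^sub>m c"
    using resolvent_inverse(1)[OF G hermitian_det_nonzero[OF G]] z unfolding S_def w_def by blast
  define P where "P = A * S * ?A'"
  have AS: "A * S \<in> carrier_mat r c" using A S by (rule mult_carrier_mat)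
  have SA: "S * ?A' \<in> carrier_mat c r" using S A' by (rule mult_carrier_mat)
  have P: "P \<in> carrier_mat r r" unfolding P_def using AS A' by (rule mult_carrier_mat)
  have GS: "G * S = w \<cdot>\<^sub>m S - 1\<^sub>m c"
  proof -
    have "(w \<cdot>\<^sub>m 1\<^sub>m c - G) * S = w \<cdot>\<^sub>m S - G * S"
      using G S by (subst minus_mult_distrib_mat[of _ c c _ _ c]) auto
    with KS have e: "w \<cdot>\<^sub>m S - G * S = 1\<^sub>m c" by simp
    have GSc: "G * S \<in> carrier_mat c c" using G S by (rule mult_carrier_mat)
    show ?thesis
    proof (rule eq_matI)
      fix i j assume ij: "i < dim_row (w \<cdot>\<^sub>m S - 1\<^sub>m c)" "j < dim_col (w \<cdot>\<^sub>m S - 1\<^sub>m c)"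
      hence ij': "i < c" "j < c" using S by auto
      have "(w \<cdot>\<^sub>m S - G * S) $$ (i, j) = 1\<^sub>m c $$ (i, j)" by (simp only: e)
      thus "(G * S) $$ (i, j) = (w \<cdot>\<^sub>m S - 1\<^sub>m c) $$ (i, j)"
        using ij' carrier_matD[OF S] carrier_matD[OF G] by (simp del: index_mult_mat(1) add: algebra_simps)
    qed (use carrier_matD[OF S] carrier_matD[OF G] in simp_all)
  qed
  have A'P: "?A' * P = w \<cdot>\<^sub>m (S * ?A') - ?A'"
  proof -
    have "?A' * P = G * (S * ?A')"
      unfolding P_def G_def using A A' S SA
      by (simp add: assoc_mult_mat[of _ _ _ _ c _ r] assoc_mult_mat[of _ c r _ c _ r])
    also have "\<dots> = G * S * ?A'" using G S A' by (rule assoc_mult_mat[symmetric])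
    also have "\<dots> = w \<cdot>\<^sub>m (S * ?A') - ?A'"
      unfolding GS using S A' by (subst minus_mult_distrib_mat[of _ c c _ _ r]) (auto simp: mult_smult_assoc_mat[of _ c c])
    finally show ?thesis .
  qed
  have trP: "tr P = w * tr S - of_nat c"
  proof -
    have "tr P = tr (?A' * (A * S))" unfolding P_def by (rule tr_comm[OF AS A'])
    also have "?A' * (A * S) = G * S" unfolding G_def using A' A S by (rule assoc_mult_mat[symmetric])
    also have "tr \<dots> = w * tr S - of_nat c" unfolding GS using S by (simp add: tr_minus[of _ c] tr_smult[of _ c] tr_one)
    finally show ?thesis .
  qed
  define Q where "Q = 1\<^sub>m r + P"
  have Q: "Q \<in> carrier_mat r r" unfolding Q_def using P by simp
  have A'Q: "?A' * Q = w \<cdot>\<^sub>m (S * ?A')"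
  proof -
    have "?A' * Q = ?A' + ?A' * P" unfolding Q_def using A' P by (subst mult_add_distrib_mat[of _ c r _ r]) auto
    also have "\<dots> = w \<cdot>\<^sub>m (S * ?A')" unfolding A'P
      by (rule mat_add_minus_cancel[OF A' smult_carrier_mat[OF SA]])
    finally show ?thesis .
  qed
  have trQ: "tr Q = of_nat r + w * tr S - of_nat c"
    unfolding Q_def using P by (simp add: tr_add[of _ r] tr_one trP)
  define R where "R = four_block_mat ((1 / z) \<cdot>\<^sub>m Q) (A * S) (S * ?A') (z \<cdot>\<^sub>m S)"
  have R: "R \<in> carrier_mat (r + c) (r + c)" unfolding R_def using Q S by simp
  have ASA: "A * (S * ?A') = P" unfolding P_def using A S A' by (rule assoc_mult_mat[symmetric])
  have K: "z \<cdot>\<^sub>m 1\<^sub>m (r + c) - dilation A = four_block_mat (z \<cdot>\<^sub>m 1\<^sub>m r) (- A) (- ?A') (z \<cdot>\<^sub>m 1\<^sub>m c)"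
    using A by (intro eq_matI) (auto simp: dilation_def)
  have "(z \<cdot>\<^sub>m 1\<^sub>m (r + c) - dilation A) * R = four_block_mat
      ((z \<cdot>\<^sub>m 1\<^sub>m r) * ((1 / z) \<cdot>\<^sub>m Q) + (- A) * (S * ?A')) ((z \<cdot>\<^sub>m 1\<^sub>m r) * (A * S) + (- A) * (z \<cdot>\<^sub>m S))
      ((- ?A') * ((1 / z) \<cdot>\<^sub>m Q) + (z \<cdot>\<^sub>m 1\<^sub>m c) * (S * ?A')) ((- ?A') * (A * S) + (z \<cdot>\<^sub>m 1\<^sub>m c) * (z \<cdot>\<^sub>m S))"
    unfolding K R_def by (rule mult_four_block_mat) (use A A' S Q AS SA in auto)
  also have "(z \<cdot>\<^sub>m 1\<^sub>m r) * ((1 / z) \<cdot>\<^sub>m Q) + (- A) * (S * ?A') = 1\<^sub>m r"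
    unfolding scalar_mult_mat[OF smult_carrier_mat[OF Q]] uminus_mult_mat[OF A SA] ASA Q_def
    using P z0 by (intro eq_matI) auto
  also have "(z \<cdot>\<^sub>m 1\<^sub>m r) * (A * S) + (- A) * (z \<cdot>\<^sub>m S) = 0\<^sub>m r c"
    unfolding scalar_mult_mat[OF AS] uminus_mult_mat[OF A smult_carrier_mat[OF S]] mult_smult_distrib[OF A S]
    using carrier_matD[OF A] carrier_matD[OF S] by (intro eq_matI) (simp_all del: index_mult_mat(1))
  also have "(- ?A') * ((1 / z) \<cdot>\<^sub>m Q) + (z \<cdot>\<^sub>m 1\<^sub>m c) * (S * ?A') = 0\<^sub>m c r"
    unfolding scalar_mult_mat[OF SA] uminus_mult_mat[OF A' smult_carrier_mat[OF Q]] mult_smult_distrib[OF A' Q] A'Q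
    using carrier_matD[OF A] carrier_matD[OF S] z0
    by (intro eq_matI) (simp_all del: index_mult_mat(1) add: w_def power2_eq_square)
  also have "(- ?A') * (A * S) + (z \<cdot>\<^sub>m 1\<^sub>m c) * (z \<cdot>\<^sub>m S) = 1\<^sub>m c"
  proof -
    have "?A' * (A * S) = G * S" unfolding G_def using A' A S by (rule assoc_mult_mat[symmetric])
    thus ?thesis unfolding scalar_mult_mat[OF smult_carrier_mat[OF S]] uminus_mult_mat[OF A' AS]
      using S by (intro eq_matI) (auto simp: GS w_def power2_eq_square)
  qed
  also have "four_block_mat (1\<^sub>m r) (0\<^sub>m r c) (0\<^sub>m c r) (1\<^sub>m c) = 1\<^sub>m (r + c)" by (rule four_block_one_mat)
  finally have "resolvent (dilation A) z = R" by (intro resolvent_unique[OF _ R]) (use A in auto)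
  hence "rtr (dilation A) z = 1 / z * tr Q + z * tr S"
    unfolding R_def using Q S AS SA by (simp add: tr_four_block[of _ r _ c] tr_smult[of _ r] tr_smult[of _ c])
  thus "rtr (dilation A) z = 2 * z * rtr (mat_adjoint A * A) (z\<^sup>2) + (of_nat r - of_nat c) / z"
    unfolding trQ S_def[symmetric] G_def[symmetric] w_def[symmetric]
    using z0 by (simp add: w_def power2_eq_square field_simps)
  have AA: "A * ?A' \<in> carrier_mat r r" using A A' by (rule mult_carrier_mat)
  have "(w \<cdot>\<^sub>m 1\<^sub>m r - A * ?A') * ((1 / w) \<cdot>\<^sub>m Q) = (1 / w) \<cdot>\<^sub>m (w \<cdot>\<^sub>m Q - A * (?A' * Q))"
  proof -
    have "(w \<cdot>\<^sub>m 1\<^sub>m r - A * ?A') * Q = w \<cdot>\<^sub>m Q - A * (?A' * Q)"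
      using A A' Q AA by (subst minus_mult_distrib_mat[of _ r r _ _ r]) (auto simp: assoc_mult_mat[of _ r c _ r _ r])
    thus ?thesis using Q AA by (subst mult_smult_distrib[of _ r r _ r]) auto
  qed
  also have "A * (?A' * Q) = w \<cdot>\<^sub>m P" unfolding A'Q using A SA by (simp add: mult_smult_distrib[of _ r c _ r] ASA)
  also have "(1 / w) \<cdot>\<^sub>m (w \<cdot>\<^sub>m Q - w \<cdot>\<^sub>m P) = 1\<^sub>m r"
    unfolding Q_def using P w0 by (intro eq_matI) (auto simp: field_simps)
  finally have "resolvent (A * ?A') w = (1 / w) \<cdot>\<^sub>m Q"
    using AA Q by (intro resolvent_unique[of _ r]) auto
  thus "rtr (A * mat_adjoint A) (z\<^sup>2) = rtr (mat_adjoint A * A) (z\<^sup>2) + (of_nat r - of_nat c) / z\<^sup>2"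
    unfolding w_def[symmetric] S_def[symmetric] G_def[symmetric]
    using Q w0 by (simp add: tr_smult[of _ r] trQ field_simps)
qed

lemma tr_resolvent_gram:
  assumes A: "A \<in> carrier_mat r c" and z: "Im (z\<^sup>2) \<noteq> 0"
  shows "rtr (gram A) (z\<^sup>2) = (rtr (dilation A) z - of_nat (max r c - min r c) / z) / (2 * z)"
proof -
  have z0: "z \<noteq> 0" using z by auto
  show ?thesis
  proof (cases "c \<le> r")
    case True
    hence "gram A = mat_adjoint A * A" using A by (simp add: gram_def)
    thus ?thesis using True z0 unfolding tr_resolvent_dilation[OF A z]
      by (simp add: of_nat_diff field_simps)
  next
    case False
    hence g: "gram A = A * mat_adjoint A" using A by (simp add: gram_def)
    have "T + (of_nat r - of_nat c) / z\<^sup>2 = (2 * z * T + (of_nat r - of_nat c) / z - (of_nat c - of_nat r) / z) / (2 * z)"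
      for T using z0 by (simp add: field_simps power2_eq_square)
    thus ?thesis using False unfolding tr_resolvent_dilation[OF A z] g tr_resolvent_mult_adjoint[OF A z]
      by (simp add: of_nat_diff)
  qed
qed

section \<open>Uniqueness of Fourier coefficients\<close>

lemma kind_sequence_scalar:
  "kind_sequence {()} (\<lambda>_. 1) 1 (\<lambda>_. ()) (\<lambda>_. 0) 1 (\<lambda>n _. n) (\<lambda>n. n) (\<lambda>n _. ()) (\<lambda>n i. i)"
proof
  show "indexes 1 (\<lambda>_. ()) (\<lambda>_. 0) {()} (\<lambda>_. 1)"
    unfolding indexes_def bij_betw_def by (auto simp: inj_on_def)
  show "\<forall>\<^sub>F n in sequentially. indexes n (\<lambda>_. ()) (\<lambda>i. i) {()} (\<lambda>_. n)"
    by (rule always_eventually) (auto simp: indexes_def bij_betw_def inj_on_def)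
  show "(\<lambda>n. real n / real n) \<longlonglongrightarrow> real 1 / real 1" for L :: unit
    by (rule tendsto_eventually) (auto intro!: eventually_sequentiallyI[of 1])
qed auto

text \<open>The Toeplitz matrices of \<open>h\<close> vanish, so their normalised resolvent traces at \<open>\<i>\<close> are
  \<open>1 / \<i>\<close>. By \<open>resolvent_limit\<close> this is the mean of \<open>1 / (\<i> - h \<theta>)\<close>, whose
  imaginary part says that \<open>1 / (1 + (h \<theta>)\<^sup>2)\<close> has mean \<open>1\<close>.\<close>

lemma fourier_uniqueness_real:
  fixes h :: "real \<Rightarrow> real"
  assumes h: "integrable circ_measure (\<lambda>\<theta>. complex_of_real (h \<theta>))" and zero: "\<And>l. fcoef (\<lambda>\<theta>. of_real (h \<theta>)) l = 0"
  shows "AE \<theta> in circ_measure. h \<theta> = 0"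
proof -
  interpret kind_sequence "{()}" "\<lambda>_. 1" 1 "\<lambda>_. ()" "\<lambda>_. 0" 1 "\<lambda>n _. n" "\<lambda>n. n" "\<lambda>n _. ()" "\<lambda>n i. i"
    by (rule kind_sequence_scalar)
  let ?h = "\<lambda>(_::unit) (_::unit) \<theta>. complex_of_real (h \<theta>)"
  have lim: "(\<lambda>n. rtr (T ?h n) \<i> / of_nat n) \<longlonglongrightarrow> mean (\<lambda>\<theta>. rtr (symb ?h \<theta>) \<i>) / of_nat 1"
    by (rule resolvent_limit) (use h in auto)
  have res: "rtr (x \<cdot>\<^sub>m 1\<^sub>m n) \<i> = of_nat n / (\<i> - x)" if "\<i> - x \<noteq> 0" for x n
  proof -
    have "resolvent (x \<cdot>\<^sub>m 1\<^sub>m n) \<i> = (1 / (\<i> - x)) \<cdot>\<^sub>m 1\<^sub>m n"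
    proof (rule resolvent_unique[of _ n])
      have "\<i> \<cdot>\<^sub>m 1\<^sub>m n - x \<cdot>\<^sub>m 1\<^sub>m n = (\<i> - x) \<cdot>\<^sub>m 1\<^sub>m n" by (intro eq_matI) auto
      thus "(\<i> \<cdot>\<^sub>m 1\<^sub>m n - x \<cdot>\<^sub>m 1\<^sub>m n) * ((1 / (\<i> - x)) \<cdot>\<^sub>m 1\<^sub>m n) = 1\<^sub>m n"
        using that by (simp add: mult_smult_assoc_mat[of _ n n _ n]) (intro eq_matI, auto)
    qed auto
    thus ?thesis by (simp add: tr_smult[of _ n] tr_one)
  qed
  have "T ?h n = 0 \<cdot>\<^sub>m 1\<^sub>m n" for n
    unfolding T_def toeplitz_mat_def by (intro eq_matI) (auto simp: zero)
  hence "rtr (T ?h n) \<i> = of_nat n / \<i>" for n using res[of 0 n] by simp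
  hence "\<forall>\<^sub>F n in sequentially. rtr (T ?h n) \<i> / of_nat n = 1 / \<i>"
    by (auto intro!: eventually_sequentiallyI[of 1])
  hence "(\<lambda>n. rtr (T ?h n) \<i> / of_nat n) \<longlonglongrightarrow> 1 / \<i>" by (rule tendsto_eventually)
  with lim have m: "mean (\<lambda>\<theta>. rtr (symb ?h \<theta>) \<i>) = 1 / \<i>" using LIMSEQ_unique by fastforce
  have "symb ?h \<theta> = of_real (h \<theta>) \<cdot>\<^sub>m 1\<^sub>m 1" for \<theta>
    unfolding symb_def symbol_mat_def by (intro eq_matI) auto
  moreover have ne: "\<i> - complex_of_real x \<noteq> 0" for x by (simp add: complex_eq_iff)
  ultimately have s: "rtr (symb ?h \<theta>) \<i> = 1 / (\<i> - of_real (h \<theta>))" for \<theta>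
    using res[of "of_real (h \<theta>)" 1] by simp
  have int: "integrable circ_measure (\<lambda>\<theta>. 1 / (\<i> - complex_of_real (h \<theta>)))"
    using tr_symb_integrable[of ?h \<i>] h unfolding s by simp
  have im: "Im (1 / (\<i> - complex_of_real x)) = - (1 / (1 + x\<^sup>2))" for x
    by (simp add: Im_divide power2_eq_square)
  have "(LINT \<theta>|circ_measure. 1 / (\<i> - complex_of_real (h \<theta>))) = 2 * of_real pi / \<i>"
    using m unfolding s mean_def set_integral_circ by (simp add: field_simps)
  hence "Im (LINT \<theta>|circ_measure. 1 / (\<i> - complex_of_real (h \<theta>))) = - 2 * pi" by simp
  hence I: "(LINT \<theta>|circ_measure. 1 / (1 + (h \<theta>)\<^sup>2)) = 2 * pi"
    using integral_Im[OF int] unfolding im by simp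
  have int': "integrable circ_measure (\<lambda>\<theta>. 1 / (1 + (h \<theta>)\<^sup>2))"
    using integrable_Im[OF int] unfolding im by simp
  have one: "integrable circ_measure (\<lambda>\<theta>. 1 :: real)" by (rule circ_bounded_integrable[of _ 1]) auto
  have "(LINT \<theta>|circ_measure. 1 - 1 / (1 + (h \<theta>)\<^sup>2)) = 0"
    unfolding Bochner_Integration.integral_diff[OF one int'] I by (simp add: measure_restrict_space)
  moreover have pos: "1 + x\<^sup>2 > 0" for x :: real by (simp add: add_pos_nonneg)
  have "0 \<le> 1 - 1 / (1 + x\<^sup>2)" for x :: real using pos[of x] by (simp add: field_simps)
  ultimately have "AE \<theta> in circ_measure. 1 - 1 / (1 + (h \<theta>)\<^sup>2) = 0"
    using integral_nonneg_eq_0_iff_AE[OF Bochner_Integration.integrable_diff[OF one int']] by simp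
  thus ?thesis
  proof eventually_elim
    case (elim \<theta>)
    thus ?case using pos[of "h \<theta>"] by (simp add: field_simps)
  qed
qed

lemma fourier_uniqueness:
  assumes f: "integrable circ_measure f" and zero: "\<And>l. fcoef f l = 0"
  shows "AE \<theta> in circ_measure. f \<theta> = 0"
proof -
  have c: "fcoef (\<lambda>\<theta>. cnj (f \<theta>)) l = 0" for l using fcoef_cnj[OF f] zero by simp
  have ic: "integrable circ_measure (\<lambda>\<theta>. cnj (f \<theta>))" using f by simp
  have lin: "fcoef (\<lambda>\<theta>. a * f \<theta> + b * cnj (f \<theta>)) l = 0" for a b l
  proof -
    have "fcoef (\<lambda>\<theta>. a * f \<theta> + b * cnj (f \<theta>)) l = mean (\<lambda>\<theta>. a * (f \<theta> * cis (- of_int l * \<theta>)) + b * (cnj (f \<theta>) * cis (- of_int l * \<theta>)))"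
      unfolding fcoef_def distrib_right mult.assoc ..
    also have "\<dots> = mean (\<lambda>\<theta>. a * (f \<theta> * cis (- of_int l * \<theta>))) + mean (\<lambda>\<theta>. b * (cnj (f \<theta>) * cis (- of_int l * \<theta>)))"
      by (rule mean_add; unfold set_integrable_circ; intro integrable_mult_right integrable_mult_cis f ic)
    also have "\<dots> = a * fcoef f l + b * fcoef (\<lambda>\<theta>. cnj (f \<theta>)) l"
      unfolding fcoef_def mean_cmult ..
    finally show ?thesis by (simp add: zero c)
  qed
  have re: "complex_of_real (Re (f \<theta>)) = 1 / 2 * f \<theta> + 1 / 2 * cnj (f \<theta>)" for \<theta>
    by (simp add: complex_eq_iff)
  have im: "complex_of_real (Im (f \<theta>)) = - \<i> / 2 * f \<theta> + \<i> / 2 * cnj (f \<theta>)" for \<theta>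
    by (simp add: complex_eq_iff)
  have "AE \<theta> in circ_measure. Re (f \<theta>) = 0"
    by (rule fourier_uniqueness_real) (use f in \<open>simp, simp only: re lin\<close>)
  moreover have "AE \<theta> in circ_measure. Im (f \<theta>) = 0"
    by (rule fourier_uniqueness_real) (use f in \<open>simp, simp only: im lin\<close>)
  ultimately show ?thesis by eventually_elim (simp add: complex_eq_iff)
qed

section \<open>Indices of block matrices\<close>

lemma block_index_bounds:
  assumes "i < sum r {..<\<nu>}"
  shows "block_index r i < \<nu>" "sum r {..<block_index r i} \<le> i" "i < sum r {..<block_index r i} + r (block_index r i)"
proof -
  obtain \<mu> where \<mu>: "\<nu> = Suc \<mu>" using assms by (cases \<nu>) auto
  have ex: "i < sum r {..\<mu>}" using assms by (simp add: \<mu> lessThan_Suc_atMost)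
  show "block_index r i < \<nu>" unfolding block_index_def \<mu> using Least_le[of "\<lambda>b. i < sum r {..b}", OF ex] by simp
  have "i < sum r {..block_index r i}" unfolding block_index_def by (rule LeastI[of _ \<mu>]) (rule ex)
  thus "i < sum r {..<block_index r i} + r (block_index r i)"
    by (simp add: lessThan_Suc_atMost[symmetric])
  show "sum r {..<block_index r i} \<le> i"
  proof (cases "block_index r i")
    case (Suc b)
    hence "\<not> i < sum r {..b}" unfolding block_index_def using not_less_Least[of b "\<lambda>b. i < sum r {..b}"] by simp
    thus ?thesis using Suc by (simp add: lessThan_Suc_atMost)
  qed simp
qed

text \<open>For blocks of sizes \<open>e * ns j\<close>, the index \<open>i\<close> is decoded into the position inside its
  block and further into the kind (the block and the residue modulo \<open>e\<close>) and the position of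
  a coefficient of size \<open>e\<close>.\<close>

definition block_offset :: "nat \<Rightarrow> (nat \<Rightarrow> nat) \<Rightarrow> nat \<Rightarrow> nat" where
  "block_offset e ns i = i - sum (\<lambda>j. e * ns j) {..<block_index (\<lambda>j. e * ns j) i}"

definition block_kind :: "nat \<Rightarrow> (nat \<Rightarrow> nat) \<Rightarrow> nat \<Rightarrow> nat \<times> nat" where
  "block_kind e ns i = (block_index (\<lambda>j. e * ns j) i, block_offset e ns i mod e)"

definition block_pos :: "nat \<Rightarrow> (nat \<Rightarrow> nat) \<Rightarrow> nat \<Rightarrow> nat" where
  "block_pos e ns i = block_offset e ns i div e"

lemma block_offset_less:
  assumes "i < e * sum ns {..<\<nu>}"
  shows "fst (block_kind e ns i) < \<nu>" "block_offset e ns i < e * ns (fst (block_kind e ns i))"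
  using block_index_bounds[of i "\<lambda>j. e * ns j" \<nu>] assms
  by (auto simp: block_kind_def block_offset_def sum_distrib_left)

text \<open>The decoding is injective into a set with as many elements as there are indices.\<close>

lemma block_indexes:
  assumes e: "e > 0"
  shows "indexes (e * sum ns {..<\<nu>}) (block_kind e ns) (block_pos e ns) ({..<\<nu>} \<times> {..<e}) (\<lambda>L. ns (fst L))"
proof -
  let ?d = "e * sum ns {..<\<nu>}" and ?f = "\<lambda>i. (block_kind e ns i, block_pos e ns i)"
    and ?B = "SIGMA L:{..<\<nu>} \<times> {..<e}. {..<ns (fst L)}"
  have inj: "inj_on ?f {..<?d}"
  proof (rule inj_onI)
    fix i j assume ij: "i \<in> {..<?d}" "j \<in> {..<?d}" "?f i = ?f j"
    have "block_offset e ns i mod e = block_offset e ns j mod e" "block_offset e ns i div e = block_offset e ns j div e"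
      using ij(3) by (simp_all add: block_kind_def block_pos_def)
    hence o: "block_offset e ns i = block_offset e ns j" by (metis div_mult_mod_eq)
    have b: "block_index (\<lambda>j. e * ns j) i = block_index (\<lambda>j. e * ns j) j" using ij(3) by (simp add: block_kind_def)
    show "i = j"
      using o b block_index_bounds(2)[of i "\<lambda>j. e * ns j" \<nu>] block_index_bounds(2)[of j "\<lambda>j. e * ns j" \<nu>] ij
      unfolding block_offset_def by (auto simp: sum_distrib_left)
  qed
  have sub: "?f ` {..<?d} \<subseteq> ?B"
  proof (rule image_subsetI)
    fix i assume "i \<in> {..<?d}"
    hence i: "i < ?d" by simp
    have "block_offset e ns i div e < ns (fst (block_kind e ns i))"
      using block_offset_less(2)[OF i] e by (simp add: less_mult_imp_div_less mult.commute)
    thus "?f i \<in> ?B" using block_offset_less(1)[OF i] e by (auto simp: block_kind_def block_pos_def)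
  qed
  have "card ?B = (\<Sum>L\<in>{..<\<nu>} \<times> {..<e}. ns (fst L))" by simp
  also have "\<dots> = (\<Sum>j<\<nu>. \<Sum>a<e. ns j)"
    unfolding sum.cartesian_product by (intro sum.cong) auto
  also have "\<dots> = ?d" by (simp add: sum_distrib_left)
  finally have "card ?B = card (?f ` {..<?d})" using card_image[OF inj] by simp
  hence "?f ` {..<?d} = ?B" using sub by (intro card_subset_eq) auto
  with inj show ?thesis unfolding indexes_def bij_betw_def by blast
qed

lemma indexes_Plus:
  assumes 1: "indexes r \<kappa>1 \<pi>1 K1 n1" and 2: "indexes c \<kappa>2 \<pi>2 K2 n2"
  shows "indexes (r + c) (\<lambda>i. if i < r then Inl (\<kappa>1 i) else Inr (\<kappa>2 (i - r))) (\<lambda>i. if i < r then \<pi>1 i else \<pi>2 (i - r))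
    (K1 <+> K2) (case_sum n1 n2)"
  unfolding indexes_def
proof (rule bij_betw_imageI)
  let ?\<kappa> = "\<lambda>i. if i < r then Inl (\<kappa>1 i) else Inr (\<kappa>2 (i - r))" and ?\<pi> = "\<lambda>i. if i < r then \<pi>1 i else \<pi>2 (i - r)"
  show "inj_on (\<lambda>i. (?\<kappa> i, ?\<pi> i)) {..<r + c}"
  proof (rule inj_onI)
    fix i j assume ij: "i \<in> {..<r + c}" "j \<in> {..<r + c}" "(?\<kappa> i, ?\<pi> i) = (?\<kappa> j, ?\<pi> j)"
    have same: "i < r \<longleftrightarrow> j < r" using ij(3) by (auto split: if_splits)
    show "i = j"
    proof (cases "i < r")
      case True
      thus ?thesis using same ij indexes_inj[OF 1, of i j] by auto
    next
      case False
      hence "i - r < c" "j - r < c" "\<kappa>2 (i - r) = \<kappa>2 (j - r)" "\<pi>2 (i - r) = \<pi>2 (j - r)"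
        using same ij by auto
      hence "i - r = j - r" by (rule indexes_inj[OF 2])
      thus ?thesis using False same by simp
    qed
  qed
  show "(\<lambda>i. (?\<kappa> i, ?\<pi> i)) ` {..<r + c} = (SIGMA L:K1 <+> K2. {..<case_sum n1 n2 L})"
  proof (intro equalityI subsetI)
    fix x assume "x \<in> (\<lambda>i. (?\<kappa> i, ?\<pi> i)) ` {..<r + c}"
    then obtain i where i: "i < r + c" "x = (?\<kappa> i, ?\<pi> i)" by auto
    show "x \<in> (SIGMA L:K1 <+> K2. {..<case_sum n1 n2 L})"
    proof (cases "i < r")
      case True
      thus ?thesis using i indexes_kind[OF 1, of i] indexes_pos[OF 1, of i] by auto
    next
      case False
      hence "i - r < c" using i by simp
      thus ?thesis using i False indexes_kind[OF 2, of "i - r"] indexes_pos[OF 2, of "i - r"] by auto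
    qed
  next
    fix x assume x: "x \<in> (SIGMA L:K1 <+> K2. {..<case_sum n1 n2 L})"
    then obtain L p where Lp: "x = (L, p)" "L \<in> K1 <+> K2" "p < case_sum n1 n2 L" by auto
    show "x \<in> (\<lambda>i. (?\<kappa> i, ?\<pi> i)) ` {..<r + c}"
    proof (cases L)
      case (Inl L1)
      then obtain i where "i < r" "\<kappa>1 i = L1" "\<pi>1 i = p" using indexes_surj[OF 1, of L1 p] Lp by auto
      thus ?thesis using Lp Inl by (intro image_eqI[of _ _ i]) auto
    next
      case (Inr L2)
      then obtain i where "i < c" "\<kappa>2 i = L2" "\<pi>2 i = p" using indexes_surj[OF 2, of L2 p] Lp by auto
      thus ?thesis using Lp Inr by (intro image_eqI[of _ _ "r + i"]) auto
    qed
  qed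
qed

lemma fourier_coeff_index:
  assumes "a < s" "b < t"
  shows "fourier_coeff s t f l $$ (a, b) = fcoef (\<lambda>\<theta>. f \<theta> $$ (a, b)) l"
proof -
  have "exp (- \<i> * of_int l * of_real \<theta>) = cis (- of_int l * \<theta>)" for \<theta>
    by (simp add: cis_conv_exp mult.assoc)
  thus ?thesis using assms unfolding fourier_coeff_def fcoef_def mean_def by simp
qed

lemma block_toeplitz_dim:
  "block_toeplitz s t \<nu> ns f \<in> carrier_mat (s * sum ns {..<\<nu>}) (t * sum ns {..<\<nu>})"
  unfolding block_toeplitz_def block_mat_def by (simp add: sum_distrib_left)

lemma block_toeplitz_index:
  assumes s: "s > 0" and t: "t > 0" and i: "i < s * sum ns {..<\<nu>}" and j: "j < t * sum ns {..<\<nu>}"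
    and L: "block_kind s ns i = (a, x)" "block_kind t ns j = (b, y)"
  shows "block_toeplitz s t \<nu> ns f $$ (i, j)
    = fcoef (\<lambda>\<theta>. f a b \<theta> $$ (x, y)) (int (block_pos s ns i) - int (block_pos t ns j))"
proof -
  have ij: "i < sum (\<lambda>j. s * ns j) {..<\<nu>}" "j < sum (\<lambda>j. t * ns j) {..<\<nu>}"
    using i j by (simp_all add: sum_distrib_left)
  have o: "block_offset s ns i < s * ns a" "block_offset t ns j < t * ns b"
    using block_offset_less(2)[OF i] block_offset_less(2)[OF j] L by simp_all
  have "block_toeplitz s t \<nu> ns f $$ (i, j) = toeplitz s t (ns a) (ns b) (f a b) $$ (block_offset s ns i, block_offset t ns j)"
    unfolding block_toeplitz_def block_mat_def index_mat(1)[OF ij] block_offset_def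
    using L by (simp add: Let_def block_kind_def)
  also have "\<dots> = fourier_coeff s t (f a b) (int (block_pos s ns i) - int (block_pos t ns j)) $$ (x, y)"
    using o L by (simp add: toeplitz_def block_pos_def block_kind_def)
  also have "\<dots> = fcoef (\<lambda>\<theta>. f a b \<theta> $$ (x, y)) (int (block_pos s ns i) - int (block_pos t ns j))"
    using L s t by (intro fourier_coeff_index) (auto simp: block_kind_def)
  finally show ?thesis .
qed

lemma F_symbol_dim: "F_symbol s t \<nu> ms f \<theta> \<in> carrier_mat (s * sum ms {..<\<nu>}) (t * sum ms {..<\<nu>})"
  unfolding F_symbol_def block_mat_def by (simp add: sum_distrib_left)

lemma kron_one_index:
  assumes f: "M \<in> carrier_mat s t" and ij: "i < n * s" "j < n * t"
  shows "kron (1\<^sub>m n) M $$ (i, j) = (if i div s = j div t then M $$ (i mod s, j mod t) else 0)"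
proof -
  have "i div s < n" "j div t < n" using ij by (simp_all add: less_mult_imp_div_less)
  thus ?thesis using f ij by (auto simp: kron_def)
qed

text \<open>The padding with zero rows or columns in the off-diagonal blocks is what the condition on
  the slots says: a slot number beyond the smaller of \<open>ms a\<close> and \<open>ms b\<close> occurs on one side
  only.\<close>

lemma E_block_index:
  assumes f: "f a b \<theta> \<in> carrier_mat s t" and s: "s > 0" and t: "t > 0" and i: "i < s * ms a" and j: "j < t * ms b"
  shows "E_block s t ms f a b \<theta> $$ (i, j) = (if i div s = j div t then f a b \<theta> $$ (i mod s, j mod t) else 0)"
proof -
  have d: "i div s < ms a" "j div t < ms b" using i j by (simp_all add: less_mult_imp_div_less mult.commute)
  have k: "dim_row (kron (1\<^sub>m n) (f a b \<theta>)) = n * s" "dim_col (kron (1\<^sub>m n) (f a b \<theta>)) = n * t" for n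
    using f by (auto simp: kron_def)
  consider "a = b" | "a \<noteq> b" "ms a \<le> ms b" | "a \<noteq> b" "ms b < ms a" by linarith
  thus ?thesis
  proof cases
    case 1
    thus ?thesis using f i j by (simp add: E_block_def kron_one_index mult.commute)
  next
    case 2
    show ?thesis
    proof (cases "j < ms a * t")
      case True
      thus ?thesis using 2 f i j by (simp add: E_block_def append_cols_def k kron_one_index mult.commute)
    next
      case False
      hence "j div t \<ge> ms a" using t by (simp add: less_eq_div_iff_mult_less_eq)
      moreover have "j - ms a * t < t * (ms b - ms a)" using False j by (simp add: right_diff_distrib' mult.commute)
      ultimately show ?thesis using 2 f i j d False by (simp add: E_block_def append_cols_def k mult.commute)
    qed
  next
    case 3
    show ?thesis
    proof (cases "i < ms b * s")
      case True
      thus ?thesis using 3 f i j by (simp add: E_block_def append_rows_def k kron_one_index mult.commute)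
    next
      case False
      hence "i div s \<ge> ms b" using s by (simp add: less_eq_div_iff_mult_less_eq)
      moreover have "i - ms b * s < s * (ms a - ms b)" using False i by (simp add: right_diff_distrib' mult.commute)
      ultimately show ?thesis using 3 f i j d False by (simp add: E_block_def append_rows_def k mult.commute)
    qed
  qed
qed

lemma F_symbol_index:
  assumes s: "s > 0" and t: "t > 0" and i: "i < s * sum ms {..<\<nu>}" and j: "j < t * sum ms {..<\<nu>}"
    and L: "block_kind s ms i = (a, x)" "block_kind t ms j = (b, y)" and f: "f a b \<theta> \<in> carrier_mat s t"
  shows "F_symbol s t \<nu> ms f \<theta> $$ (i, j) = (if block_pos s ms i = block_pos t ms j then f a b \<theta> $$ (x, y) else 0)"
proof -
  have ij: "i < sum (\<lambda>j. s * ms j) {..<\<nu>}" "j < sum (\<lambda>j. t * ms j) {..<\<nu>}"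
    using i j by (simp_all add: sum_distrib_left)
  have o: "block_offset s ms i < s * ms a" "block_offset t ms j < t * ms b"
    using block_offset_less(2)[OF i] block_offset_less(2)[OF j] L by simp_all
  have "F_symbol s t \<nu> ms f \<theta> $$ (i, j) = E_block s t ms f a b \<theta> $$ (block_offset s ms i, block_offset t ms j)"
    unfolding F_symbol_def block_mat_def index_mat(1)[OF ij] block_offset_def
    using L by (simp add: Let_def block_kind_def)
  also have "\<dots> = (if block_pos s ms i = block_pos t ms j then f a b \<theta> $$ (x, y) else 0)"
    unfolding E_block_index[of f, OF f s t o] using L by (simp add: block_pos_def block_kind_def)
  finally show ?thesis .
qed

section \<open>Spectra and means\<close>

text \<open>The Lebesgue measure is complete. This is needed because in the Hermitian case the symbol
  is known only almost everywhere.\<close>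

lemma circ_measurable_AE:
  fixes f g :: "real \<Rightarrow> complex"
  assumes f: "f \<in> borel_measurable circ_measure" and eq: "AE \<theta> in circ_measure. f \<theta> = g \<theta>"
  shows "g \<in> borel_measurable circ_measure"
proof -
  let ?r = "\<lambda>f \<theta>. if \<theta> \<in> {-pi..pi} then f \<theta> else (0 :: complex)"
  have "?r f \<in> borel_measurable lebesgue" using f by (subst borel_measurable_if) auto
  moreover have "AE \<theta> in lebesgue. ?r f \<theta> = ?r g \<theta>"
    using eq by (subst (asm) AE_restrict_space_iff) (auto elim: eventually_mono)
  ultimately have "?r g \<in> borel_measurable lebesgue" by (rule borel_measurable_AE)
  thus ?thesis by (subst (asm) borel_measurable_if) auto
qed

lemma mean_AE:
  assumes f: "integrable circ_measure f" and eq: "AE \<theta> in circ_measure. f \<theta> = g \<theta>"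
  shows "mean f = mean g"
  unfolding mean_def set_integral_circ
  using integral_cong_AE[OF borel_measurable_integrable[OF f] circ_measurable_AE[OF borel_measurable_integrable[OF f] eq] eq] by simp

lemma mean_cong:
  assumes "\<And>\<theta>. \<theta> \<in> {-pi..pi} \<Longrightarrow> f \<theta> = g \<theta>"
  shows "mean f = mean g"
  unfolding mean_def set_integral_circ using assms
  by (intro arg_cong2[of _ _ _ _ "(*)"] refl Bochner_Integration.integral_cong) auto

lemma measure_circ: "measure lebesgue {-pi..pi} = 2 * pi"
  by simp

lemma mean_eq: "1 / of_real (measure lebesgue {-pi..pi}) * (LINT \<theta>:{-pi..pi}|lebesgue. g \<theta>) = mean g"
  unfolding mean_def measure_circ by simp

lemma mat_vec_index_sum:
  assumes "X \<in> carrier_mat r c" "v \<in> carrier_vec c" "i < r"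
  shows "vec_index (X *\<^sub>v v) i = (\<Sum>j<c. X $$ (i, j) * vec_index v j)"
  using assms by (auto simp: scalar_prod_def lessThan_atLeast0 intro!: sum.cong)

lemma adjoint_mult_eigvals_nonneg:
  assumes A: "A \<in> carrier_mat r c" and x: "x \<in># eigvals (mat_adjoint A * A)"
  shows "Re x \<ge> 0"
proof -
  let ?G = "mat_adjoint A * A"
  have A': "mat_adjoint A \<in> carrier_mat c r" using A by simp
  have G: "?G \<in> carrier_mat c c" using A' A by (rule mult_carrier_mat)
  have "char_poly ?G \<noteq> 0" using degree_monic_char_poly[OF G] by auto
  hence "poly (char_poly ?G) x = 0" using x by (simp add: eigvals_def)
  hence "eigenvalue ?G x" using eigenvalue_root_char_poly[OF G] by simp
  then obtain v where v: "v \<in> carrier_vec c" "v \<noteq> 0\<^sub>v c" "?G *\<^sub>v v = x \<cdot>\<^sub>v v"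
    using G unfolding eigenvalue_def eigenvector_def by auto
  define V where "V = (\<lambda>i. vec_index v i)"
  define u where "u = (\<lambda>k. \<Sum>j<c. A $$ (k, j) * V j)"
  have Gv: "x * V i = (\<Sum>k<r. cnj (A $$ (k, i)) * u k)" if i: "i < c" for i
  proof -
    have "x * V i = vec_index (?G *\<^sub>v v) i" unfolding v(3) V_def using v(1) i by simp
    also have "\<dots> = (\<Sum>j<c. ?G $$ (i, j) * V j)"
      unfolding V_def by (rule mat_vec_index_sum[OF G v(1) i])
    also have "\<dots> = (\<Sum>j<c. \<Sum>k<r. cnj (A $$ (k, i)) * (A $$ (k, j) * V j))"
      using i A by (intro sum.cong refl, subst mat_mult_index_sum[OF A' A]) (auto simp: sum_distrib_right mult.assoc)
    also have "\<dots> = (\<Sum>k<r. cnj (A $$ (k, i)) * u k)"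
      unfolding u_def sum_distrib_left by (rule sum.swap)
    finally show ?thesis .
  qed
  have "x * complex_of_real ((enorm c V)\<^sup>2) = (\<Sum>i<c. cnj (V i) * (x * V i))"
    unfolding enorm_square sum_distrib_left by (intro sum.cong refl) (simp only: mult.left_commute)
  also have "\<dots> = (\<Sum>i<c. \<Sum>k<r. cnj (V i) * (cnj (A $$ (k, i)) * u k))"
    by (intro sum.cong refl) (simp add: Gv sum_distrib_left)
  also have "\<dots> = (\<Sum>k<r. cnj (u k) * u k)"
  proof (subst sum.swap, intro sum.cong refl)
    fix k
    show "(\<Sum>i<c. cnj (V i) * (cnj (A $$ (k, i)) * u k)) = cnj (u k) * u k"
      unfolding u_def cnj_sum sum_distrib_right by (intro sum.cong refl) (simp add: mult_ac)
  qed
  also have "\<dots> = complex_of_real ((enorm r u)\<^sup>2)" by (rule enorm_square[symmetric])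
  finally have "Re (x * complex_of_real ((enorm c V)\<^sup>2)) = Re (complex_of_real ((enorm r u)\<^sup>2))" by (rule arg_cong)
  hence e: "Re x * (enorm c V)\<^sup>2 = (enorm r u)\<^sup>2" by (simp del: of_real_power)
  have "enorm c V \<noteq> 0"
  proof
    assume "enorm c V = 0"
    hence "\<forall>i<c. V i = 0" by (simp add: L2_set_eq_0_iff)
    hence "v = 0\<^sub>v c" using v(1) unfolding V_def by (intro eq_vecI) auto
    with v(2) show False by simp
  qed
  hence "(enorm c V)\<^sup>2 > 0" by simp
  thus ?thesis using e zero_le_power2[of "enorm r u"] by (metis linorder_not_less mult_less_0_iff not_less_iff_gr_or_eq)
qed

lemma gram_eigvals_nonneg:
  assumes "x \<in># eigvals (gram A)"
  shows "Re x \<ge> 0"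
  using assms adjoint_mult_eigvals_nonneg[of A "dim_row A" "dim_col A" x] adjoint_mult_eigvals_nonneg[of "mat_adjoint A" "dim_col A" "dim_row A" x]
  by (auto simp: gram_def mat_adjoint_adjoint split: if_splits)

text \<open>Test functions live on the real line; for a Hermitian matrix, taking real parts loses
  nothing.\<close>

definition real_spectrum :: "complex mat \<Rightarrow> real multiset" where
  "real_spectrum X = image_mset Re (eigvals X)"

lemma size_real_spectrum: "X \<in> carrier_mat d d \<Longrightarrow> size (real_spectrum X) = d"
  by (simp add: real_spectrum_def size_eigvals)

lemma real_spectrum_resolvent:
  assumes "X \<in> carrier_mat d d" "hermitian_mat X" "Im z \<noteq> 0"
  shows "(\<Sum>x\<in>#real_spectrum X. 1 / (z - of_real x)) = rtr X z"
proof -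
  have "(\<Sum>x\<in>#real_spectrum X. 1 / (z - of_real x)) = (\<Sum>x\<in>#eigvals X. 1 / (z - of_real (Re x)))"
    by (simp add: real_spectrum_def image_mset.compositionality o_def)
  also have "\<dots> = (\<Sum>x\<in>#eigvals X. 1 / (z - x))"
  proof (intro arg_cong[of _ _ sum_mset] image_mset_cong)
    fix x assume "x \<in># eigvals X"
    hence "of_real (Re x) = x" using eigvals_hermitian_real[OF assms(1,2)] by (simp add: complex_eq_iff)
    thus "1 / (z - of_real (Re x)) = 1 / (z - x)" by simp
  qed
  also have "\<dots> = rtr X z" by (rule eigvals_resolvent_sum[OF assms])
  finally show ?thesis .
qed

lemma real_spectrum_eigvals:
  assumes "X \<in> carrier_mat d d" "hermitian_mat X"
  shows "(\<Sum>x\<in>#real_spectrum X. \<Phi> (of_real x)) = (\<Sum>x\<in>#eigvals X. \<Phi> x :: complex)"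
proof -
  have "(\<Sum>x\<in>#real_spectrum X. \<Phi> (of_real x)) = (\<Sum>x\<in>#eigvals X. \<Phi> (of_real (Re x)))"
    by (simp add: real_spectrum_def image_mset.compositionality o_def)
  also have "\<dots> = (\<Sum>x\<in>#eigvals X. \<Phi> x)"
    using eigvals_hermitian_real[OF assms]
    by (intro arg_cong[of _ _ sum_mset] image_mset_cong arg_cong[of _ _ \<Phi>]) (auto simp: complex_eq_iff)
  finally show ?thesis .
qed

text \<open>The absolute value makes the test function continuous on the whole line; it does not
  change the sum, since Gram matrices have no negative eigenvalues.\<close>

lemma real_spectrum_singvals:
  "(\<Sum>x\<in>#real_spectrum (gram A). \<Phi> (sqrt \<bar>x\<bar>)) = (\<Sum>x\<in>#singvals A. \<Phi> x :: complex)"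
proof -
  have "(\<Sum>x\<in>#singvals A. \<Phi> x) = (\<Sum>x\<in>#eigvals (gram A). \<Phi> (sqrt (Re x)))"
    by (simp add: singvals_def gram_def image_mset.compositionality o_def)
  also have "\<dots> = (\<Sum>x\<in>#eigvals (gram A). \<Phi> (sqrt \<bar>Re x\<bar>))"
    using gram_eigvals_nonneg[of _ A] by (intro arg_cong[of _ _ sum_mset] image_mset_cong) auto
  finally show ?thesis by (simp add: real_spectrum_def image_mset.compositionality o_def)
qed

section \<open>Block Toeplitz sequences\<close>

locale block_toeplitz_sequence =
  fixes s t \<nu> m :: nat and f :: "nat \<Rightarrow> nat \<Rightarrow> real \<Rightarrow> complex mat" and N :: "nat \<Rightarrow> nat \<Rightarrow> nat" and ms :: "nat \<Rightarrow> nat"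
  assumes s: "s > 0" and t: "t > 0" and \<nu>: "\<nu> > 0" and m: "m > 0"
    and L1: "\<And>i j. i < \<nu> \<Longrightarrow> j < \<nu> \<Longrightarrow> L1_mat s t (f i j)"
    and sumN: "\<And>n. n \<ge> \<nu> \<Longrightarrow> sum (N n) {..<\<nu>} = n"
    and ratio: "\<And>j. j < \<nu> \<Longrightarrow> (\<lambda>n. real (N n j) / real n) \<longlonglongrightarrow> real (ms j) / real m"
    and ms_pos: "\<And>j. j < \<nu> \<Longrightarrow> ms j > 0"
    and sum_ms: "sum ms {..<\<nu>} = m"
begin

abbreviation "A n \<equiv> block_toeplitz s t \<nu> (N n) f"
abbreviation "F \<equiv> F_symbol s t \<nu> ms f"

definition entry :: "nat \<times> nat \<Rightarrow> nat \<times> nat \<Rightarrow> real \<Rightarrow> complex" where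
  "entry L M \<theta> = f (fst L) (fst M) \<theta> $$ (snd L, snd M)"

lemma entry_integrable:
  "L \<in> {..<\<nu>} \<times> {..<s} \<Longrightarrow> M \<in> {..<\<nu>} \<times> {..<t} \<Longrightarrow> integrable circ_measure (entry L M)"
  using L1[of "fst L" "fst M"] unfolding L1_mat_def entry_def[abs_def] set_integrable_circ by auto

lemma f_carrier: "a < \<nu> \<Longrightarrow> b < \<nu> \<Longrightarrow> \<theta> \<in> {-pi..pi} \<Longrightarrow> f a b \<theta> \<in> carrier_mat s t"
  using L1[of a b] by (simp add: L1_mat_def)

lemma A_carrier: "A n \<in> carrier_mat (s * sum (N n) {..<\<nu>}) (t * sum (N n) {..<\<nu>})"
  by (rule block_toeplitz_dim)

lemma A_index:
  assumes "i < s * sum (N n) {..<\<nu>}" "j < t * sum (N n) {..<\<nu>}"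
  shows "A n $$ (i, j) = fcoef (entry (block_kind s (N n) i) (block_kind t (N n) j)) (int (block_pos s (N n) i) - int (block_pos t (N n) j))"
  unfolding entry_def[abs_def] by (rule block_toeplitz_index[OF s t assms]) simp_all

lemma F_carrier: "F \<theta> \<in> carrier_mat (s * m) (t * m)"
  using F_symbol_dim[of s t \<nu> ms f \<theta>] by (simp add: sum_ms)

lemma F_index:
  assumes i: "i < s * m" and j: "j < t * m" and \<theta>: "\<theta> \<in> {-pi..pi}"
  shows "F \<theta> $$ (i, j) = (if block_pos s ms i = block_pos t ms j then entry (block_kind s ms i) (block_kind t ms j) \<theta> else 0)"
proof -
  have ij: "i < s * sum ms {..<\<nu>}" "j < t * sum ms {..<\<nu>}" using i j by (simp_all add: sum_ms)
  show ?thesis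
    unfolding entry_def
    by (rule F_symbol_index[OF s t ij]) (use block_offset_less(1)[OF ij(1)] block_offset_less(1)[OF ij(2)] \<theta> in \<open>auto intro: f_carrier\<close>)
qed

lemma row_indexes: "indexes (s * sum ns {..<\<nu>}) (block_kind s ns) (block_pos s ns) ({..<\<nu>} \<times> {..<s}) (\<lambda>L. ns (fst L))"
  and col_indexes: "indexes (t * sum ns {..<\<nu>}) (block_kind t ns) (block_pos t ns) ({..<\<nu>} \<times> {..<t}) (\<lambda>L. ns (fst L))"
  using block_indexes s t by auto

lemma F_measurable: "measurable_mat (s * m) (t * m) {-pi..pi} F"
  unfolding measurable_mat_def
proof (intro conjI ballI allI impI F_carrier)
  fix i j assume ij: "i < s * m" "j < t * m"
  have K: "block_kind s ms i \<in> {..<\<nu>} \<times> {..<s}" "block_kind t ms j \<in> {..<\<nu>} \<times> {..<t}"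
    using indexes_kind[OF row_indexes[of ms], of i] indexes_kind[OF col_indexes[of ms], of j] ij by (simp_all add: sum_ms)
  have "(\<lambda>\<theta>. F \<theta> $$ (i, j)) \<in> borel_measurable circ_measure \<longleftrightarrow>
    (\<lambda>\<theta>. if block_pos s ms i = block_pos t ms j then entry (block_kind s ms i) (block_kind t ms j) \<theta> else 0) \<in> borel_measurable circ_measure"
    by (intro measurable_cong) (simp add: F_index ij)
  thus "(\<lambda>\<theta>. F \<theta> $$ (i, j)) \<in> borel_measurable circ_measure"
    using borel_measurable_integrable[OF entry_integrable[OF K]] by simp
qed

abbreviation "kinds \<equiv> ({..<\<nu>} \<times> {..<s}) <+> ({..<\<nu>} \<times> {..<t})"

text \<open>The index maps of the dilation: the row indices of the matrix, followed by its column
  indices.\<close>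

definition dil_kind :: "(nat \<Rightarrow> nat) \<Rightarrow> nat \<Rightarrow> (nat \<times> nat) + (nat \<times> nat)" where
  "dil_kind ns i = (if i < s * sum ns {..<\<nu>} then Inl (block_kind s ns i) else Inr (block_kind t ns (i - s * sum ns {..<\<nu>})))"

definition dil_pos :: "(nat \<Rightarrow> nat) \<Rightarrow> nat \<Rightarrow> nat" where
  "dil_pos ns i = (if i < s * sum ns {..<\<nu>} then block_pos s ns i else block_pos t ns (i - s * sum ns {..<\<nu>}))"

fun dil_symbol :: "(nat \<times> nat) + (nat \<times> nat) \<Rightarrow> (nat \<times> nat) + (nat \<times> nat) \<Rightarrow> real \<Rightarrow> complex" where
  "dil_symbol (Inl L) (Inr M) \<theta> = entry L M \<theta>"
| "dil_symbol (Inr M) (Inl L) \<theta> = cnj (entry L M \<theta>)"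
| "dil_symbol (Inl L) (Inl L') \<theta> = 0"
| "dil_symbol (Inr M) (Inr M') \<theta> = 0"

lemma dil_indexes:
  "indexes (s * sum ns {..<\<nu>} + t * sum ns {..<\<nu>}) (dil_kind ns) (dil_pos ns) kinds (case_sum (\<lambda>L. ns (fst L)) (\<lambda>L. ns (fst L)))"
  unfolding dil_kind_def[abs_def] dil_pos_def[abs_def] by (rule indexes_Plus[OF row_indexes col_indexes])

sublocale dil: kind_sequence kinds "case_sum (\<lambda>L. ms (fst L)) (\<lambda>L. ms (fst L))" "s * sum ms {..<\<nu>} + t * sum ms {..<\<nu>}"
  "dil_kind ms" "dil_pos ms" m "\<lambda>n. case_sum (\<lambda>L. N n (fst L)) (\<lambda>L. N n (fst L))"
  "\<lambda>n. s * sum (N n) {..<\<nu>} + t * sum (N n) {..<\<nu>}" "\<lambda>n. dil_kind (N n)" "\<lambda>n. dil_pos (N n)"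
proof
  show "kinds \<noteq> {}" using s \<nu> by auto
  show "indexes (s * sum ms {..<\<nu>} + t * sum ms {..<\<nu>}) (dil_kind ms) (dil_pos ms) kinds (case_sum (\<lambda>L. ms (fst L)) (\<lambda>L. ms (fst L)))"
    by (rule dil_indexes)
  show "\<forall>\<^sub>F n in sequentially. indexes (s * sum (N n) {..<\<nu>} + t * sum (N n) {..<\<nu>}) (dil_kind (N n)) (dil_pos (N n)) kinds
      (case_sum (\<lambda>L. N n (fst L)) (\<lambda>L. N n (fst L)))"
    by (rule always_eventually) (blast intro: dil_indexes)
  show "(\<lambda>n. real (case_sum (\<lambda>L. N n (fst L)) (\<lambda>L. N n (fst L)) L) / real n)
      \<longlonglongrightarrow> real (case_sum (\<lambda>L. ms (fst L)) (\<lambda>L. ms (fst L)) L) / real m" if "L \<in> kinds" for L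
    using that by (auto intro!: ratio)
qed (use m ms_pos in auto)

lemma dil_herm: "dil.herm dil_symbol"
proof (intro ballI allI)
  fix L L' :: "(nat \<times> nat) + (nat \<times> nat)" and \<theta>
  show "dil_symbol L L' \<theta> = cnj (dil_symbol L' L \<theta>)" by (cases L; cases L') auto
qed

lemma dil_symbol_eqs:
  "dil_symbol (Inl L) (Inr M) = entry L M" "dil_symbol (Inr M) (Inl L) = (\<lambda>\<theta>. cnj (entry L M \<theta>))"
  "dil_symbol (Inl L) (Inl L') = (\<lambda>_. 0)" "dil_symbol (Inr M) (Inr M') = (\<lambda>_. 0)"
  by (rule ext, simp)+

lemma dil_integrable:
  assumes "L \<in> kinds" "L' \<in> kinds" shows "integrable circ_measure (dil_symbol L L')"
  using assms by (cases L; cases L') (auto simp: dil_symbol_eqs intro!: entry_integrable)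

lemma dil_T: "dil.T dil_symbol n = dilation (A n)"
proof (rule eq_matI)
  let ?r = "s * sum (N n) {..<\<nu>}" and ?c = "t * sum (N n) {..<\<nu>}"
  have d: "dim_row (A n) = ?r" "dim_col (A n) = ?c" using A_carrier[of n] by auto
  fix i j assume "i < dim_row (dilation (A n))" "j < dim_col (dilation (A n))"
  hence ij: "i < ?r + ?c" "j < ?r + ?c" using d by (simp_all add: dilation_def)
  have l: "dil.T dil_symbol n $$ (i, j) = fcoef (dil_symbol (dil_kind (N n) i) (dil_kind (N n) j)) (int (dil_pos (N n) i) - int (dil_pos (N n) j))"
    using ij by (simp add: dil.T_def toeplitz_mat_def)
  consider "i < ?r" "j < ?r" | "i < ?r" "\<not> j < ?r" | "\<not> i < ?r" "j < ?r" | "\<not> i < ?r" "\<not> j < ?r" by blast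
  thus "dil.T dil_symbol n $$ (i, j) = dilation (A n) $$ (i, j)"
  proof cases
    case 1
    thus ?thesis unfolding l using ij d by (simp add: dilation_def dil_kind_def dil_symbol_eqs fcoef_zero)
  next
    case 2
    hence "j - ?r < ?c" using ij by simp
    thus ?thesis unfolding l using 2 ij d A_index[of i n "j - ?r"] by (simp add: dilation_def dil_kind_def dil_pos_def dil_symbol_eqs)
  next
    case 3
    hence i: "i - ?r < ?c" using ij by simp
    have K: "block_kind s (N n) j \<in> {..<\<nu>} \<times> {..<s}" "block_kind t (N n) (i - ?r) \<in> {..<\<nu>} \<times> {..<t}"
      using indexes_kind[OF row_indexes[of "N n"], of j] indexes_kind[OF col_indexes[of "N n"], of "i - ?r"] 3 i by auto
    show ?thesis unfolding l using i 3 ij d A_index[of j n "i - ?r"] fcoef_cnj[OF entry_integrable[OF K]]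
      by (simp add: dilation_def dil_kind_def dil_pos_def dil_symbol_eqs)
  next
    case 4
    thus ?thesis unfolding l using ij d by (simp add: dilation_def dil_kind_def dil_symbol_eqs fcoef_zero)
  qed
qed (use A_carrier[of n] in \<open>auto simp: dil.T_def toeplitz_mat_def dilation_def\<close>)

lemma dil_symb:
  assumes \<theta>: "\<theta> \<in> {-pi..pi}"
  shows "dil.symb dil_symbol \<theta> = dilation (F \<theta>)"
proof (rule eq_matI)
  have d: "dim_row (F \<theta>) = s * m" "dim_col (F \<theta>) = t * m" using F_carrier[of \<theta>] by auto
  fix i j assume "i < dim_row (dilation (F \<theta>))" "j < dim_col (dilation (F \<theta>))"
  hence ij: "i < s * m + t * m" "j < s * m + t * m" using d by (simp_all add: dilation_def)
  have l: "dil.symb dil_symbol \<theta> $$ (i, j) = (if dil_pos ms i = dil_pos ms j then dil_symbol (dil_kind ms i) (dil_kind ms j) \<theta> else 0)"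
    unfolding dil.symb_def symbol_mat_def using ij by (simp add: sum_ms)
  consider "i < s * m" "j < s * m" | "i < s * m" "\<not> j < s * m" | "\<not> i < s * m" "j < s * m" | "\<not> i < s * m" "\<not> j < s * m" by blast
  thus "dil.symb dil_symbol \<theta> $$ (i, j) = dilation (F \<theta>) $$ (i, j)"
  proof cases
    case 1
    thus ?thesis unfolding l using ij d by (simp add: dilation_def dil_kind_def sum_ms)
  next
    case 2
    hence "j - s * m < t * m" using ij by simp
    thus ?thesis unfolding l using 2 ij d F_index[of i "j - s * m", OF _ _ \<theta>] by (simp add: dilation_def dil_kind_def dil_pos_def sum_ms)
  next
    case 3
    hence "i - s * m < t * m" using ij by simp
    thus ?thesis unfolding l using 3 ij d F_index[of j "i - s * m", OF _ _ \<theta>] by (auto simp: dilation_def dil_kind_def dil_pos_def sum_ms)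
  next
    case 4
    thus ?thesis unfolding l using ij d by (simp add: dilation_def dil_kind_def sum_ms)
  qed
qed (unfold dil.symb_def symbol_mat_def dilation_def, use F_carrier[of \<theta>] in \<open>auto simp: sum_ms\<close>)

lemma gram_integrable:
  assumes w: "Im w \<noteq> 0"
  shows "integrable circ_measure (\<lambda>\<theta>. rtr (gram (F \<theta>)) w)"
proof -
  define z where "z = csqrt w"
  have zw: "z\<^sup>2 = w" by (simp add: z_def)
  have z: "Im z \<noteq> 0" using w unfolding zw[symmetric] by (auto simp: power2_eq_square)
  have "integrable circ_measure (\<lambda>\<theta>. rtr (gram (F \<theta>)) w) \<longleftrightarrow>
     integrable circ_measure (\<lambda>\<theta>. (rtr (dil.symb dil_symbol \<theta>) z - of_nat (max (s * m) (t * m) - min (s * m) (t * m)) / z) / (2 * z))"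
    using tr_resolvent_gram[OF F_carrier, of z] w
    by (intro Bochner_Integration.integrable_cong) (auto simp: dil_symb zw)
  moreover have "integrable circ_measure (\<lambda>\<theta>. rtr (dil.symb dil_symbol \<theta>) z)"
    by (rule dil.tr_symb_integrable[OF dil_herm dil_integrable z])
  moreover have "integrable circ_measure (\<lambda>\<theta>. c)" for c :: complex by (rule circ_bounded_integrable[of _ "cmod c"]) auto
  ultimately show ?thesis by (simp del: of_nat_diff)
qed

text \<open>A square root \<open>z\<close> of \<open>w\<close> lies off the real axis. The resolvent trace of the Gram matrix at
  \<open>w\<close> is an affine function of that of the dilation at \<open>z\<close>; after normalisation its
  coefficients are the same for \<open>A n\<close> and for the symbol, so the limit carries over.\<close>

lemma gram_limit:
  assumes w: "Im w \<noteq> 0"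
  shows "(\<lambda>n. 1 / of_nat (min (s * n) (t * n)) * rtr (gram (A n)) w)
    \<longlonglongrightarrow> mean (\<lambda>\<theta>. 1 / of_nat (min (s * m) (t * m)) * rtr (gram (F \<theta>)) w)"
proof -
  define z where "z = csqrt w"
  have zw: "z\<^sup>2 = w" by (simp add: z_def)
  have z: "Im z \<noteq> 0" using w unfolding zw[symmetric] by (auto simp: power2_eq_square)
  hence z0: "z \<noteq> 0" by auto
  define \<mu> where "\<mu> = min s t"
  define \<delta> where "\<delta> = max s t - min s t"
  have \<mu>: "\<mu> > 0" using s t by (simp add: \<mu>_def)
  have mn: "min (s * n) (t * n) = \<mu> * n" "max (s * n) (t * n) - min (s * n) (t * n) = \<delta> * n" for n
    unfolding \<mu>_def \<delta>_def by (simp_all add: nat_mult_min_left nat_mult_max_left diff_mult_distrib)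
  have g: "rtr (gram X) w = (rtr (dilation X) z - of_nat (\<delta> * n) / z) / (2 * z)"
    if "X \<in> carrier_mat (s * n) (t * n)" for X n
    using tr_resolvent_gram[OF that, of z] w unfolding zw mn(2) by simp
  have "(\<lambda>n. (rtr (dil.T dil_symbol n) z / of_nat n - of_nat \<delta> / z) / (2 * z * of_nat \<mu>))
     \<longlonglongrightarrow> (mean (\<lambda>\<theta>. rtr (dil.symb dil_symbol \<theta>) z) / of_nat m - of_nat \<delta> / z) / (2 * z * of_nat \<mu>)"
    using z0 \<mu> by (intro tendsto_intros dil.resolvent_limit dil_herm dil_integrable z) auto
  moreover have "\<forall>\<^sub>F n in sequentially. (rtr (dil.T dil_symbol n) z / of_nat n - of_nat \<delta> / z) / (2 * z * of_nat \<mu>)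
      = 1 / of_nat (min (s * n) (t * n)) * rtr (gram (A n)) w"
  proof (rule eventually_sequentiallyI)
    fix n assume n: "n \<ge> \<nu>"
    hence n0: "n > 0" using \<nu> by simp
    have An: "A n \<in> carrier_mat (s * n) (t * n)" using A_carrier[of n] by (simp add: sumN[OF n])
    show "(rtr (dil.T dil_symbol n) z / of_nat n - of_nat \<delta> / z) / (2 * z * of_nat \<mu>)
      = 1 / of_nat (min (s * n) (t * n)) * rtr (gram (A n)) w"
      unfolding g[OF An] mn dil_T using n0 z0 \<mu> by (simp add: field_simps)
  qed
  ultimately have lim: "(\<lambda>n. 1 / of_nat (min (s * n) (t * n)) * rtr (gram (A n)) w)
     \<longlonglongrightarrow> (mean (\<lambda>\<theta>. rtr (dil.symb dil_symbol \<theta>) z) / of_nat m - of_nat \<delta> / z) / (2 * z * of_nat \<mu>)"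
    by (rule Lim_transform_eventually)
  define \<alpha> where "\<alpha> = 1 / (2 * z * of_nat \<mu> * of_nat m)"
  define b where "b = - of_nat \<delta> / (2 * z * of_nat \<mu> * z)"
  have "mean (\<lambda>\<theta>. 1 / of_nat (min (s * m) (t * m)) * rtr (gram (F \<theta>)) w)
      = mean (\<lambda>\<theta>. \<alpha> * rtr (dil.symb dil_symbol \<theta>) z + b)"
    by (rule mean_cong) (simp add: g[OF F_carrier] mn dil_symb \<alpha>_def b_def, use z0 \<mu> m in \<open>simp add: field_simps\<close>)
  also have "\<dots> = mean (\<lambda>\<theta>. \<alpha> * rtr (dil.symb dil_symbol \<theta>) z) + mean (\<lambda>\<theta>. b)"
  proof (rule mean_add; unfold set_integrable_circ)
    show "integrable circ_measure (\<lambda>\<theta>. \<alpha> * rtr (dil.symb dil_symbol \<theta>) z)"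
      by (rule integrable_mult_right[OF dil.tr_symb_integrable[OF dil_herm dil_integrable z]])
    show "integrable circ_measure (\<lambda>\<theta>. b)" by (rule circ_bounded_integrable[of _ "cmod b"]) auto
  qed
  also have "\<dots> = (mean (\<lambda>\<theta>. rtr (dil.symb dil_symbol \<theta>) z) / of_nat m - of_nat \<delta> / z) / (2 * z * of_nat \<mu>)"
    unfolding mean_cmult mean_const \<alpha>_def b_def using z0 \<mu> m by (simp add: field_simps)
  finally show ?thesis using lim by simp
qed

text \<open>The singular values are square roots of eigenvalues \<open>y\<close> of the Gram matrix, so the test
  function is \<open>\<Phi>\<close> after the square root. For \<open>y < 0\<close> the root leaves the half line on
  which \<open>\<Phi>\<close> is continuous, so the even extension is used there.\<close>

lemma singular_distr: "singular_value_distr (s * m) (t * m) A {-pi..pi} F"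
  unfolding singular_value_distr_def
proof (intro conjI allI impI)
  show "0 < s * m" "0 < t * m" using s t m by auto
  show "{-pi..pi} \<in> lmeasurable" by simp
  show "0 < measure lebesgue {-pi..pi}" by simp
  show "measurable_mat (s * m) (t * m) {-pi..pi} F" by (rule F_measurable)
  have dims: "dim_row (A n) = s * n" "dim_col (A n) = t * n" if "n \<ge> \<nu>" for n
    using A_carrier[of n] sumN[OF that] by auto
  show "filterlim (\<lambda>n. min (dim_row (A n)) (dim_col (A n))) sequentially sequentially"
  proof (rule filterlim_at_top_mono[OF filterlim_ident], rule eventually_sequentiallyI)
    fix n assume "n \<ge> \<nu>"
    thus "n \<le> min (dim_row (A n)) (dim_col (A n))" using s t by (simp add: dims)
  qed
  fix \<Phi> :: "real \<Rightarrow> complex"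
  assume \<Phi>: "continuous_on {0..} \<Phi> \<and> compact (closure {x \<in> {0..}. \<Phi> x \<noteq> 0})"
  define \<phi> where "\<phi> = (\<lambda>y. \<Phi> (sqrt \<bar>y\<bar>))"
  have "continuous_on UNIV \<phi>"
    unfolding \<phi>_def by (rule continuous_on_compose2[OF conjunct1[OF \<Phi>]]) (auto intro!: continuous_intros)
  moreover obtain R where "\<forall>x\<in>closure {x \<in> {0..}. \<Phi> x \<noteq> 0}. norm x \<le> R"
    using compact_imp_bounded[OF conjunct2[OF \<Phi>]] unfolding bounded_iff ..
  hence R: "norm x \<le> R" if "x \<in> closure {x \<in> {0..}. \<Phi> x \<noteq> 0}" for x using that by (rule bspec)
  have "\<phi> y = 0" if y: "\<bar>y\<bar> > R\<^sup>2" for y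
  proof (rule ccontr)
    assume "\<phi> y \<noteq> 0"
    hence "sqrt \<bar>y\<bar> \<in> {x \<in> {0..}. \<Phi> x \<noteq> 0}" by (simp add: \<phi>_def)
    from R[OF subsetD[OF closure_subset this]] have "sqrt \<bar>y\<bar> \<le> R" by simp
    hence "(sqrt \<bar>y\<bar>)\<^sup>2 \<le> R\<^sup>2" by (intro power_mono) auto
    with y show False by simp
  qed
  ultimately have \<phi>: "res_class \<phi>" by (rule res_class_compact_support)
  have "(\<lambda>n. 1 / of_nat (min (s * n) (t * n)) * (\<Sum>x\<in>#real_spectrum (gram (A n)). \<phi> x))
     \<longlonglongrightarrow> mean (\<lambda>\<theta>. 1 / of_nat (min (s * m) (t * m)) * (\<Sum>x\<in>#real_spectrum (gram (F \<theta>)). \<phi> x))"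
  proof (rule conjunct2[OF distribution_from_resolvents[OF _ _ _ _ _ \<phi>]])
    show "\<forall>\<^sub>F n in sequentially. size (real_spectrum (gram (A n))) = min (s * n) (t * n) \<and> min (s * n) (t * n) > 0"
    proof (rule eventually_sequentiallyI)
      fix n assume n: "n \<ge> \<nu>"
      have "A n \<in> carrier_mat (s * n) (t * n)" using A_carrier[of n] by (simp add: sumN[OF n])
      thus "size (real_spectrum (gram (A n))) = min (s * n) (t * n) \<and> min (s * n) (t * n) > 0"
        using size_real_spectrum[OF gram_carrier] n \<nu> s t by auto
    qed
    show "size (real_spectrum (gram (F \<theta>))) = min (s * m) (t * m)" for \<theta>
      by (rule size_real_spectrum[OF gram_carrier[OF F_carrier]])
    show "min (s * m) (t * m) > 0" using s t m by simp
    fix w :: complex assume w: "Im w \<noteq> 0"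
    have r: "(\<Sum>x\<in>#real_spectrum (gram X). 1 / (w - of_real x)) = rtr (gram X) w" for X
      by (rule real_spectrum_resolvent[OF gram_carrier gram_hermitian w, of _ "dim_row X" "dim_col X"]) simp
    show "integrable circ_measure (\<lambda>\<theta>. \<Sum>x\<in>#real_spectrum (gram (F \<theta>)). 1 / (w - of_real x))"
      unfolding r by (rule gram_integrable[OF w])
    show "(\<lambda>n. 1 / of_nat (min (s * n) (t * n)) * (\<Sum>x\<in>#real_spectrum (gram (A n)). 1 / (w - of_real x)))
       \<longlonglongrightarrow> mean (\<lambda>\<theta>. 1 / of_nat (min (s * m) (t * m)) * (\<Sum>x\<in>#real_spectrum (gram (F \<theta>)). 1 / (w - of_real x)))"
      unfolding r by (rule gram_limit[OF w])
  qed
  hence "(\<lambda>n. 1 / of_nat (min (s * n) (t * n)) * (\<Sum>x\<in>#singvals (A n). \<Phi> x))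
     \<longlonglongrightarrow> mean (\<lambda>\<theta>. 1 / of_nat (min (s * m) (t * m)) * (\<Sum>x\<in>#singvals (F \<theta>). \<Phi> x))"
    unfolding \<phi>_def real_spectrum_singvals .
  moreover have "\<forall>\<^sub>F n in sequentially. 1 / of_nat (min (s * n) (t * n)) * (\<Sum>x\<in>#singvals (A n). \<Phi> x)
     = 1 / of_nat (min (dim_row (A n)) (dim_col (A n))) * (\<Sum>x\<in>#singvals (A n). \<Phi> x)"
    by (rule eventually_sequentiallyI[of \<nu>]) (simp add: dims)
  ultimately show "(\<lambda>n. 1 / of_nat (min (dim_row (A n)) (dim_col (A n))) * (\<Sum>\<sigma>\<in>#singvals (A n). \<Phi> \<sigma>))
      \<longlonglongrightarrow> 1 / of_real (measure lebesgue {-pi..pi}) *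
        (LINT \<theta>:{-pi..pi}|lebesgue. 1 / of_nat (min (s * m) (t * m)) * (\<Sum>\<sigma>\<in>#singvals (F \<theta>). \<Phi> \<sigma>))"
    unfolding mean_eq by (rule Lim_transform_eventually)
qed

end

locale hermitian_block_toeplitz_sequence = block_toeplitz_sequence s s \<nu> m f N ms
  for s \<nu> m f N ms +
  assumes herm: "\<And>n. n \<ge> \<nu> \<Longrightarrow> hermitian_mat (A n)"
begin

abbreviation "index_kinds \<equiv> {..<\<nu>} \<times> {..<s}"

text \<open>The Hermitian part of the symbol. It is Hermitian everywhere, as \<open>resolvent_limit\<close>
  demands, while \<open>f\<close> itself turns out to be so only almost everywhere.\<close>

definition sym_symbol :: "nat \<times> nat \<Rightarrow> nat \<times> nat \<Rightarrow> real \<Rightarrow> complex" where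
  "sym_symbol L M \<theta> = 1 / 2 * (entry L M \<theta> + cnj (entry M L \<theta>))"

sublocale sym: kind_sequence index_kinds "\<lambda>L. ms (fst L)" "s * sum ms {..<\<nu>}" "block_kind s ms" "block_pos s ms" m
  "\<lambda>n L. N n (fst L)" "\<lambda>n. s * sum (N n) {..<\<nu>}" "\<lambda>n. block_kind s (N n)" "\<lambda>n. block_pos s (N n)"
proof
  show "index_kinds \<noteq> {}" using s \<nu> by auto
  show "indexes (s * sum ms {..<\<nu>}) (block_kind s ms) (block_pos s ms) index_kinds (\<lambda>L. ms (fst L))"
    by (rule row_indexes)
  show "\<forall>\<^sub>F n in sequentially. indexes (s * sum (N n) {..<\<nu>}) (block_kind s (N n)) (block_pos s (N n)) index_kinds (\<lambda>L. N n (fst L))"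
    by (rule always_eventually) (blast intro: row_indexes)
  show "(\<lambda>n. real (N n (fst L)) / real n) \<longlonglongrightarrow> real (ms (fst L)) / real m" if "L \<in> index_kinds" for L
    using that by (auto intro!: ratio)
qed (use m ms_pos in auto)

lemma sym_herm: "sym.herm sym_symbol"
  unfolding sym_symbol_def by (simp add: add.commute)

lemma sym_integrable:
  assumes "L \<in> index_kinds" "M \<in> index_kinds" shows "integrable circ_measure (sym_symbol L M)"
  unfolding sym_symbol_def[abs_def]
  by (intro integrable_mult_right Bochner_Integration.integrable_add integrable_cnj entry_integrable assms)

lemma fcoef_sym:
  assumes "L \<in> index_kinds" "M \<in> index_kinds"
  shows "fcoef (sym_symbol L M) l = 1 / 2 * (fcoef (entry L M) l + cnj (fcoef (entry M L) (-l)))"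
proof -
  have i: "integrable circ_measure (entry L M)" "integrable circ_measure (\<lambda>\<theta>. cnj (entry M L \<theta>))"
    using entry_integrable assms by auto
  have "fcoef (sym_symbol L M) l = 1 / 2 * (fcoef (entry L M) l + fcoef (\<lambda>\<theta>. cnj (entry M L \<theta>)) l)"
    unfolding fcoef_def sym_symbol_def mult.assoc distrib_right mean_cmult
    by (subst mean_add) (unfold set_integrable_circ, (rule integrable_mult_cis i refl)+)
  thus ?thesis using fcoef_cnj[OF entry_integrable[OF assms(2,1)]] by simp
qed

lemma N_at_top: "j < \<nu> \<Longrightarrow> filterlim (\<lambda>n. N n j) at_top sequentially"
  using m ms_pos[of j] by (intro at_top_of_positive_ratio[OF ratio]) auto

text \<open>The block sizes tend to infinity, so every Fourier coefficient occurs as an entry of some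
  \<open>A n\<close>.\<close>

lemma fcoef_entry_herm:
  assumes L: "L \<in> index_kinds" and M: "M \<in> index_kinds"
  shows "fcoef (entry L M) l = cnj (fcoef (entry M L) (-l))"
proof -
  have "\<forall>\<^sub>F n in sequentially. N n (fst L) > nat \<bar>l\<bar> \<and> N n (fst M) > nat \<bar>l\<bar> \<and> n \<ge> \<nu>"
    using L M by (intro eventually_conj eventually_ge_at_top eventually_compose_filterlim[OF eventually_gt_at_top N_at_top]) auto
  then obtain n where n: "N n (fst L) > nat \<bar>l\<bar>" "N n (fst M) > nat \<bar>l\<bar>" "n \<ge> \<nu>"
    by (auto simp: eventually_sequentially)
  \<comment> \<open>The positions are chosen with difference \<open>l\<close>.\<close>
  obtain i where i: "i < s * sum (N n) {..<\<nu>}" "block_kind s (N n) i = L" "block_pos s (N n) i = nat (max l 0)"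
    by (rule indexes_surj[OF row_indexes L, of "nat (max l 0)" "N n"]) (use n(1) in auto)
  obtain j where j: "j < s * sum (N n) {..<\<nu>}" "block_kind s (N n) j = M" "block_pos s (N n) j = nat (max (-l) 0)"
    by (rule indexes_surj[OF row_indexes M, of "nat (max (-l) 0)" "N n"]) (use n(2) in auto)
  have e: "int (block_pos s (N n) i) - int (block_pos s (N n) j) = l" "int (block_pos s (N n) j) - int (block_pos s (N n) i) = -l"
    using i j by auto
  have "A n $$ (i, j) = cnj (A n $$ (j, i))"
    by (rule hermitian_matD[OF herm[OF n(3)] A_carrier i(1) j(1)])
  thus ?thesis unfolding A_index[OF i(1) j(1)] A_index[OF j(1) i(1)] e i(2) j(2) .
qed

lemma sym_T: "sym.T sym_symbol n = A n"
proof (rule eq_matI)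
  fix i j assume "i < dim_row (A n)" "j < dim_col (A n)"
  hence ij: "i < s * sum (N n) {..<\<nu>}" "j < s * sum (N n) {..<\<nu>}" using A_carrier[of n] by auto
  have K: "block_kind s (N n) i \<in> index_kinds" "block_kind s (N n) j \<in> index_kinds"
    using indexes_kind[OF row_indexes] ij by auto
  have "sym.T sym_symbol n $$ (i, j) = fcoef (sym_symbol (block_kind s (N n) i) (block_kind s (N n) j)) (int (block_pos s (N n) i) - int (block_pos s (N n) j))"
    using ij by (simp add: sym.T_def toeplitz_mat_def)
  also have "\<dots> = A n $$ (i, j)"
    unfolding fcoef_sym[OF K] fcoef_entry_herm[OF K, symmetric] A_index[OF ij] by simp
  finally show "sym.T sym_symbol n $$ (i, j) = A n $$ (i, j)" .
qed (use A_carrier[of n] in \<open>auto simp: sym.T_def toeplitz_mat_def\<close>)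

lemma sym_symb: "AE \<theta> in circ_measure. sym.symb sym_symbol \<theta> = F \<theta>"
proof -
  have "AE \<theta> in circ_measure. sym_symbol L M \<theta> - entry L M \<theta> = 0" if L: "L \<in> index_kinds" "M \<in> index_kinds" for L M
  proof (rule fourier_uniqueness)
    show "integrable circ_measure (\<lambda>\<theta>. sym_symbol L M \<theta> - entry L M \<theta>)"
      by (intro Bochner_Integration.integrable_diff sym_integrable entry_integrable L)
    show "fcoef (\<lambda>\<theta>. sym_symbol L M \<theta> - entry L M \<theta>) l = 0" for l
      unfolding fcoef_diff[OF sym_integrable[OF L] entry_integrable[OF L], symmetric] fcoef_sym[OF L] fcoef_entry_herm[OF L, symmetric] by simp
  qed
  hence "AE \<theta> in circ_measure. \<forall>x\<in>index_kinds \<times> index_kinds. sym_symbol (fst x) (snd x) \<theta> - entry (fst x) (snd x) \<theta> = 0"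
    by (intro AE_finite_allI) auto
  moreover have "AE \<theta> in circ_measure. \<theta> \<in> {-pi..pi}" by (intro AE_I2) simp
  ultimately show ?thesis
  proof eventually_elim
    case (elim \<theta>)
    show ?case
    proof (rule eq_matI)
      fix i j assume "i < dim_row (F \<theta>)" "j < dim_col (F \<theta>)"
      hence ij: "i < s * m" "j < s * m" using F_carrier[of \<theta>] by auto
      have "block_kind s ms i \<in> index_kinds" "block_kind s ms j \<in> index_kinds"
        using indexes_kind[OF row_indexes[of ms]] ij by (simp_all add: sum_ms)
      hence "sym_symbol (block_kind s ms i) (block_kind s ms j) \<theta> = entry (block_kind s ms i) (block_kind s ms j) \<theta>"
        using elim(1) by force
      thus "sym.symb sym_symbol \<theta> $$ (i, j) = F \<theta> $$ (i, j)"
        unfolding sym.symb_def symbol_mat_def using ij elim(2) by (simp add: sum_ms F_index)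
    qed (unfold sym.symb_def symbol_mat_def, use F_carrier[of \<theta>] in \<open>auto simp: sum_ms\<close>)
  qed
qed

text \<open>The limit is computed for the Hermitian part of the symbol, which has the same matrices;
  at the end it is replaced by \<open>F\<close>, which agrees with it almost everywhere.\<close>

lemma eigenvalue_distr: "eigenvalue_distr (s * m) A {-pi..pi} F"
  unfolding eigenvalue_distr_def
proof (intro conjI allI impI)
  show "0 < s * m" using s m by auto
  show "{-pi..pi} \<in> lmeasurable" by simp
  show "0 < measure lebesgue {-pi..pi}" by simp
  show "measurable_mat (s * m) (s * m) {-pi..pi} F" by (rule F_measurable)
  show "square_mat (A n)" for n using A_carrier[of n] by auto
  have dims: "dim_row (A n) = s * n" if "n \<ge> \<nu>" for n
    using A_carrier[of n] sumN[OF that] by auto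
  show "filterlim (\<lambda>n. dim_row (A n)) sequentially sequentially"
  proof (rule filterlim_at_top_mono[OF filterlim_ident], rule eventually_sequentiallyI)
    fix n assume "n \<ge> \<nu>"
    thus "n \<le> dim_row (A n)" using s by (simp add: dims)
  qed
  fix \<Phi> :: "complex \<Rightarrow> complex"
  assume \<Phi>: "continuous_on UNIV \<Phi> \<and> compact (closure {z. \<Phi> z \<noteq> 0})"
  define \<phi> where "\<phi> = (\<lambda>y :: real. \<Phi> (of_real y))"
  have "continuous_on UNIV \<phi>"
    unfolding \<phi>_def by (rule continuous_on_compose2[OF conjunct1[OF \<Phi>]]) (auto intro!: continuous_intros)
  moreover obtain R where "\<forall>x\<in>closure {z. \<Phi> z \<noteq> 0}. norm x \<le> R"
    using compact_imp_bounded[OF conjunct2[OF \<Phi>]] unfolding bounded_iff ..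
  hence R: "norm x \<le> R" if "x \<in> closure {z. \<Phi> z \<noteq> 0}" for x using that by (rule bspec)
  have "\<phi> y = 0" if y: "\<bar>y\<bar> > R" for y
  proof (rule ccontr)
    assume "\<phi> y \<noteq> 0"
    hence "of_real y \<in> {z. \<Phi> z \<noteq> 0}" by (simp add: \<phi>_def)
    from R[OF subsetD[OF closure_subset this]] y show False by simp
  qed
  ultimately have \<phi>: "res_class \<phi>" by (rule res_class_compact_support)
  let ?F = "sym.symb sym_symbol"
  have F: "?F \<theta> \<in> carrier_mat (s * m) (s * m)" "hermitian_mat (?F \<theta>)" for \<theta>
    using sym.symb_carrier[of sym_symbol \<theta>] sym.symb_herm[OF sym_herm] by (auto simp: sum_ms)
  have *: "integrable circ_measure (\<lambda>\<theta>. \<Sum>x\<in>#real_spectrum (?F \<theta>). \<phi> x) \<and>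
     (\<lambda>n. 1 / of_nat (s * n) * (\<Sum>x\<in>#real_spectrum (A n). \<phi> x))
     \<longlonglongrightarrow> mean (\<lambda>\<theta>. 1 / of_nat (s * m) * (\<Sum>x\<in>#real_spectrum (?F \<theta>). \<phi> x))"
  proof (rule distribution_from_resolvents[OF _ _ _ _ _ \<phi>])
    have An: "A n \<in> carrier_mat (s * n) (s * n)" if "n \<ge> \<nu>" for n using A_carrier[of n] by (simp add: sumN[OF that])
    show "\<forall>\<^sub>F n in sequentially. size (real_spectrum (A n)) = s * n \<and> s * n > 0"
      by (rule eventually_sequentiallyI[of \<nu>]) (use size_real_spectrum[OF An] \<nu> s in auto)
    show "size (real_spectrum (?F \<theta>)) = s * m" for \<theta> by (rule size_real_spectrum[OF F(1)])
    show "s * m > 0" using s m by simp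
    fix w :: complex assume w: "Im w \<noteq> 0"
    have r: "(\<Sum>x\<in>#real_spectrum (?F \<theta>). 1 / (w - of_real x)) = rtr (?F \<theta>) w" for \<theta>
      by (rule real_spectrum_resolvent[OF F w])
    show "integrable circ_measure (\<lambda>\<theta>. \<Sum>x\<in>#real_spectrum (?F \<theta>). 1 / (w - of_real x))"
      unfolding r by (rule sym.tr_symb_integrable[OF sym_herm sym_integrable w])
    have "(\<lambda>n. 1 / of_nat s * (rtr (sym.T sym_symbol n) w / of_nat n))
      \<longlonglongrightarrow> 1 / of_nat s * (mean (\<lambda>\<theta>. rtr (?F \<theta>) w) / of_nat m)"
      by (intro tendsto_mult_left sym.resolvent_limit sym_herm sym_integrable w)
    moreover have "1 / of_nat s * (mean (\<lambda>\<theta>. rtr (?F \<theta>) w) / of_nat m) = mean (\<lambda>\<theta>. 1 / of_nat (s * m) * rtr (?F \<theta>) w)"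
      unfolding mean_cmult by simp
    moreover have "\<forall>\<^sub>F n in sequentially. 1 / of_nat s * (rtr (sym.T sym_symbol n) w / of_nat n)
       = 1 / of_nat (s * n) * (\<Sum>x\<in>#real_spectrum (A n). 1 / (w - of_real x))"
      by (rule eventually_sequentiallyI[of \<nu>]) (simp add: real_spectrum_resolvent[OF An herm w] sym_T)
    ultimately show "(\<lambda>n. 1 / of_nat (s * n) * (\<Sum>x\<in>#real_spectrum (A n). 1 / (w - of_real x)))
       \<longlonglongrightarrow> mean (\<lambda>\<theta>. 1 / of_nat (s * m) * (\<Sum>x\<in>#real_spectrum (?F \<theta>). 1 / (w - of_real x)))"
      unfolding r using Lim_transform_eventually by simp
  qed
  have "mean (\<lambda>\<theta>. 1 / of_nat (s * m) * (\<Sum>x\<in>#real_spectrum (?F \<theta>). \<phi> x))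
      = mean (\<lambda>\<theta>. 1 / of_nat (s * m) * (\<Sum>x\<in>#eigvals (F \<theta>). \<Phi> x))"
  proof (rule mean_AE)
    show "integrable circ_measure (\<lambda>\<theta>. 1 / of_nat (s * m) * (\<Sum>x\<in>#real_spectrum (?F \<theta>). \<phi> x))"
      by (rule integrable_mult_right[OF conjunct1[OF *]])
    show "AE \<theta> in circ_measure. 1 / of_nat (s * m) * (\<Sum>x\<in>#real_spectrum (?F \<theta>). \<phi> x) = 1 / of_nat (s * m) * (\<Sum>x\<in>#eigvals (F \<theta>). \<Phi> x)"
      using sym_symb
    proof eventually_elim
      case (elim \<theta>)
      have "(\<Sum>x\<in>#real_spectrum (?F \<theta>). \<Phi> (of_real x)) = (\<Sum>x\<in>#eigvals (?F \<theta>). \<Phi> x)"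
        by (rule real_spectrum_eigvals[OF F])
      thus ?case unfolding \<phi>_def elim by simp
    qed
  qed
  with conjunct2[OF *] have "(\<lambda>n. 1 / of_nat (s * n) * (\<Sum>x\<in>#real_spectrum (A n). \<phi> x))
     \<longlonglongrightarrow> mean (\<lambda>\<theta>. 1 / of_nat (s * m) * (\<Sum>x\<in>#eigvals (F \<theta>). \<Phi> x))" by simp
  moreover have "\<forall>\<^sub>F n in sequentially. 1 / of_nat (s * n) * (\<Sum>x\<in>#real_spectrum (A n). \<phi> x)
     = 1 / of_nat (dim_row (A n)) * (\<Sum>x\<in>#eigvals (A n). \<Phi> x)"
  proof (rule eventually_sequentiallyI)
    fix n assume n: "n \<ge> \<nu>"
    show "1 / of_nat (s * n) * (\<Sum>x\<in>#real_spectrum (A n). \<phi> x) = 1 / of_nat (dim_row (A n)) * (\<Sum>x\<in>#eigvals (A n). \<Phi> x)"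
      unfolding \<phi>_def real_spectrum_eigvals[OF A_carrier herm[OF n]] dims[OF n] ..
  qed
  ultimately show "(\<lambda>n. 1 / of_nat (dim_row (A n)) * (\<Sum>z\<in>#eigvals (A n). \<Phi> z))
      \<longlonglongrightarrow> 1 / of_real (measure lebesgue {-pi..pi}) *
        (LINT \<theta>:{-pi..pi}|lebesgue. 1 / of_nat (s * m) * (\<Sum>z\<in>#eigvals (F \<theta>). \<Phi> z))"
    unfolding mean_eq by (rule Lim_transform_eventually)
qed

end

theorem theorem3p10:
  fixes s t \<nu> m :: nat
    and f :: "nat \<Rightarrow> nat \<Rightarrow> real \<Rightarrow> complex mat"
    and N :: "nat \<Rightarrow> nat \<Rightarrow> nat"
    and c :: "nat \<Rightarrow> real"
    and \<alpha> \<beta> ms :: "nat \<Rightarrow> nat"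
  assumes "s \<ge> 1" and "t \<ge> 1" and "\<nu> \<ge> 2"
    and "\<And>i j. i < \<nu> \<Longrightarrow> j < \<nu> \<Longrightarrow> L1_mat s t (f i j)"
    and "\<And>n j. n \<ge> \<nu> \<Longrightarrow> j < \<nu> \<Longrightarrow> N n j > 0"
    and "\<And>n. n \<ge> \<nu> \<Longrightarrow> n = (\<Sum>j<\<nu>. N n j)"
    and "\<And>j. j < \<nu> \<Longrightarrow> (\<lambda>n. real (N n j) / real n) \<longlonglongrightarrow> c j"
    and "\<And>j. j < \<nu> \<Longrightarrow> c j \<in> {0<..<1}"
    and "(\<Sum>j<\<nu>. c j) = 1"
    and "\<And>j. j < \<nu> \<Longrightarrow> \<alpha> j > 0 \<and> \<beta> j > 0 \<and> c j = real (\<alpha> j) / real (\<beta> j)"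
    and "m = Lcm (\<beta> ` {..<\<nu>})"
    and "\<And>j. j < \<nu> \<Longrightarrow> ms j > 0 \<and> c j = real (ms j) / real m"
  shows "singular_value_distr (s * m) (t * m)
           (\<lambda>n. block_toeplitz s t \<nu> (N n) f) {-pi..pi} (F_symbol s t \<nu> ms f) \<and>
         ((\<forall>n\<ge>\<nu>. hermitian_mat (block_toeplitz s t \<nu> (N n) f)) \<longrightarrow>
           eigenvalue_distr (s * m)
             (\<lambda>n. block_toeplitz s t \<nu> (N n) f) {-pi..pi} (F_symbol s t \<nu> ms f))"
proof -
  have c: "c j = real (ms j) / real m" "ms j > 0" if "j < \<nu>" for j using assms(12)[OF that] by auto
  \<comment> \<open>For \<open>m = 0\<close> the quotients, and with them all \<open>c j\<close>, would be \<open>0\<close>.\<close>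
  have m: "m > 0"
  proof (rule ccontr)
    assume "\<not> m > 0"
    hence "c 0 = 0" using c(1)[of 0] assms(3) by simp
    thus False using assms(8)[of 0] assms(3) by simp
  qed
  have "real (sum ms {..<\<nu>}) / real m = (\<Sum>j<\<nu>. c j)" by (simp add: c(1) sum_divide_distrib)
  hence "real (sum ms {..<\<nu>}) = real m" using m assms(9) by (simp add: field_simps del: of_nat_sum)
  hence sum_ms: "sum ms {..<\<nu>} = m" by (simp only: of_nat_eq_iff)
  have seq: "block_toeplitz_sequence s t \<nu> m f N ms"
  proof
    show "s > 0" "t > 0" "\<nu> > 0" "m > 0" using assms(1,2,3) m by auto
    show "sum (N n) {..<\<nu>} = n" if "n \<ge> \<nu>" for n using assms(6)[OF that] by simp
    show "(\<lambda>n. real (N n j) / real n) \<longlonglongrightarrow> real (ms j) / real m" if "j < \<nu>" for j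
      using assms(7)[OF that] by (simp add: c(1)[OF that])
  qed (use assms(4) c(2) sum_ms in auto)
  interpret block_toeplitz_sequence s t \<nu> m f N ms by (rule seq)
  show ?thesis
  proof (intro conjI impI)
    show "singular_value_distr (s * m) (t * m) (\<lambda>n. block_toeplitz s t \<nu> (N n) f) {-pi..pi} (F_symbol s t \<nu> ms f)"
      by (rule singular_distr)
    assume herm: "\<forall>n\<ge>\<nu>. hermitian_mat (block_toeplitz s t \<nu> (N n) f)"
    hence "dim_row (A \<nu>) = dim_col (A \<nu>)" unfolding hermitian_mat_iff by blast
    hence "s * \<nu> = t * \<nu>" using A_carrier[of \<nu>] sumN[of \<nu>] by auto
    hence st: "t = s" using \<nu> by simp
    interpret h: hermitian_block_toeplitz_sequence s \<nu> m f N ms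
      using seq herm unfolding st
      by (intro hermitian_block_toeplitz_sequence.intro hermitian_block_toeplitz_sequence_axioms.intro) auto
    show "eigenvalue_distr (s * m) (\<lambda>n. block_toeplitz s t \<nu> (N n) f) {-pi..pi} (F_symbol s t \<nu> ms f)"
      unfolding st by (rule h.eigenvalue_distr)
  qed
qed

end
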